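(* Let $R>0$, let $f,g\in{\cal M}_u(d(0,R^-))$ and let $\alpha\in{\cal M}(d(0,R^-))$ be non-identically zero and small with respect to both $f$ and $g$. Let $a\in\mathbb{K}\setminus\{0\}$ and let $n\geq 12$ be an integer. If $f'f^n(f-a)$ and $g'g^n(g-a)$ share $\alpha$ C.M., then either $f=g$ or there exists $h\in{\cal M}(d(0,R^-))$ such that $$f=\frac{a(n+2)}{n+1}\Big(\frac{h^{n+1}-1}{h^{n+2}-1}\Big)h,\qquad g=\frac{a(n+2)}{n+1}\Big(\frac{h^{n+1}-1}{h^{n+2}-1}\Big).$$
   Context: $\mathbb{K}$ is an algebraically closed field of characteristic zero, complete with respect to an ultrametric absolute value $|\cdot|$. $d(0,R^-)=\{x\in\mathbb{K}:|x|<R\}$. ${\cal A}(d(0,R^-))$ is the algebra of power series $\sum_{n\ge0}c_nx^n$ converging in $d(0,R^-)$, ${\cal A}_b(d(0,R^-))$ its subalgebra of those with $\sup_n|c_n|R^n<+\infty$; ${\cal M}(d(0,R^-))$ and ${\cal M}_b(d(0,R^-))$ are their fields of fractions, and ${\cal M}_u(d(0,R^-))={\cal M}(d(0,R^-))\setminus{\cal M}_b(d(0,R^-))$. For $h\in{\cal M}(d(0,R^-))$, $\omega_\gamma(h)$ is $m$ if $h$ has a zero of order $m$ at $\gamma$, $-m$ if a pole of order $m$, $0$ otherwise. For $h$ with no zero or pole at $0$ and $0<r<R$: $Z(r,h)=\sum_{\omega_\gamma(h)>0,\ |\gamma|\leq r}\omega_\gamma(h)(\log r-\log|\gamma|)$,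 $N(r,h)=Z(r,1/h)$, $T(r,h)=\max\{Z(r,h)+\log|h(0)|,N(r,h)\}$. $\alpha$ is small with respect to $f$ if $\lim_{r\to R^-}T(r,\alpha)/T(r,f)=0$ (if $0$ is a zero or pole of $f$ or $\alpha$, one first changes the origin inside the disk; the condition does not depend on this). Two meromorphic functions $F,G$ share $\alpha$ C.M. if $F-\alpha$ and $G-\alpha$ have the same zeroes with the same multiplicities. *)

theory Defs
  imports Complex_Main "HOL-Library.Extended_Nat" "HOL-Computational_Algebra.Computational_Algebra"
begin

text \<open>
  A field with an ultrametric absolute value inducing the metric. Since \<open>absval x = dist x 0\<close>,
  nonnegativity and definiteness of the absolute value are part of the metric axioms. (The library
  constant \<open>norm\<close> is confined to real normed vector spaces, which excludes ultrametric fields.)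
\<close>

class ultrametric_field = field + metric_space +
  fixes absval :: "'a \<Rightarrow> real"
  assumes dist_absval: "dist x y = absval (x - y)"
    and absval_mult: "absval (x * y) = absval x * absval y"
    and absval_add_le_max: "absval (x + y) \<le> max (absval x) (absval y)"

definition open_disk :: "real \<Rightarrow> 'k::ultrametric_field set" where
  "open_disk R = {x. absval x < R}"

definition ps_eval :: "'k::ultrametric_field fps \<Rightarrow> 'k \<Rightarrow> 'k" where
  "ps_eval u x = (\<Sum>n. fps_nth u n * x ^ n)"

definition analytic_disk :: "real \<Rightarrow> 'k::ultrametric_field fps set" where
  "analytic_disk R = {u. \<forall>x\<in>open_disk R. summable (\<lambda>n. fps_nth u n * x ^ n)}"

definition bdd_analytic_disk :: "real \<Rightarrow> 'k::ultrametric_field fps set" where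
  "bdd_analytic_disk R =
     {u \<in> analytic_disk R. bdd_above (range (\<lambda>n. absval (fps_nth u n) * R ^ n))}"

text \<open>
  The rings above are subrings of the domain of formal power series, whose field of fractions is
  the field of formal Laurent series. Their fields of fractions are therefore realised as the
  subfields of formal Laurent series at 0 that consist of all quotients; constants, field operations
  and the derivative are those of Laurent series.
\<close>

definition mero_disk :: "real \<Rightarrow> 'k::ultrametric_field fls set" where
  "mero_disk R = {fps_to_fls u / fps_to_fls v | u v.
     u \<in> analytic_disk R \<and> v \<in> analytic_disk R \<and> v \<noteq> 0}"

definition bdd_mero_disk :: "real \<Rightarrow> 'k::ultrametric_field fls set" where
  "bdd_mero_disk R = {fps_to_fls u / fps_to_fls v | u v.
     u \<in> bdd_analytic_disk R \<and> v \<in> bdd_analytic_disk R \<and> v \<noteq> 0}"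

definition unbdd_mero_disk :: "real \<Rightarrow> 'k::ultrametric_field fls set" where
  "unbdd_mero_disk R = mero_disk R - bdd_mero_disk R"

text \<open>Value at a point \<open>c\<close> of the disk; only meaningful if \<open>c\<close> is not a pole.\<close>

definition mero_eval :: "real \<Rightarrow> 'k::ultrametric_field fls \<Rightarrow> 'k \<Rightarrow> 'k" where
  "mero_eval R h c = (THE y. \<exists>u\<in>analytic_disk R. \<exists>v\<in>analytic_disk R.
     ps_eval v c \<noteq> 0 \<and> h = fps_to_fls u / fps_to_fls v \<and> y = ps_eval u c / ps_eval v c)"

text \<open>
  \<open>h = (x - \<gamma>)\<^sup>m u / v\<close> with \<open>u\<close>, \<open>v\<close> analytic in the disk and nonzero at \<open>\<gamma>\<close>: a zero of order \<open>m\<close>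
  if \<open>m > 0\<close>, a pole of order \<open>-m\<close> if \<open>m < 0\<close>. The zero function has no order.
\<close>

definition has_order_at :: "real \<Rightarrow> 'k::ultrametric_field fls \<Rightarrow> 'k \<Rightarrow> int \<Rightarrow> bool" where
  "has_order_at R h \<gamma> m \<longleftrightarrow> (\<exists>u\<in>analytic_disk R. \<exists>v\<in>analytic_disk R.
     ps_eval u \<gamma> \<noteq> 0 \<and> ps_eval v \<gamma> \<noteq> 0 \<and>
     h = (fls_X - fls_const \<gamma>) powi m * (fps_to_fls u / fps_to_fls v))"

definition omega :: "real \<Rightarrow> 'k::ultrametric_field \<Rightarrow> 'k fls \<Rightarrow> int" where
  "omega R \<gamma> h =
     (if \<exists>m. has_order_at R h \<gamma> m then (THE m. has_order_at R h \<gamma> m) else 0)"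

text \<open>
  The counting and characteristic functions with origin \<open>c\<close> in the disk, i.e. those of
  \<open>x \<mapsto> h (x + c)\<close>; \<open>c\<close> should be neither a zero nor a pole of \<open>h\<close>. For \<open>c = 0\<close>
  these are the usual ones. For \<open>h \<noteq> 0\<close> and \<open>0 < r < R\<close> the sum is finite.
\<close>

definition Zcount :: "real \<Rightarrow> 'k::ultrametric_field \<Rightarrow> real \<Rightarrow> 'k fls \<Rightarrow> real" where
  "Zcount R c r h = (\<Sum>\<gamma> | omega R \<gamma> h > 0 \<and> absval (\<gamma> - c) \<le> r.
     of_int (omega R \<gamma> h) * (ln r - ln (absval (\<gamma> - c))))"

definition Ncount :: "real \<Rightarrow> 'k::ultrametric_field \<Rightarrow> real \<Rightarrow> 'k fls \<Rightarrow> real" where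
  "Ncount R c r h = Zcount R c r (1 / h)"

definition Tchar :: "real \<Rightarrow> 'k::ultrametric_field \<Rightarrow> real \<Rightarrow> 'k fls \<Rightarrow> real" where
  "Tchar R c r h = max (Zcount R c r h + ln (absval (mero_eval R h c))) (Ncount R c r h)"

text \<open>
  The origin \<open>c\<close> may be any point of the disk at which neither function has a zero or a pole:
  \<open>c = 0\<close> if possible, another point otherwise. The condition does not depend on the choice.
\<close>

definition small_wrt :: "real \<Rightarrow> 'k::ultrametric_field fls \<Rightarrow> 'k fls \<Rightarrow> bool" where
  "small_wrt R \<alpha> f \<longleftrightarrow> (\<exists>c\<in>open_disk R. omega R c f = 0 \<and> omega R c \<alpha> = 0 \<and>
     ((\<lambda>r. Tchar R c r \<alpha> / Tchar R c r f) \<longlongrightarrow> 0) (at_left R))"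

text \<open>Multiplicity of \<open>\<gamma>\<close> as a zero: 0 if it is not a zero, infinite for the zero function.\<close>

definition zero_mult :: "real \<Rightarrow> 'k::ultrametric_field \<Rightarrow> 'k fls \<Rightarrow> enat" where
  "zero_mult R \<gamma> h = (if h = 0 then \<infinity> else enat (nat (omega R \<gamma> h)))"

definition share_CM ::
  "real \<Rightarrow> 'k::ultrametric_field fls \<Rightarrow> 'k fls \<Rightarrow> 'k fls \<Rightarrow> bool" where
  "share_CM R F G \<alpha> \<longleftrightarrow>
     (\<forall>\<gamma>\<in>open_disk R. zero_mult R \<gamma> (F - \<alpha>) = zero_mult R \<gamma> (G - \<alpha>))"

end

theory Submission
  imports Defs
begin

text \<open>
  Write \<open>F = f' f\<^sup>n (f - a) / \<alpha>\<close> and \<open>G\<close> likewise for \<open>g\<close>. If the functions \<open>1 / (F - 1)\<close>,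
  \<open>1 / (G - 1)\<close> and \<open>1\<close> are linearly independent, then at a shared point of multiplicity \<open>k\<close> their
  Wronskian \<open>W\<close> has a pole of order at most \<open>3 k\<close>, and Jensen's formula for \<open>G / ((F - 1) (G - 1)\<^sup>2 W)\<close>, whose Gauss norm bounds \<open>max 1 (1 / |F|)\<close> up to a
  constant, gives \<open>(n + 2) T(f) \<le> 6 T(f) + 7 T(g) + o(T(f))\<close>. Adding the same inequality for \<open>g\<close>
  contradicts \<open>n \<ge> 12\<close>, because \<open>T(f)\<close> is unbounded. Otherwise \<open>G\<close> is a Moebius transform of \<open>F\<close>; unless
  \<open>F = G\<close> or \<open>F G = 1\<close>, the zeros of \<open>F - s\<close> for some constant \<open>s \<noteq> 0\<close> are zeros or poles of \<open>G\<close>, and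
  the second main theorem gives the same inequality. If \<open>F G = 1\<close>, the zeros of \<open>f\<close> and \<open>f - a\<close> at which
  \<open>\<alpha>\<close> has neither a zero nor a pole have large multiplicity, which is again impossible. Hence \<open>F = G\<close>; integrating,
  \<open>f\<^bsup>n+1\<^esup> (f - b)\<close> and \<open>g\<^bsup>n+1\<^esup> (g - b)\<close> differ by a constant, which has to vanish, and \<open>h = f / g\<close>.
\<close>

section \<open>Ultrametric absolute values\<close>

text \<open>The definition of \<open>unbdd_mero_disk\<close> is purely algebraic, while every
  estimate needs a characteristic function that exceeds all bounds. The bridge is
  \<open>bounded_of_char_fun_bounded\<close>: a function with bounded characteristic function is a
  quotient of bounded series. The obstacle is a bounded denominator that vanishes at all the poles.
  Over a field that need not be spherically complete, a function with exactly prescribed zeros may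
  fail to exist; one that vanishes to at least the prescribed orders, and possibly elsewhere, is
  enough.

  All analysis goes through Gauss norms at real radii. They are multiplicative, so they extend to
  quotients, and a derivative costs only the factor \<open>1 / r\<close>; hence the lemma on the
  logarithmic derivative is a plain inequality. The link to zeros is the index of the last dominant
  term, which algebraic closedness and completeness turn into an actual number of zeros.

  The bound 12 is the first \<open>n\<close> with \<open>n + 2 > 6 + 7\<close>.\<close>

context ultrametric_field
begin

lemma absval_nonneg [simp]: "absval x \<ge> 0"
  using dist_absval[of x 0] zero_le_dist[of x 0] by simp

lemma absval_eq_0_iff [simp]: "absval x = 0 \<longleftrightarrow> x = 0"
  using dist_absval[of x 0] dist_eq_0_iff[of x 0] by simp

lemma absval_zero [simp]: "absval 0 = 0"
  by simp

lemma absval_pos_iff [simp]: "absval x > 0 \<longleftrightarrow> x \<noteq> 0"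
  using absval_nonneg[of x] by (auto simp: less_le simp del: absval_nonneg)

lemma absval_one [simp]: "absval 1 = 1"
  using absval_mult[of 1 1] by simp

lemma absval_uminus [simp]: "absval (- x) = absval x"
proof -
  have "absval (- x) = dist 0 x" by (simp add: dist_absval)
  then show ?thesis by (simp add: dist_commute dist_absval)
qed

lemma absval_minus_commute: "absval (x - y) = absval (y - x)"
  using absval_uminus[of "x - y"] by simp

lemma absval_power [simp]: "absval (x ^ n) = absval x ^ n"
  by (induction n) (simp_all add: absval_mult)

lemma absval_inverse: "absval (inverse x) = inverse (absval x)"
proof (cases "x = 0")
  case False
  then have "absval x * absval (inverse x) = 1"
    by (simp flip: absval_mult)
  then show ?thesis using False by (simp add: field_simps)
qed simp

lemma absval_triangle: "absval (x + y) \<le> absval x + absval y"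
  by (rule order.trans[OF absval_add_le_max]) simp

lemma absval_diff_le_max: "absval (x - y) \<le> max (absval x) (absval y)"
  using absval_add_le_max[of x "- y"] by simp

lemma absval_add_le: "absval x \<le> B \<Longrightarrow> absval y \<le> B \<Longrightarrow> absval (x + y) \<le> B"
  using absval_add_le_max[of x y] by simp

lemma absval_diff_le: "absval x \<le> B \<Longrightarrow> absval y \<le> B \<Longrightarrow> absval (x - y) \<le> B"
  using absval_diff_le_max[of x y] by simp

text \<open>Isosceles principle: \<open>y\<close> is the difference of \<open>x + y\<close> and
  \<open>x\<close>, and a maximum that has to reach \<open>absval y\<close> cannot be attained at
  the smaller \<open>x\<close>.\<close>

lemma absval_add_eq: "absval x < absval y \<Longrightarrow> absval (x + y) = absval y"
proof -
  assume lt: "absval x < absval y"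
  have 1: "absval (x + y) \<le> absval y"
    using absval_add_le_max[of x y] lt by (simp add: max_absorb2 less_imp_le)
  have "absval y \<le> max (absval (x + y)) (absval x)"
    using absval_diff_le_max[of "x + y" x] by simp
  then have "absval y \<le> absval (x + y)" using lt by (simp add: le_max_iff_disj)
  with 1 show ?thesis by simp
qed

lemma absval_diff_eq: "absval x < absval y \<Longrightarrow> absval (y - x) = absval y"
  using absval_add_eq[of "- x" y] by (simp add: algebra_simps)

lemma absval_sum_le:
  "B \<ge> 0 \<Longrightarrow> (\<And>i. i \<in> S \<Longrightarrow> absval (f i) \<le> B) \<Longrightarrow> absval (sum f S) \<le> B"
proof (induction S rule: infinite_finite_induct)
  case (insert x F)
  then have "absval (f x) \<le> B" "absval (sum f F) \<le> B" by simp_all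
  then show ?case using insert by (simp add: absval_add_le)
qed simp_all

lemma absval_sum_less:
  "B > 0 \<Longrightarrow> (\<And>i. i \<in> S \<Longrightarrow> absval (f i) < B) \<Longrightarrow> absval (sum f S) < B"
proof (induction S rule: infinite_finite_induct)
  case (insert x F)
  have "max (absval (f x)) (absval (sum f F)) < B"
    unfolding max_less_iff_conj using insert by simp
  then show ?case
    using le_less_trans[OF absval_add_le_max] insert by simp
qed simp_all

text \<open>This is why differentiation, which multiplies coefficients by integers, cannot enlarge
  them (\<open>conv_at_deriv\<close>).\<close>

lemma absval_of_nat_le_1: "absval (of_nat n) \<le> 1"
  by (induction n) (simp_all add: absval_add_le)

end

text \<open>Gives access to the generic laws for limits and series. It covers addition; products are
  handled through \<open>absval\<close>, as in \<open>sums_cmult\<close>.\<close>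

instance ultrametric_field \<subseteq> topological_ab_group_add
proof
  fix a b :: 'a
  have fst: "(fst \<longlongrightarrow> a) (nhds a \<times>\<^sub>F nhds b)"
    unfolding filterlim_def by (rule filtermap_fst_prod_filter)
  have snd: "(snd \<longlongrightarrow> b) (nhds a \<times>\<^sub>F nhds b)"
    unfolding filterlim_def by (rule filtermap_snd_prod_filter)
  have lim: "((\<lambda>x. dist (fst x) a + dist (snd x) b) \<longlongrightarrow> 0) (nhds a \<times>\<^sub>F nhds b)"
    using tendsto_add[OF fst[THEN tendsto_dist_iff[THEN iffD1]] snd[THEN tendsto_dist_iff[THEN iffD1]]]
    unfolding add_0_right .
  have le: "dist (x + y) (a + b) \<le> dist x a + dist y b" for x y
    unfolding dist_absval add_diff_add by (rule absval_triangle)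
  show "((\<lambda>x. fst x + snd x) \<longlongrightarrow> a + b) (nhds a \<times>\<^sub>F nhds b)"
  proof (rule tendsto_dist_iff[THEN iffD2], rule tendsto_sandwich[OF _ _ tendsto_const lim])
    show "\<forall>\<^sub>F x in nhds a \<times>\<^sub>F nhds b. 0 \<le> dist (fst x + snd x) (a + b)"
      by (rule always_eventually) (rule allI, rule zero_le_dist)
    show "\<forall>\<^sub>F x in nhds a \<times>\<^sub>F nhds b. dist (fst x + snd x) (a + b) \<le> dist (fst x) a + dist (snd x) b"
      by (rule always_eventually) (rule allI, rule le)
  qed
  have eq: "dist (- x) (- a) = dist x a" for x
    unfolding dist_absval minus_diff_minus by (rule absval_uminus)
  show "(uminus \<longlongrightarrow> - a) (nhds a)"
  proof (rule tendsto_dist_iff[THEN iffD2])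
    have "((\<lambda>x. x) \<longlongrightarrow> a) (nhds a)" by (rule filterlim_ident)
    then have "((\<lambda>x. dist x a) \<longlongrightarrow> 0) (nhds a)"
      by (simp only: tendsto_dist_iff[of "\<lambda>x. x" a "nhds a"])
    then show "((\<lambda>x. dist (- x) (- a)) \<longlongrightarrow> 0) (nhds a)"
      by (simp only: eq)
  qed
qed

lemma tendsto_absval_iff:
  fixes h :: "'b \<Rightarrow> 'k::ultrametric_field"
  shows "(h \<longlongrightarrow> c) F \<longleftrightarrow> ((\<lambda>x. absval (h x - c)) \<longlongrightarrow> 0) F"
  by (subst tendsto_dist_iff) (simp add: dist_absval)

lemma sums_cmult:
  fixes f :: "nat \<Rightarrow> 'k::ultrametric_field"
  assumes "f sums s"
  shows "(\<lambda>n. c * f n) sums (c * s)"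
proof -
  have "(\<lambda>n. absval c * absval ((\<Sum>i<n. f i) - s)) \<longlonglongrightarrow> absval c * 0"
    using assms by (intro tendsto_mult tendsto_const) (simp add: sums_def tendsto_absval_iff)
  then show ?thesis
    unfolding sums_def by (subst tendsto_absval_iff)
      (simp add: absval_mult[symmetric] right_diff_distrib sum_distrib_left)
qed

text \<open>Close to a limit \<open>L \<noteq> 0\<close> the terms have exactly the absolute value
  of \<open>L\<close>, by the isosceles principle.\<close>

lemma absval_lim_le:
  fixes X :: "nat \<Rightarrow> 'k::ultrametric_field"
  assumes "X \<longlonglongrightarrow> L" "\<And>n. absval (X n) \<le> B"
  shows "absval L \<le> B"
proof (rule ccontr)
  assume "\<not> ?thesis"
  then have L: "absval L > B" by simp
  have B: "B \<ge> 0" using assms(2)[of 0] absval_nonneg[of "X 0"] by linarith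
  have "(\<lambda>n. absval (X n - L)) \<longlonglongrightarrow> 0"
    using assms(1) by (rule tendsto_absval_iff[THEN iffD1])
  then have "\<forall>\<^sub>F n in sequentially. absval (X n - L) < absval L"
    by (rule order_tendstoD(2)) (use L B in linarith)
  then obtain n where n: "absval (X n - L) < absval L"
    unfolding eventually_sequentially by blast
  have "absval (X n) = absval L"
    using absval_add_eq[OF n] by simp
  then show False using assms(2)[of n] L by simp
qed

lemma absval_sums_le:
  fixes f :: "nat \<Rightarrow> 'k::ultrametric_field"
  assumes "f sums s" "\<And>n. absval (f n) \<le> B"
  shows "absval s \<le> B"
proof -
  have "B \<ge> 0" using assms(2)[of 0] absval_nonneg[of "f 0"] by linarith
  then have "absval (\<Sum>i<n. f i) \<le> B" for n
    using assms(2) by (intro absval_sum_le)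
  then show ?thesis by (rule absval_lim_le[OF assms(1)[unfolded sums_def]])
qed

lemma null_bounded:
  fixes f :: "nat \<Rightarrow> real"
  assumes "f \<longlonglongrightarrow> 0"
  obtains B where "B > 0" "\<And>n. f n \<le> B"
proof -
  have "Bseq f" using assms by (intro convergent_imp_Bseq) (auto simp: convergent_def)
  then obtain B where "B > 0" "\<And>n. \<bar>f n\<bar> \<le> B" by (auto simp: Bseq_def)
  then show ?thesis by (intro that[of B]) (auto simp: abs_le_iff)
qed

text \<open>The difference of two distant terms is a sum of consecutive steps, and the ultrametric
  inequality bounds it by the largest of them. This is the source of the convergence criterion
  \<open>summable_null\<close>.\<close>

lemma Cauchy_of_diff_null:
  fixes X :: "nat \<Rightarrow> 'k::ultrametric_field"
  assumes "(\<lambda>n. absval (X (Suc n) - X n)) \<longlonglongrightarrow> 0"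
  shows "Cauchy X"
proof (rule metric_CauchyI)
  fix e :: real assume e: "e > 0"
  then obtain N where N: "\<And>n. n \<ge> N \<Longrightarrow> absval (X (Suc n) - X n) < e"
    using order_tendstoD(2)[OF assms e] by (auto simp: eventually_sequentially)
  have *: "absval (X (n + k) - X n) < e" if "n \<ge> N" for n k
  proof (induction k)
    case (Suc k)
    have "X (n + Suc k) - X n = (X (Suc (n + k)) - X (n + k)) + (X (n + k) - X n)" by simp
    also have "absval \<dots> < e"
      using absval_add_le_max[of "X (Suc (n + k)) - X (n + k)" "X (n + k) - X n"] Suc N[of "n + k"] that
      by (auto simp: max_def split: if_splits)
    finally show ?case .
  qed (use e in simp)
  have "dist (X m) (X n) < e" if "m \<ge> N" "n \<ge> N" for m n
  proof (cases "m \<le> n")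
    case True
    then show ?thesis using *[of m "n - m"] that by (simp add: dist_absval absval_minus_commute)
  next
    case False
    then show ?thesis using *[of n "m - n"] that by (simp add: dist_absval)
  qed
  then show "\<exists>M. \<forall>m\<ge>M. \<forall>n\<ge>M. dist (X m) (X n) < e" by blast
qed

lemma summable_null:
  fixes f :: "nat \<Rightarrow> 'k::{ultrametric_field, complete_space}"
  assumes "(\<lambda>n. absval (f n)) \<longlonglongrightarrow> 0"
  shows "summable f"
proof -
  have eq: "(\<Sum>i<Suc n. f i) - (\<Sum>i<n. f i) = f n" for n by simp
  have "Cauchy (\<lambda>n. \<Sum>i<n. f i)"
    by (rule Cauchy_of_diff_null) (simp only: eq assms)
  then show ?thesis
    unfolding summable_iff_convergent by (rule Cauchy_convergent)
qed

lemma summable_imp_null: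
  fixes f :: "nat \<Rightarrow> 'k::ultrametric_field"
  assumes "summable f"
  shows "(\<lambda>n. absval (f n)) \<longlonglongrightarrow> 0"
proof -
  obtain s where s: "(\<lambda>n. \<Sum>i<n. f i) \<longlonglongrightarrow> s"
    using assms by (auto simp: summable_def sums_def)
  have "(\<lambda>n. (\<Sum>i<Suc n. f i) - (\<Sum>i<n. f i)) \<longlonglongrightarrow> s - s"
    by (intro tendsto_diff s LIMSEQ_Suc[OF s])
  then show ?thesis by (simp add: tendsto_absval_iff)
qed

section \<open>Gauss norms of power series\<close>

text \<open>The radius is an arbitrary real number, not only the absolute value of a point;
  \<open>analytic_iff\<close> makes the link.\<close>

definition conv_at :: "real \<Rightarrow> 'k::ultrametric_field fps \<Rightarrow> bool" where
  "conv_at r u \<longleftrightarrow> (\<lambda>n. absval (fps_nth u n) * r ^ n) \<longlonglongrightarrow> 0"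

definition gauss_norm :: "real \<Rightarrow> 'k::ultrametric_field fps \<Rightarrow> real" where
  "gauss_norm r u = (SUP n. absval (fps_nth u n) * r ^ n)"

text \<open>The index of the last dominant term: by Weierstrass preparation it is the number of zeros
  in the closed disk of radius \<open>r\<close>.\<close>

definition dom_index :: "real \<Rightarrow> 'k::ultrametric_field fps \<Rightarrow> nat" where
  "dom_index r u = (GREATEST n. absval (fps_nth u n) * r ^ n = gauss_norm r u)"

lemma conv_at_bdd:
  assumes "conv_at r u"
  shows "bdd_above (range (\<lambda>n. absval (fps_nth u n) * r ^ n))"
proof -
  obtain B where "\<And>n. absval (fps_nth u n) * r ^ n \<le> B"
    using null_bounded[OF assms[unfolded conv_at_def]] by blast
  then show ?thesis by (rule bdd_aboveI2)
qed

lemma gauss_norm_ge: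
  assumes "conv_at r u"
  shows "absval (fps_nth u n) * r ^ n \<le> gauss_norm r u"
  unfolding gauss_norm_def by (rule cSUP_upper[OF _ conv_at_bdd[OF assms]]) simp

lemma gauss_norm_le:
  assumes "\<And>n. absval (fps_nth u n) * r ^ n \<le> B"
  shows "gauss_norm r u \<le> B"
  unfolding gauss_norm_def by (rule cSUP_least) (use assms in auto)

lemma gauss_norm_nonneg:
  assumes "conv_at r u"
  shows "gauss_norm r u \<ge> 0"
  using gauss_norm_ge[OF assms, of 0] by (simp add: order_trans[OF absval_nonneg])

lemma gauss_norm_zero [simp]: "gauss_norm r 0 = 0"
  by (simp add: gauss_norm_def)

lemma gauss_norm_pos:
  assumes "conv_at r u" "r > 0" "u \<noteq> 0"
  shows "gauss_norm r u > 0"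
proof -
  obtain n where "fps_nth u n \<noteq> 0" using assms(3) by (auto simp: fps_eq_iff)
  then have "absval (fps_nth u n) * r ^ n > 0" using assms(2) by simp
  then show ?thesis using gauss_norm_ge[OF assms(1), of n] by linarith
qed

text \<open>The terms tend to 0 while the supremum is positive, so only finitely many of them
  compete for it: it is attained, and there is a last index where this happens.\<close>

lemma dom_index:
  assumes "conv_at r u" "r > 0" "u \<noteq> 0"
  shows "absval (fps_nth u (dom_index r u)) * r ^ dom_index r u = gauss_norm r u"
    and "n > dom_index r u \<Longrightarrow> absval (fps_nth u n) * r ^ n < gauss_norm r u"
proof -
  define t where "t = (\<lambda>n. absval (fps_nth u n) * r ^ n)"
  note pos = gauss_norm_pos[OF assms]
  have "\<forall>\<^sub>F n in sequentially. t n < gauss_norm r u"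
    using assms(1) pos unfolding conv_at_def t_def by (rule order_tendstoD(2))
  then obtain N where N: "\<And>n. n \<ge> N \<Longrightarrow> t n < gauss_norm r u"
    by (auto simp: eventually_sequentially)
  have ex: "\<exists>n. t n = gauss_norm r u"
  proof (rule ccontr)
    assume "\<nexists>n. t n = gauss_norm r u"
    then have lt: "t n < gauss_norm r u" for n
      using gauss_norm_ge[OF assms(1), of n] by (simp add: t_def less_le)
    have *: "\<forall>\<^sub>F n in sequentially. t n < gauss_norm r u / 2"
      using assms(1) pos unfolding conv_at_def t_def by (intro order_tendstoD(2)[of _ 0]) auto
    then obtain M where M: "\<And>n. n \<ge> M \<Longrightarrow> t n < gauss_norm r u / 2"
      by (auto simp: eventually_sequentially)
    \<comment> \<open>If the supremum were not attained, \<open>B\<close> would be a smaller upper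
      bound: the maximum of finitely many terms below it and of one half of it.\<close>
    define B where "B = Max (insert (gauss_norm r u / 2) (t ` {..<M}))"
    have "t n \<le> B" for n
    proof (cases "n < M")
      case True then show ?thesis unfolding B_def by (intro Max_ge) auto
    next
      case False
      then have "t n \<le> gauss_norm r u / 2" using M[of n] by simp
      also have "\<dots> \<le> B" unfolding B_def by (intro Max_ge) auto
      finally show ?thesis .
    qed
    then have "gauss_norm r u \<le> B" by (intro gauss_norm_le) (simp add: t_def)
    moreover have "B < gauss_norm r u" unfolding B_def using lt pos by (subst Max_less_iff) auto
    ultimately show False by simp
  qed
  have bnd: "t n = gauss_norm r u \<Longrightarrow> n \<le> N" for n
    using N[of n] by (cases "n \<le> N") auto
  show "absval (fps_nth u (dom_index r u)) * r ^ dom_index r u = gauss_norm r u"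
    using GreatestI_ex_nat[OF ex bnd] by (simp add: dom_index_def t_def)
  have gr: "t n = gauss_norm r u \<Longrightarrow> n \<le> dom_index r u" for n
    using Greatest_le_nat[of "\<lambda>n. t n = gauss_norm r u" n N] bnd by (simp add: dom_index_def t_def)
  show "n > dom_index r u \<Longrightarrow> absval (fps_nth u n) * r ^ n < gauss_norm r u"
    using gr[of n] gauss_norm_ge[OF assms(1), of n] by (fastforce simp: t_def less_le)
qed

lemma dom_index_unique:
  assumes "conv_at r u" "r > 0"
    and "absval (fps_nth u N) * r ^ N = M" "M > 0"
    and "\<And>n. absval (fps_nth u n) * r ^ n \<le> M"
    and "\<And>n. n > N \<Longrightarrow> absval (fps_nth u n) * r ^ n < M"
  shows "gauss_norm r u = M" "dom_index r u = N"
proof -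
  show g: "gauss_norm r u = M"
    using gauss_norm_le[of u r M] assms gauss_norm_ge[OF assms(1), of N] by force
  show "dom_index r u = N"
    unfolding dom_index_def g using assms(3) 
  proof (rule Greatest_equality)
    fix n assume "absval (fps_nth u n) * r ^ n = M"
    then show "n \<le> N" using assms(6)[of n] by (cases "n > N") auto
  qed
qed

lemma conv_at_zero [simp]: "conv_at r 0" by (simp add: conv_at_def)

lemma conv_at_eventually_zero:
  assumes "\<And>n. n \<ge> N \<Longrightarrow> fps_nth u n = 0"
  shows "conv_at r u"
  unfolding conv_at_def
  by (rule tendsto_eventually) (use assms in \<open>auto simp: eventually_sequentially\<close>)

lemma conv_at_const [simp]: "conv_at r (fps_const c)"
  by (rule conv_at_eventually_zero[of 1]) auto

lemma conv_at_add:
  assumes "conv_at r u" "conv_at r v" "r \<ge> 0"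
  shows "conv_at r (u + v)"
  unfolding conv_at_def
proof (rule tendsto_sandwich[OF _ _ tendsto_const])
  show "(\<lambda>n. absval (fps_nth u n) * r ^ n + absval (fps_nth v n) * r ^ n) \<longlonglongrightarrow> 0"
    using tendsto_add[OF assms(1,2)[unfolded conv_at_def]] by simp
  show "\<forall>\<^sub>F n in sequentially. absval (fps_nth (u + v) n) * r ^ n
      \<le> absval (fps_nth u n) * r ^ n + absval (fps_nth v n) * r ^ n"
    unfolding distrib_right[symmetric] fps_add_nth using assms(3)
    by (intro always_eventually allI mult_right_mono absval_triangle) simp
  show "\<forall>\<^sub>F n in sequentially. 0 \<le> absval (fps_nth (u + v) n) * r ^ n"
    using assms(3) by (intro always_eventually allI mult_nonneg_nonneg) auto
qed

lemma conv_at_uminus [simp]: "conv_at r (- u) \<longleftrightarrow> conv_at r u"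
  by (simp add: conv_at_def)

lemma conv_at_diff:
  assumes "conv_at r u" "conv_at r v" "r \<ge> 0"
  shows "conv_at r (u - v)"
  using conv_at_add[of r u "- v"] assms by simp

lemma absval_mult_weight:
  assumes "k \<le> n"
  shows "(absval a * r ^ k) * (absval b * r ^ (n - k)) = absval (a * b) * r ^ n"
proof -
  have "(absval a * r ^ k) * (absval b * r ^ (n - k)) = absval a * absval b * (r ^ k * r ^ (n - k))"
    by (simp only: mult_ac)
  also have "r ^ k * r ^ (n - k) = r ^ n"
    unfolding power_add[symmetric] using assms by simp
  finally show ?thesis by (simp add: absval_mult)
qed

lemma conv_at_mult:
  assumes "conv_at r u" "conv_at r v" "r > 0"
  shows "conv_at r (u * v)"
proof -
  obtain B where B: "B > 0" "\<And>n. absval (fps_nth u n) * r ^ n \<le> B"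
    using null_bounded[OF assms(1)[unfolded conv_at_def]] by blast
  obtain C where C: "C > 0" "\<And>n. absval (fps_nth v n) * r ^ n \<le> C"
    using null_bounded[OF assms(2)[unfolded conv_at_def]] by blast
  show ?thesis unfolding conv_at_def
  proof (rule LIMSEQ_I)
    fix e :: real assume e: "e > 0"
    have "\<forall>\<^sub>F n in sequentially. absval (fps_nth u n) * r ^ n < e / (2 * C)"
      using assms(1) e C unfolding conv_at_def by (intro order_tendstoD(2)[of _ 0]) auto
    then obtain N where N: "\<And>n. n \<ge> N \<Longrightarrow> absval (fps_nth u n) * r ^ n < e / (2 * C)"
      by (auto simp: eventually_sequentially)
    have "\<forall>\<^sub>F n in sequentially. absval (fps_nth v n) * r ^ n < e / (2 * B)"
      using assms(2) e B unfolding conv_at_def by (intro order_tendstoD(2)[of _ 0]) auto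
    then obtain M where M: "\<And>n. n \<ge> M \<Longrightarrow> absval (fps_nth v n) * r ^ n < e / (2 * B)"
      by (auto simp: eventually_sequentially)
    \<comment> \<open>Two indices with sum at least \<open>N + M\<close> cannot both be small: one
      factor lies in its small tail and the other one is bounded.\<close>
    have "absval (fps_nth (u * v) n) * r ^ n \<le> e / 2" if n: "n \<ge> N + M" for n
    proof -
      have r: "r > 0" by (rule assms(3))
      have "absval (fps_nth (u * v) n) \<le> (e / 2) / r ^ n"
        unfolding fps_mult_nth
      proof (rule absval_sum_le)
        show "0 \<le> e / 2 / r ^ n" using e r by simp
        fix i assume i: "i \<in> {0..n}"
        have "(absval (fps_nth u i) * r ^ i) * (absval (fps_nth v (n - i)) * r ^ (n - i)) \<le> e / 2"
        proof (cases "i \<ge> N")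
          case True
          have "(absval (fps_nth u i) * r ^ i) * (absval (fps_nth v (n - i)) * r ^ (n - i))
              \<le> e / (2 * C) * C"
            using N[OF True] C(2)[of "n - i"] e C(1) r by (intro mult_mono) auto
          then show ?thesis using C by simp
        next
          case False
          then have *: "n - i \<ge> M" using n i by auto
          have "(absval (fps_nth u i) * r ^ i) * (absval (fps_nth v (n - i)) * r ^ (n - i))
              \<le> B * (e / (2 * B))"
            using M[OF *] B(2)[of i] e B(1) r by (intro mult_mono) auto
          then show ?thesis using B by simp
        qed
        moreover have "(absval (fps_nth u i) * r ^ i) * (absval (fps_nth v (n - i)) * r ^ (n - i))
            = absval (fps_nth u i * fps_nth v (n - i)) * r ^ n"
          using i by (intro absval_mult_weight) simp
        ultimately show "absval (fps_nth u i * fps_nth v (n - i)) \<le> (e / 2) / r ^ n"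
          using r by (simp add: pos_le_divide_eq)
      qed
      then show ?thesis using r by (simp add: pos_le_divide_eq)
    qed
    then show "\<exists>no. \<forall>n\<ge>no. norm (absval (fps_nth (u * v) n) * r ^ n - 0) < e"
    proof (intro exI[of _ "N + M"] allI impI)
      fix n assume *: "n \<ge> N + M"
        and H: "\<And>n. N + M \<le> n \<Longrightarrow> absval (fps_nth (u * v) n) * r ^ n \<le> e / 2"
      have "absval (fps_nth (u * v) n) * r ^ n \<ge> 0" using assms(3) by (intro mult_nonneg_nonneg) auto
      then show "norm (absval (fps_nth (u * v) n) * r ^ n - 0) < e"
        using H[OF *] e unfolding real_norm_def by linarith
    qed
  qed
qed

lemma gauss_norm_add_le:
  assumes "conv_at r u" "conv_at r v" "r > 0"
  shows "gauss_norm r (u + v) \<le> max (gauss_norm r u) (gauss_norm r v)"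
proof (rule gauss_norm_le)
  fix n
  have "absval (fps_nth (u + v) n) * r ^ n
      \<le> max (absval (fps_nth u n)) (absval (fps_nth v n)) * r ^ n"
    using absval_add_le_max assms(3) by (intro mult_right_mono) auto
  also have "\<dots> \<le> max (gauss_norm r u) (gauss_norm r v)"
    using gauss_norm_ge[OF assms(1), of n] gauss_norm_ge[OF assms(2), of n]
    by (auto simp: max_def split: if_splits)
  finally show "absval (fps_nth (u + v) n) * r ^ n \<le> max (gauss_norm r u) (gauss_norm r v)" .
qed

lemma gauss_norm_uminus [simp]: "gauss_norm r (- u) = gauss_norm r u"
  by (simp add: gauss_norm_def)

text \<open>Gauss's lemma. In the coefficient of the product at the sum of the two last dominant
  indices, the two dominant terms meet in the only summand of maximal weight, so nothing cancels; at
  every later index all summands are strictly lighter.\<close>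

lemma
  assumes "conv_at r u" "conv_at r v" "r > 0" "u \<noteq> 0" "v \<noteq> 0"
  shows gauss_norm_mult_nonzero: "gauss_norm r (u * v) = gauss_norm r u * gauss_norm r v"
    and dom_index_mult: "dom_index r (u * v) = dom_index r u + dom_index r v"
proof -
  define p where "p = (\<lambda>n. absval (fps_nth u n) * r ^ n)"
  define q where "q = (\<lambda>n. absval (fps_nth v n) * r ^ n)"
  define i j where "i = dom_index r u" and "j = dom_index r v"
  define A B where "A = gauss_norm r u" and "B = gauss_norm r v"
  have AB: "A > 0" "B > 0"
    using gauss_norm_pos[of r u] gauss_norm_pos[of r v] assms by (auto simp: A_def B_def)
  have p: "p n \<le> A" "p n \<ge> 0" for n
    using gauss_norm_ge[OF assms(1)] assms(3) by (auto simp: p_def A_def)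
  have q: "q n \<le> B" "q n \<ge> 0" for n
    using gauss_norm_ge[OF assms(2)] assms(3) by (auto simp: q_def B_def)
  have pi: "p i = A" and qj: "q j = B"
    using dom_index(1)[of r u] dom_index(1)[of r v] assms
    by (auto simp: p_def q_def i_def j_def A_def B_def)
  have plt: "n > i \<Longrightarrow> p n < A" for n
    using dom_index(2)[OF assms(1,3,4)] by (auto simp: p_def i_def A_def)
  have qlt: "n > j \<Longrightarrow> q n < B" for n
    using dom_index(2)[OF assms(2,3,5)] by (auto simp: q_def j_def B_def)
  have prod: "absval (fps_nth u k * fps_nth v (n - k)) = p k * q (n - k) / r ^ n" if "k \<le> n" for k n
    unfolding p_def q_def absval_mult_weight[OF that] using assms(3) by simp
  have lt: "p k * q (n - k) < A * B" if "k \<le> n" "n > i + j \<or> (n = i + j \<and> k \<noteq> i)" for k n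
  proof (cases "k > i")
    case True
    have "p k * q (n - k) \<le> p k * B" using p q by (intro mult_left_mono) auto
    also have "\<dots> < A * B" using plt[OF True] AB by simp
    finally show ?thesis .
  next
    case False
    then have "n - k > j" using that by auto
    then have "q (n - k) < B" by (rule qlt)
    then have "A * q (n - k) < A * B" using AB by simp
    moreover have "p k * q (n - k) \<le> A * q (n - k)" using p q by (intro mult_right_mono) auto
    ultimately show ?thesis by linarith
  qed
  have le: "absval (fps_nth (u * v) n) * r ^ n \<le> A * B" for n
  proof -
    have "absval (fps_nth (u * v) n) \<le> A * B / r ^ n"
      unfolding fps_mult_nth
    proof (rule absval_sum_le)
      show "0 \<le> A * B / r ^ n" using AB assms(3) by simp
      fix k assume "k \<in> {0..n}"
      then have "k \<le> n" by simp
      show "absval (fps_nth u k * fps_nth v (n - k)) \<le> A * B / r ^ n"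
        unfolding prod[OF \<open>k \<le> n\<close>] using p[of k] q[of "n - k"] AB assms(3)
        by (intro divide_right_mono mult_mono) auto
    qed
    then show ?thesis using assms(3) by (simp add: pos_le_divide_eq)
  qed
  have less: "absval (fps_nth (u * v) n) * r ^ n < A * B" if "n > i + j" for n
  proof -
    have "absval (fps_nth (u * v) n) < A * B / r ^ n"
      unfolding fps_mult_nth
    proof (rule absval_sum_less)
      show "0 < A * B / r ^ n" using AB assms(3) by simp
      fix k assume "k \<in> {0..n}"
      then have "k \<le> n" by simp
      show "absval (fps_nth u k * fps_nth v (n - k)) < A * B / r ^ n"
        unfolding prod[OF \<open>k \<le> n\<close>] using lt[of k n] that assms(3) \<open>k \<le> n\<close>
        by (intro divide_strict_right_mono) auto
    qed
    then show ?thesis using assms(3) by (simp add: pos_less_divide_eq)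
  qed
  have eq: "absval (fps_nth (u * v) (i + j)) * r ^ (i + j) = A * B"
  proof -
    let ?S = "\<Sum>k\<in>{0..i+j} - {i}. fps_nth u k * fps_nth v (i + j - k)"
    have "fps_nth (u * v) (i + j) = fps_nth u i * fps_nth v j + ?S"
      unfolding fps_mult_nth by (subst sum.remove[of _ i]) auto
    moreover have s: "absval ?S < A * B / r ^ (i + j)"
    proof (rule absval_sum_less)
      show "0 < A * B / r ^ (i + j)" using AB assms(3) by simp
      fix k assume "k \<in> {0..i + j} - {i}"
      then have "k \<le> i + j" "k \<noteq> i" by auto
      show "absval (fps_nth u k * fps_nth v (i + j - k)) < A * B / r ^ (i + j)"
        unfolding prod[OF \<open>k \<le> i + j\<close>] using lt[of k "i + j"] assms(3) \<open>k \<le> i + j\<close> \<open>k \<noteq> i\<close>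
        by (intro divide_strict_right_mono) auto
    qed
    moreover have m: "absval (fps_nth u i * fps_nth v j) = A * B / r ^ (i + j)"
      using prod[of i "i + j"] pi qj by simp
    ultimately have "absval (fps_nth (u * v) (i + j)) = A * B / r ^ (i + j)"
      using absval_add_eq[of ?S "fps_nth u i * fps_nth v j"] by (simp add: add.commute)
    then show ?thesis using assms(3) by simp
  qed
  have c: "conv_at r (u * v)" by (rule conv_at_mult[OF assms(1-3)])
  show "gauss_norm r (u * v) = gauss_norm r u * gauss_norm r v"
    using dom_index_unique(1)[OF c assms(3) eq _ le less] AB by (simp add: A_def B_def)
  show "dom_index r (u * v) = dom_index r u + dom_index r v"
    using dom_index_unique(2)[OF c assms(3) eq _ le less] AB by (simp add: i_def j_def)
qed

lemma gauss_norm_mult: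
  assumes "conv_at r u" "conv_at r v" "r > 0"
  shows "gauss_norm r (u * v) = gauss_norm r u * gauss_norm r v"
  using gauss_norm_mult_nonzero[OF assms] by (cases "u = 0 \<or> v = 0") auto

lemma gauss_norm_const [simp]:
  assumes "r > 0"
  shows "gauss_norm r (fps_const c) = absval c"
proof (rule antisym)
  show "gauss_norm r (fps_const c) \<le> absval c" by (rule gauss_norm_le) auto
  show "absval c \<le> gauss_norm r (fps_const c)" using gauss_norm_ge[of r "fps_const c" 0] by simp
qed

lemma conv_at_deriv:
  assumes "conv_at r u" "r > 0"
  shows "conv_at r (fps_deriv u)"
    and "gauss_norm r (fps_deriv u) \<le> gauss_norm r u / r"
proof -
  have le: "absval (fps_nth (fps_deriv u) n) * r ^ n \<le> absval (fps_nth u (Suc n)) * r ^ Suc n / r" for n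
  proof -
    have "absval (of_nat (Suc n)) * absval (fps_nth u (Suc n)) \<le> 1 * absval (fps_nth u (Suc n))"
      by (intro mult_right_mono absval_of_nat_le_1) auto
    then have "absval (fps_nth (fps_deriv u) n) \<le> absval (fps_nth u (Suc n))"
      by (simp add: absval_mult del: of_nat_Suc)
    then have "absval (fps_nth (fps_deriv u) n) * r ^ n \<le> absval (fps_nth u (Suc n)) * r ^ n"
      using assms(2) by (intro mult_right_mono) auto
    then show ?thesis using assms(2) by simp
  qed
  show "conv_at r (fps_deriv u)"
    unfolding conv_at_def
  proof (rule tendsto_sandwich[OF _ _ tendsto_const])
    show "(\<lambda>n. absval (fps_nth u (Suc n)) * r ^ Suc n / r) \<longlonglongrightarrow> 0"
      using tendsto_divide[OF LIMSEQ_Suc[OF assms(1)[unfolded conv_at_def]] tendsto_const[of r]] assms(2)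
      by simp
    show "\<forall>\<^sub>F n in sequentially. absval (fps_nth (fps_deriv u) n) * r ^ n
        \<le> absval (fps_nth u (Suc n)) * r ^ Suc n / r"
      using le by (intro always_eventually allI)
    show "\<forall>\<^sub>F n in sequentially. 0 \<le> absval (fps_nth (fps_deriv u) n) * r ^ n"
      using assms(2) by (intro always_eventually allI mult_nonneg_nonneg) auto
  qed
  show "gauss_norm r (fps_deriv u) \<le> gauss_norm r u / r"
  proof (rule gauss_norm_le)
    fix n
    have "absval (fps_nth u (Suc n)) * r ^ Suc n / r \<le> gauss_norm r u / r"
      using gauss_norm_ge[OF assms(1), of "Suc n"] assms(2) by (intro divide_right_mono) auto
    then show "absval (fps_nth (fps_deriv u) n) * r ^ n \<le> gauss_norm r u / r"
      using le[of n] by linarith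
  qed
qed

definition lin_fps :: "'k::ultrametric_field \<Rightarrow> 'k fps" where
  "lin_fps \<gamma> = fps_X - fps_const \<gamma>"

lemma lin_fps_nth: "fps_nth (lin_fps \<gamma>) n = (if n = 0 then - \<gamma> else if n = 1 then 1 else 0)"
  by (simp add: lin_fps_def fps_X_def)

lemma lin_fps_nonzero [simp]: "lin_fps \<gamma> \<noteq> 0"
  using lin_fps_nth[of \<gamma> 1] by (metis fps_zero_nth one_neq_zero zero_neq_one)

lemma lin_fps_mult_nth:
  "fps_nth (lin_fps \<gamma> * w) n = (if n = 0 then 0 else fps_nth w (n - 1)) - \<gamma> * fps_nth w n"
  by (simp add: lin_fps_def left_diff_distrib)

lemma conv_at_lin [simp]: "conv_at r (lin_fps \<gamma>)"
  by (rule conv_at_eventually_zero[of 2]) (simp add: lin_fps_nth)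

text \<open>The index is 1 exactly if the root lies in the closed disk; together with
  \<open>dom_index_mult\<close> this makes the index count roots.\<close>

lemma gauss_norm_lin:
  assumes "r > 0"
  shows "gauss_norm r (lin_fps \<gamma>) = max r (absval \<gamma>)"
    and "dom_index r (lin_fps \<gamma>) = (if absval \<gamma> \<le> r then 1 else 0)"
proof -
  have *: "gauss_norm r (lin_fps \<gamma>) = max r (absval \<gamma>) \<and>
    dom_index r (lin_fps \<gamma>) = (if absval \<gamma> \<le> r then 1 else 0)"
  proof (cases "absval \<gamma> \<le> r")
    case True
    have "absval (fps_nth (lin_fps \<gamma>) n) * r ^ n \<le> r"
         "n > 1 \<Longrightarrow> absval (fps_nth (lin_fps \<gamma>) n) * r ^ n < r" for n
      unfolding lin_fps_nth using True assms by auto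
    then show ?thesis
      using dom_index_unique[OF conv_at_lin assms, of \<gamma> 1 r] True assms by (simp add: lin_fps_nth)
  next
    case False
    have "absval (fps_nth (lin_fps \<gamma>) n) * r ^ n \<le> absval \<gamma>"
         "n > 0 \<Longrightarrow> absval (fps_nth (lin_fps \<gamma>) n) * r ^ n < absval \<gamma>" for n
      unfolding lin_fps_nth using False assms by auto
    then show ?thesis
      using dom_index_unique[OF conv_at_lin assms, of \<gamma> 0 "absval \<gamma>"] False assms absval_zero
      by (cases "\<gamma> = 0") (simp_all only: lin_fps_nth, simp_all)
  qed
  then show "gauss_norm r (lin_fps \<gamma>) = max r (absval \<gamma>)"
    and "dom_index r (lin_fps \<gamma>) = (if absval \<gamma> \<le> r then 1 else 0)" by auto
qed

text \<open>\<open>dense\<close> says that the absolute values are dense in the positive reals, so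
  that convergence at points controls every real radius. It follows from the existence of an
  unbounded function (\<open>ultrametric_disk_of_unbounded\<close>).\<close>

locale ultrametric_disk =
  fixes R :: real and K :: "'k::{ultrametric_field, complete_space, alg_closed_field, field_char_0} itself"
  assumes R_pos: "R > 0"
    and dense: "0 < s \<Longrightarrow> s < t \<Longrightarrow> \<exists>x::'k. s < absval x \<and> absval x < t"
begin

abbreviation A :: "'k fps set" where "A \<equiv> analytic_disk R"

text \<open>From left to right, \<open>dense\<close> supplies a point between the radius
  \<open>r\<close> and \<open>R\<close>; from right to left, a radius is chosen between the given
  point and \<open>R\<close>.\<close>

lemma analytic_iff: "u \<in> A \<longleftrightarrow> (\<forall>r. 0 < r \<longrightarrow> r < R \<longrightarrow> conv_at r u)"
proof
  assume u: "u \<in> A"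
  show "\<forall>r. 0 < r \<longrightarrow> r < R \<longrightarrow> conv_at r u"
  proof (intro allI impI)
    fix r assume r: "0 < r" "r < R"
    obtain x :: 'k where x: "r < absval x" "absval x < R" using dense[OF r] by blast
    then have "summable (\<lambda>n. fps_nth u n * x ^ n)"
      using u by (auto simp: analytic_disk_def open_disk_def)
    then have lim: "(\<lambda>n. absval (fps_nth u n * x ^ n)) \<longlonglongrightarrow> 0" by (rule summable_imp_null)
    show "conv_at r u" unfolding conv_at_def
    proof (rule tendsto_sandwich[OF _ _ tendsto_const lim])
      show "\<forall>\<^sub>F n in sequentially. 0 \<le> absval (fps_nth u n) * r ^ n"
        using r by (intro always_eventually allI mult_nonneg_nonneg) auto
      show "\<forall>\<^sub>F n in sequentially. absval (fps_nth u n) * r ^ n \<le> absval (fps_nth u n * x ^ n)"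
        unfolding absval_mult absval_power using r x
        by (intro always_eventually allI mult_left_mono power_mono) auto
    qed
  qed
next
  assume u: "\<forall>r. 0 < r \<longrightarrow> r < R \<longrightarrow> conv_at r u"
  have "summable (\<lambda>n. fps_nth u n * x ^ n)" if x: "absval x < R" for x
  proof (rule summable_null)
    obtain r where r: "absval x < r" "r < R" using Rats_dense_in_real[OF x] by blast
    then have "r > 0" using absval_nonneg[of x] by linarith
    then have lim: "(\<lambda>n. absval (fps_nth u n) * r ^ n) \<longlonglongrightarrow> 0"
      using u r unfolding conv_at_def by blast
    show "(\<lambda>n. absval (fps_nth u n * x ^ n)) \<longlonglongrightarrow> 0"
    proof (rule tendsto_sandwich[OF _ _ tendsto_const lim])
      show "\<forall>\<^sub>F n in sequentially. absval (fps_nth u n * x ^ n) \<le> absval (fps_nth u n) * r ^ n"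
        unfolding absval_mult absval_power using r
        by (intro always_eventually allI mult_left_mono power_mono) auto
    qed (intro always_eventually allI absval_nonneg)
  qed
  then show "u \<in> A" by (auto simp: analytic_disk_def open_disk_def)
qed

lemma conv: "u \<in> A \<Longrightarrow> 0 < r \<Longrightarrow> r < R \<Longrightarrow> conv_at r u"
  by (simp add: analytic_iff)

lemma analytic_const [simp]: "fps_const c \<in> A" by (simp add: analytic_iff)
lemma analytic_zero [simp]: "0 \<in> A" by (simp add: analytic_iff)
lemma analytic_one [simp]: "1 \<in> A" using analytic_const[of 1] by simp
lemma analytic_lin [simp]: "lin_fps \<gamma> \<in> A" by (simp add: analytic_iff)
lemma analytic_add: "u \<in> A \<Longrightarrow> v \<in> A \<Longrightarrow> u + v \<in> A" by (simp add: analytic_iff conv_at_add)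
lemma analytic_diff: "u \<in> A \<Longrightarrow> v \<in> A \<Longrightarrow> u - v \<in> A" by (simp add: analytic_iff conv_at_diff)
lemma analytic_mult: "u \<in> A \<Longrightarrow> v \<in> A \<Longrightarrow> u * v \<in> A" by (simp add: analytic_iff conv_at_mult)
lemma analytic_deriv: "u \<in> A \<Longrightarrow> fps_deriv u \<in> A" by (simp add: analytic_iff conv_at_deriv)
lemma analytic_power: "u \<in> A \<Longrightarrow> u ^ n \<in> A" by (induction n) (simp_all add: analytic_mult)

lemmas analytic_intros = analytic_const analytic_zero analytic_one analytic_lin analytic_add
  analytic_diff analytic_mult analytic_deriv analytic_power

section \<open>Values of analytic functions and division by linear factors\<close>

lemma ps_eval_sums:
  assumes "u \<in> A" "absval x < R"
  shows "(\<lambda>n. fps_nth u n * x ^ n) sums ps_eval u x"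
  using assms unfolding ps_eval_def by (intro summable_sums) (simp add: analytic_disk_def open_disk_def)

lemma ps_eval_const [simp]: "ps_eval (fps_const c) x = (c::'k)"
proof -
  have "(\<lambda>n. fps_nth (fps_const c) n * x ^ n) sums (\<Sum>n\<in>{0}. fps_nth (fps_const c) n * x ^ n)"
    by (rule sums_finite) auto
  then show ?thesis unfolding ps_eval_def by (simp add: sums_iff)
qed

lemma ps_eval_zero [simp]: "ps_eval 0 x = (0::'k)" using ps_eval_const[of 0] by simp
lemma ps_eval_one [simp]: "ps_eval 1 x = (1::'k)" using ps_eval_const[of 1] by simp

lemma ps_eval_add:
  assumes "u \<in> A" "v \<in> A" "absval x < R"
  shows "ps_eval (u + v) x = ps_eval u x + ps_eval v x"
  using sums_add[OF ps_eval_sums[OF assms(1,3)] ps_eval_sums[OF assms(2,3)]]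
    ps_eval_sums[OF analytic_add[OF assms(1,2)] assms(3)]
  by (intro sums_unique2) (simp_all add: distrib_right)

lemma ps_eval_diff:
  assumes "u \<in> A" "v \<in> A" "absval x < R"
  shows "ps_eval (u - v) x = ps_eval u x - ps_eval v x"
  using ps_eval_add[OF analytic_diff[OF assms(1,2)] assms(2,3)] by simp

text \<open>The partial sums telescope to a multiple of a single term of the convergent series of
  \<open>w\<close>, and these terms tend to 0.\<close>

lemma ps_eval_root:
  assumes "w \<in> A" "absval \<gamma> < R"
  shows "ps_eval (lin_fps \<gamma> * w) \<gamma> = 0"
proof -
  have part: "(\<Sum>n<Suc N. fps_nth (lin_fps \<gamma> * w) n * \<gamma> ^ n) = - (\<gamma> * (fps_nth w N * \<gamma> ^ N))" for N
  proof (induction N)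
    case (Suc N)
    then show ?case
      by (subst sum.lessThan_Suc) (simp only: lin_fps_mult_nth, simp add: algebra_simps)
  qed (simp only: lin_fps_mult_nth, simp)
  have "(\<lambda>n. absval (fps_nth w n * \<gamma> ^ n)) \<longlonglongrightarrow> 0"
    by (rule summable_imp_null[OF sums_summable[OF ps_eval_sums[OF assms]]])
  then have "(\<lambda>n. absval \<gamma> * absval (fps_nth w n * \<gamma> ^ n)) \<longlonglongrightarrow> absval \<gamma> * 0"
    by (intro tendsto_mult tendsto_const)
  then have "(\<lambda>N. - (\<gamma> * (fps_nth w N * \<gamma> ^ N))) \<longlonglongrightarrow> 0"
    by (subst tendsto_absval_iff) (simp add: absval_mult)
  then have "(\<lambda>N. \<Sum>n<Suc N. fps_nth (lin_fps \<gamma> * w) n * \<gamma> ^ n) \<longlonglongrightarrow> 0"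
    by (simp only: part)
  then have "(\<lambda>n. fps_nth (lin_fps \<gamma> * w) n * \<gamma> ^ n) sums 0"
    unfolding sums_def by (rule LIMSEQ_imp_Suc)
  then show ?thesis unfolding ps_eval_def by (rule sums_unique[symmetric])
qed

text \<open>Synthetic division: up to a power of \<open>\<gamma>\<close>, the coefficient
  \<open>b k\<close> of the quotient is the tail of the series of \<open>u\<close> at
  \<open>\<gamma>\<close> beyond index \<open>k\<close>, written without a division by
  \<open>\<gamma>\<close> so that \<open>\<gamma> = 0\<close> is included.\<close>

lemma analytic_division:
  assumes "u \<in> A" "absval \<gamma> < R"
  obtains w where "w \<in> A" "u = fps_const (ps_eval u \<gamma>) + lin_fps \<gamma> * w"
proof -
  define b where "b k = (\<Sum>n. fps_nth u (n + k + 1) * \<gamma> ^ n)" for k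
  have bs: "(\<lambda>n. fps_nth u (n + k + 1) * \<gamma> ^ n) sums b k" for k
  proof -
    have "summable (\<lambda>n. fps_nth u (n + k + 1) * \<gamma> ^ n)"
    proof (cases "\<gamma> = 0")
      case True
      have "(\<lambda>n. fps_nth u (n + k + 1) * \<gamma> ^ n) sums (\<Sum>n\<in>{0}. fps_nth u (n + k + 1) * \<gamma> ^ n)"
        using True by (intro sums_finite) auto
      then show ?thesis by (rule sums_summable)
    next
      case False
      have "summable (\<lambda>n. fps_nth u n * \<gamma> ^ n)"
        by (rule sums_summable[OF ps_eval_sums[OF assms]])
      from summable_imp_null[OF this] have "(\<lambda>n. absval (fps_nth u n * \<gamma> ^ n)) \<longlonglongrightarrow> 0" .
      from LIMSEQ_ignore_initial_segment[OF this, of "k + 1"]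
      have "(\<lambda>n. absval (fps_nth u (n + (k + 1)) * \<gamma> ^ (n + (k + 1)))) \<longlonglongrightarrow> 0" .
      then have "(\<lambda>n. inverse (absval \<gamma> ^ (k + 1)) * absval (fps_nth u (n + (k + 1)) * \<gamma> ^ (n + (k + 1))))
          \<longlonglongrightarrow> inverse (absval \<gamma> ^ (k + 1)) * 0"
        by (intro tendsto_mult tendsto_const)
      moreover have "inverse (absval \<gamma> ^ (k + 1)) * absval (fps_nth u (n + (k + 1)) * \<gamma> ^ (n + (k + 1)))
          = absval (fps_nth u (n + k + 1) * \<gamma> ^ n)" for n
        using False unfolding absval_mult absval_power power_add[of _ n "k + 1"]
        by (simp add: add.assoc field_simps)
      ultimately show ?thesis by (intro summable_null) simp
    qed
    then show ?thesis unfolding b_def by (rule summable_sums)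
  qed
  have rec: "b k = fps_nth u (k + 1) + \<gamma> * b (k + 1)" for k
  proof -
    have "(\<lambda>n. fps_nth u (Suc n + k + 1) * \<gamma> ^ Suc n) sums (\<gamma> * b (k + 1))"
      using sums_cmult[OF bs[of "k + 1"], of \<gamma>] by (simp add: mult_ac add_ac)
    from sums_Suc[OF this] show ?thesis
      using sums_unique2[OF bs[of k]] by (simp add: add.commute)
  qed
  have ev: "ps_eval u \<gamma> = fps_nth u 0 + \<gamma> * b 0"
  proof -
    have "(\<lambda>n. fps_nth u (Suc n) * \<gamma> ^ Suc n) sums (\<gamma> * b 0)"
      using sums_cmult[OF bs[of 0], of \<gamma>] by (simp add: mult_ac add_ac)
    from sums_Suc[OF this] show ?thesis
      using sums_unique2[OF ps_eval_sums[OF assms]] by (simp add: add.commute)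
  qed
  define w where "w = Abs_fps b"
  have eq: "u = fps_const (ps_eval u \<gamma>) + lin_fps \<gamma> * w"
  proof (rule fps_ext)
    fix n
    have "fps_nth u n = fps_nth (fps_const (ps_eval u \<gamma>)) n
        + ((if n = 0 then 0 else fps_nth w (n - 1)) - \<gamma> * fps_nth w n)"
    proof (cases n)
      case (Suc m) then show ?thesis using rec[of m] by (simp add: w_def)
    qed (simp add: w_def ev)
    then show "fps_nth u n = fps_nth (fps_const (ps_eval u \<gamma>) + lin_fps \<gamma> * w) n"
      unfolding fps_add_nth lin_fps_mult_nth .
  qed
  have "w \<in> A" unfolding analytic_iff
  proof (intro allI impI)
    fix r assume r: "0 < r" "r < R"
    \<comment> \<open>The tail estimate compares powers of \<open>\<gamma>\<close> with powers of
      the radius, so it is made at a radius not smaller than \<open>absval \<gamma>\<close> and then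
      carried down to \<open>r\<close>.\<close>
    define s where "s = max r (absval \<gamma>)"
    have s: "s > 0" "s < R" "r \<le> s" "absval \<gamma> \<le> s" using r assms(2) by (auto simp: s_def)
    define t where "t n = absval (fps_nth u n) * s ^ n" for n
    have t0: "t \<longlonglongrightarrow> 0" using conv[OF assms(1) s(1,2)] by (simp add: conv_at_def t_def[abs_def])
    have key: "absval (b k) * r ^ k \<le> e" if e: "\<And>n. n > k \<Longrightarrow> t n \<le> e * s" "e > 0" for k e
    proof -
      have "absval (b k) \<le> e / s ^ k"
      proof (rule absval_sums_le[OF bs])
        fix n
        have "absval (fps_nth u (n + k + 1) * \<gamma> ^ n) \<le> absval (fps_nth u (n + k + 1)) * s ^ n"
          unfolding absval_mult absval_power using s by (intro mult_left_mono power_mono) auto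
        also have "\<dots> = t (n + k + 1) / s / s ^ k"
          using s by (simp add: t_def power_add)
        also have "\<dots> \<le> (e * s) / s / s ^ k"
          using s e(1)[of "n + k + 1"] by (intro divide_right_mono) auto
        finally show "absval (fps_nth u (n + k + 1) * \<gamma> ^ n) \<le> e / s ^ k" using s by simp
      qed
      then have "absval (b k) * s ^ k \<le> e" using s by (simp add: pos_le_divide_eq)
      moreover have "absval (b k) * r ^ k \<le> absval (b k) * s ^ k"
        using r s by (intro mult_left_mono power_mono) auto
      ultimately show ?thesis by linarith
    qed
    show "conv_at r w" unfolding conv_at_def
    proof (rule LIMSEQ_I)
      fix e :: real assume e: "e > 0"
      have "\<forall>\<^sub>F n in sequentially. t n < e / 2 * s"
        using t0 by (rule order_tendstoD(2)) (use e s in simp)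
      then obtain N where N: "\<And>n. n \<ge> N \<Longrightarrow> t n < e / 2 * s" unfolding eventually_sequentially by blast
      have "norm (absval (fps_nth w k) * r ^ k - 0) < e" if "k \<ge> N" for k
      proof -
        have "absval (b k) * r ^ k \<le> e / 2"
          using N that e by (intro key) (auto intro!: less_imp_le)
        moreover have "absval (b k) * r ^ k \<ge> 0" using r by (intro mult_nonneg_nonneg) auto
        ultimately show ?thesis using e by (simp add: w_def)
      qed
      then show "\<exists>no. \<forall>k\<ge>no. norm (absval (fps_nth w k) * r ^ k - 0) < e" by blast
    qed
  qed
  then show ?thesis using eq that by blast
qed

text \<open>Division at \<open>x\<close> replaces the Cauchy product of series: both factors are
  congruent to their values modulo \<open>lin_fps x\<close>, hence so is the product.\<close>

lemma ps_eval_mult: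
  assumes "u \<in> A" "v \<in> A" "absval x < R"
  shows "ps_eval (u * v) x = ps_eval u x * ps_eval v x"
proof -
  obtain w where w: "w \<in> A" "u = fps_const (ps_eval u x) + lin_fps x * w"
    using analytic_division[OF assms(1,3)] by blast
  obtain z where z: "z \<in> A" "v = fps_const (ps_eval v x) + lin_fps x * z"
    using analytic_division[OF assms(2,3)] by blast
  define c d where "c = ps_eval u x" and "d = ps_eval v x"
  define y where "y = fps_const c * z + fps_const d * w + lin_fps x * (w * z)"
  have y: "y \<in> A" unfolding y_def using w z by (intro analytic_intros)
  have "u * v = (fps_const c + lin_fps x * w) * (fps_const d + lin_fps x * z)"
    using w(2) z(2) by (simp add: c_def d_def)
  also have "\<dots> = fps_const c * fps_const d + lin_fps x * y"
    unfolding y_def by (simp only: algebra_simps)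
  also have "fps_const c * fps_const d = fps_const (c * d)" by simp
  finally have "ps_eval (u * v) x = ps_eval (fps_const (c * d)) x + ps_eval (lin_fps x * y) x"
    using ps_eval_add[OF analytic_const analytic_mult[OF analytic_lin y] assms(3)] by simp
  then show ?thesis using ps_eval_root[OF y assms(3)] by (simp add: c_def d_def)
qed

lemma ps_eval_lin [simp]: "absval x < R \<Longrightarrow> ps_eval (lin_fps \<gamma>) x = x - (\<gamma>::'k)"
proof -
  assume x: "absval x < R"
  have "lin_fps \<gamma> = fps_const (x - \<gamma>) + lin_fps x * 1" by (simp add: lin_fps_def fps_const_sub[symmetric] del: fps_const_sub)
  then have "ps_eval (lin_fps \<gamma>) x = ps_eval (fps_const (x - \<gamma>)) x + ps_eval (lin_fps x * 1) x"
    using ps_eval_add[OF analytic_const analytic_mult[OF analytic_lin analytic_one] x] by metis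
  then show ?thesis using ps_eval_root[OF analytic_one x] by simp
qed

lemma absval_ps_eval_le:
  assumes "u \<in> A" "absval x \<le> r" "0 < r" "r < R"
  shows "absval (ps_eval u x) \<le> gauss_norm r u"
proof (rule absval_sums_le[OF ps_eval_sums[OF assms(1)]])
  show "absval x < R" using assms by linarith
  fix n
  have "absval (fps_nth u n * x ^ n) \<le> absval (fps_nth u n) * r ^ n"
    unfolding absval_mult absval_power using assms by (intro mult_left_mono power_mono) auto
  also have "\<dots> \<le> gauss_norm r u" using gauss_norm_ge[OF conv[OF assms(1,3,4)]] .
  finally show "absval (fps_nth u n * x ^ n) \<le> gauss_norm r u" .
qed

text \<open>The constant term strictly dominates all others at radius \<open>r\<close>, so the rest
  \<open>v\<close> of the series has a smaller norm and cannot disturb the value.\<close>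

lemma absval_ps_eval_dom_0:
  assumes "u \<in> A" "u \<noteq> 0" "absval x \<le> r" "0 < r" "r < R" "dom_index r u = 0"
  shows "absval (ps_eval u x) = gauss_norm r u"
proof -
  note c = conv[OF assms(1,4,5)]
  have 0: "absval (fps_nth u 0) = gauss_norm r u"
    using dom_index(1)[OF c assms(4,2)] assms(6) by simp
  define v where "v = u - fps_const (fps_nth u 0)"
  have v: "v \<in> A" unfolding v_def using assms by (intro analytic_intros)
  have xR: "absval x < R" using assms by linarith
  note cv = conv[OF v assms(4,5)]
  have lt: "absval (fps_nth v n) * r ^ n < gauss_norm r u" for n
  proof (cases "n = 0")
    case True then show ?thesis using gauss_norm_pos[OF c assms(4,2)] by (simp add: v_def)
  next
    case False then show ?thesis using dom_index(2)[OF c assms(4,2), of n] assms(6) by (simp add: v_def)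
  qed
  have "gauss_norm r v < gauss_norm r u"
  proof (cases "v = 0")
    case False then show ?thesis using dom_index(1)[OF cv assms(4) False] lt by metis
  qed (use gauss_norm_pos[OF c assms(4,2)] in simp)
  then have "absval (ps_eval v x) < absval (fps_nth u 0)"
    using absval_ps_eval_le[OF v assms(3-5)] 0 by linarith
  moreover have "ps_eval u x = ps_eval v x + fps_nth u 0"
    unfolding v_def using ps_eval_diff[OF assms(1) analytic_const xR] by simp
  ultimately show ?thesis using absval_add_eq 0 by metis
qed

section \<open>Existence of zeros in closed disks\<close>

lemma analytic_poly [simp]: "fps_of_poly p \<in> A"
  unfolding analytic_iff by (auto intro!: conv_at_eventually_zero[of "Suc (degree p)"] coeff_eq_0)

lemma ps_eval_poly [simp]: "ps_eval (fps_of_poly p) x = poly (p::'k poly) x"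
proof -
  have "(\<lambda>n. fps_nth (fps_of_poly p) n * x ^ n) sums (\<Sum>n\<le>degree p. fps_nth (fps_of_poly p) n * x ^ n)"
    by (rule sums_finite) (auto simp: coeff_eq_0)
  then show ?thesis unfolding ps_eval_def by (simp add: sums_iff poly_altdef)
qed

text \<open>Split \<open>p\<close> into linear factors. A root outside the closed disk contributes
  the same amount to the value at \<open>y\<close> and to the Gauss norm; each of the
  \<open>N\<close> roots inside contributes its distance from \<open>y\<close> to the value and
  \<open>r\<close> to the norm. So the product of the \<open>N\<close> distances is the right-hand
  side, and the nearest root satisfies the bound.\<close>

lemma poly_root_near:
  fixes p :: "'k poly"
  assumes "p \<noteq> 0" "0 < r" "r < R" "absval y \<le> r" "dom_index r (fps_of_poly p) = N" "N > 0"
  shows "\<exists>\<gamma>. absval \<gamma> \<le> r \<and> poly p \<gamma> = 0 \<and>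
    absval (y - \<gamma>) ^ N \<le> absval (poly p y) * r ^ N / gauss_norm r (fps_of_poly p)"
  using assms
proof (induction "degree p" arbitrary: p N)
  case 0
  then obtain c where "p = [:c:]" by (metis degree_0_id)
  then have "dom_index r (fps_of_poly p) = 0"
    using 0 dom_index_unique(2)[of r "fps_const c" 0 "absval c"]
    by (simp add: fps_of_poly_const)
  then show ?case using 0 by simp
next
  case (Suc d p N)
  note r = \<open>0 < r\<close> \<open>r < R\<close>
  have "degree p > 0" using Suc.hyps(2) by linarith
  then obtain \<gamma> where \<gamma>: "poly p \<gamma> = 0" using alg_closed_imp_poly_has_root by blast
  then obtain q where q: "p = [:-\<gamma>, 1:] * q" by (auto simp: poly_eq_0_iff_dvd)
  have q0: "q \<noteq> 0" using q Suc.prems(1) by auto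
  have dq: "d = degree q"
    using Suc.hyps(2) q0 unfolding q by (subst (asm) degree_mult_eq) auto
  have lin: "fps_of_poly [:-\<gamma>, 1:] = lin_fps \<gamma>"
    by (simp add: lin_fps_def fps_of_poly_pCons fps_of_poly_const)
  have fp: "fps_of_poly p = lin_fps \<gamma> * fps_of_poly q"
    unfolding q fps_of_poly_mult lin ..
  have fq0: "fps_of_poly q \<noteq> 0" using q0 by simp
  have cq: "conv_at r (fps_of_poly q)" by (rule conv[OF analytic_poly r])
  have G: "gauss_norm r (fps_of_poly p) = max r (absval \<gamma>) * gauss_norm r (fps_of_poly q)"
    unfolding fp gauss_norm_mult[OF conv_at_lin cq r(1)] gauss_norm_lin(1)[OF r(1)] ..
  have D: "N = (if absval \<gamma> \<le> r then 1 else 0) + dom_index r (fps_of_poly q)"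
    using Suc.prems(5) unfolding fp dom_index_mult[OF conv_at_lin cq r(1) lin_fps_nonzero fq0]
      gauss_norm_lin(2)[OF r(1)] by simp
  have Gq: "gauss_norm r (fps_of_poly q) > 0" by (rule gauss_norm_pos[OF cq r(1) fq0])
  have py: "absval (poly p y) = absval (y - \<gamma>) * absval (poly q y)"
  proof -
    have "poly p y = (y - \<gamma>) * poly q y" unfolding q by (simp add: algebra_simps)
    then show ?thesis by (simp add: absval_mult)
  qed
  show ?case
  proof (cases "absval \<gamma> \<le> r")
    case False
    have "absval (y - \<gamma>) = absval \<gamma>"
      using absval_diff_eq[of y \<gamma>] False Suc.prems(4) by (simp add: absval_minus_commute)
    obtain \<gamma>' where \<gamma>': "absval \<gamma>' \<le> r" "poly q \<gamma>' = 0"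
      "absval (y - \<gamma>') ^ N \<le> absval (poly q y) * r ^ N / gauss_norm r (fps_of_poly q)"
      using Suc.hyps(1)[OF dq q0 r Suc.prems(4) _ Suc.prems(6)] D False by auto
    have "absval (poly q y) * r ^ N / gauss_norm r (fps_of_poly q)
      = absval (poly p y) * r ^ N / gauss_norm r (fps_of_poly p)"
      unfolding G py \<open>absval (y - \<gamma>) = absval \<gamma>\<close> using False r by (cases "\<gamma> = 0") simp_all
    then show ?thesis using \<gamma>' by (intro exI[of _ \<gamma>']) (auto simp: q)
  next
    case True
    have GG: "gauss_norm r (fps_of_poly p) = r * gauss_norm r (fps_of_poly q)" using G True by simp
    show ?thesis
    proof (cases "dom_index r (fps_of_poly q) = 0")
      case d0: True
      have "absval (poly q y) = gauss_norm r (fps_of_poly q)"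
        using absval_ps_eval_dom_0[OF analytic_poly fq0 Suc.prems(4) r d0] by simp
      then have "absval (y - \<gamma>) ^ N = absval (poly p y) * r ^ N / gauss_norm r (fps_of_poly p)"
        unfolding GG py using D True d0 Gq r by simp
      then show ?thesis using True \<gamma> by auto
    next
      case d0: False
      define M where "M = dom_index r (fps_of_poly q)"
      have N: "N = Suc M" using D True by (simp add: M_def)
      obtain \<gamma>' where \<gamma>': "absval \<gamma>' \<le> r" "poly q \<gamma>' = 0"
        "absval (y - \<gamma>') ^ M \<le> absval (poly q y) * r ^ M / gauss_norm r (fps_of_poly q)"
        using Suc.hyps(1)[OF dq q0 r Suc.prems(4), of M] d0 by (auto simp: M_def)
      have bnd: "absval (y - \<gamma>) * absval (y - \<gamma>') ^ M \<le> absval (poly p y) * r ^ N / gauss_norm r (fps_of_poly p)"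
      proof -
        have "absval (y - \<gamma>) * absval (y - \<gamma>') ^ M
          \<le> absval (y - \<gamma>) * (absval (poly q y) * r ^ M / gauss_norm r (fps_of_poly q))"
          using \<gamma>'(3) by (rule mult_left_mono) simp
        also have "\<dots> = absval (poly p y) * r ^ N / gauss_norm r (fps_of_poly p)"
          unfolding GG py N using r by simp
        finally show ?thesis .
      qed
      show ?thesis
      proof (cases "absval (y - \<gamma>) \<le> absval (y - \<gamma>')")
        case le: True
        have "absval (y - \<gamma>) ^ N \<le> absval (y - \<gamma>) * absval (y - \<gamma>') ^ M"
          unfolding N power_Suc using le by (intro mult_left_mono power_mono) auto
        then show ?thesis using bnd True \<gamma> by (intro exI[of _ \<gamma>]) linarith
      next
        case le: False
        have "absval (y - \<gamma>') ^ N \<le> absval (y - \<gamma>) * absval (y - \<gamma>') ^ M"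
          unfolding N power_Suc using le by (intro mult_right_mono) auto
        then show ?thesis using bnd \<gamma>' q by (intro exI[of _ \<gamma>']) (auto intro: order_trans)
      qed
    qed
  qed
qed

text \<open>Zeros of truncations are followed to a limit. All truncations beyond the dominant term
  have the same norm and index, the next truncation takes a single small term as its value at the
  current zero, and \<open>poly_root_near\<close> turns this into a nearby zero. Completeness takes
  the place of compactness.\<close>

lemma exists_zero:
  assumes "u \<in> A" "u \<noteq> 0" "0 < r" "r < R" "dom_index r u > 0"
  obtains \<gamma> where "absval \<gamma> \<le> r" "ps_eval u \<gamma> = 0"
proof -
  note r = assms(3,4)
  note cu = conv[OF assms(1) r]
  define N where "N = dom_index r u"
  define M where "M = gauss_norm r u"
  have M: "M > 0" unfolding M_def by (rule gauss_norm_pos[OF cu r(1) assms(2)])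
  define t where "t n = absval (fps_nth u n) * r ^ n" for n
  have t0: "t \<longlonglongrightarrow> 0" using cu by (simp add: conv_at_def t_def[abs_def])
  define p where "p d = Abs_poly (\<lambda>n. if n \<le> N + d then fps_nth u n else 0)" for d
  have cp: "coeff (p d) n = (if n \<le> N + d then fps_nth u n else 0)" for d n
  proof -
    have "\<forall>\<^sub>\<infinity>n. (if n \<le> N + d then fps_nth u n else 0) = 0"
      unfolding MOST_nat by (intro exI[of _ "N + d"]) auto
    then show ?thesis unfolding p_def by (subst Abs_poly_inverse) auto
  qed
  have uN: "t N = M" using dom_index(1)[OF cu r(1) assms(2)] by (simp add: t_def N_def M_def)
  then have "fps_nth u N \<noteq> 0" using M by (auto simp: t_def)
  then have p0: "p d \<noteq> 0" for d using cp[of d N] by auto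
  have tle: "t n \<le> M" for n using gauss_norm_ge[OF cu] by (simp add: t_def M_def)
  have tlt: "n > N \<Longrightarrow> t n < M" for n using dom_index(2)[OF cu r(1) assms(2)] by (simp add: t_def M_def N_def)
  have dp: "gauss_norm r (fps_of_poly (p d)) = M" "dom_index r (fps_of_poly (p d)) = N" for d
    using dom_index_unique[OF conv[OF analytic_poly r] r(1), of "p d" N M] uN tle tlt M
    by (auto simp: cp t_def)
  have step: "\<exists>\<gamma>'. (absval \<gamma>' \<le> r \<and> poly (p (Suc d)) \<gamma>' = 0) \<and>
      absval (\<gamma> - \<gamma>') ^ N \<le> t (N + Suc d) * r ^ N / M"
    if \<gamma>: "absval \<gamma> \<le> r \<and> poly (p d) \<gamma> = 0" for \<gamma> d
  proof -
    have "p (Suc d) = p d + monom (fps_nth u (N + Suc d)) (N + Suc d)"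
      by (rule poly_eqI) (auto simp: cp)
    then have "poly (p (Suc d)) \<gamma> = fps_nth u (N + Suc d) * \<gamma> ^ (N + Suc d)"
      using \<gamma> by (simp add: poly_monom)
    then have "absval (poly (p (Suc d)) \<gamma>) \<le> t (N + Suc d)"
      unfolding t_def using \<gamma> by (simp only: absval_mult absval_power) (intro mult_left_mono power_mono, auto)
    then have "absval (poly (p (Suc d)) \<gamma>) * r ^ N / M \<le> t (N + Suc d) * r ^ N / M"
      using r M by (intro divide_right_mono mult_right_mono) auto
    moreover obtain \<gamma>' where "absval \<gamma>' \<le> r" "poly (p (Suc d)) \<gamma>' = 0"
      "absval (\<gamma> - \<gamma>') ^ N \<le> absval (poly (p (Suc d)) \<gamma>) * r ^ N / M"
      using poly_root_near[OF p0 r, of \<gamma> "Suc d" N] \<gamma> dp[of "Suc d"] assms(5) by (auto simp: N_def)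
    ultimately show ?thesis by force
  qed
  have start: "\<exists>\<gamma>. absval \<gamma> \<le> r \<and> poly (p 0) \<gamma> = 0"
    using poly_root_near[OF p0 r, of 0 0 N] dp[of 0] assms(5) r by (auto simp: N_def)
  obtain x where x: "\<And>d. absval (x d) \<le> r \<and> poly (p d) (x d) = 0"
    "\<And>d. absval (x d - x (Suc d)) ^ N \<le> t (N + Suc d) * r ^ N / M"
    using dependent_nat_choice[of "\<lambda>d \<gamma>. absval \<gamma> \<le> r \<and> poly (p d) \<gamma> = 0"
      "\<lambda>d \<gamma> \<gamma>'. absval (\<gamma> - \<gamma>') ^ N \<le> t (N + Suc d) * r ^ N / M"] start step by metis
  have tN: "(\<lambda>d. t (N + Suc d) * r ^ N / M) \<longlonglongrightarrow> 0"
  proof -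
    have "(\<lambda>d. t (d + Suc N)) \<longlonglongrightarrow> 0" by (rule LIMSEQ_ignore_initial_segment[OF t0])
    then have "(\<lambda>d. t (d + Suc N) * (r ^ N / M)) \<longlonglongrightarrow> 0 * (r ^ N / M)"
      by (intro tendsto_mult tendsto_const)
    then show ?thesis by (simp add: add.commute)
  qed
  have "(\<lambda>d. absval (x (Suc d) - x d)) \<longlonglongrightarrow> 0"
  proof (rule LIMSEQ_I)
    fix e :: real assume e: "e > 0"
    have "\<forall>\<^sub>F d in sequentially. t (N + Suc d) * r ^ N / M < e ^ N"
      using tN by (rule order_tendstoD(2)) (use e in simp)
    then obtain d0 where d0: "\<And>d. d \<ge> d0 \<Longrightarrow> t (N + Suc d) * r ^ N / M < e ^ N"
      unfolding eventually_sequentially by blast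
    have "absval (x d - x (Suc d)) < e" if "d \<ge> d0" for d
      by (rule power_less_imp_less_base[OF le_less_trans[OF x(2) d0[OF that]]]) (use e in simp)
    then show "\<exists>no. \<forall>n\<ge>no. norm (absval (x (Suc n) - x n) - 0) < e"
      by (auto simp: absval_minus_commute)
  qed
  then have "Cauchy x" by (rule Cauchy_of_diff_null)
  then obtain \<gamma> where lim: "x \<longlonglongrightarrow> \<gamma>"
    unfolding Cauchy_convergent_iff convergent_def by blast
  have \<gamma>: "absval \<gamma> \<le> r" by (rule absval_lim_le[OF lim]) (simp add: x(1))
  then have \<gamma>R: "absval \<gamma> < R" using r by simp
  obtain w where w: "w \<in> A" "u = fps_const (ps_eval u \<gamma>) + lin_fps \<gamma> * w"
    using analytic_division[OF assms(1) \<gamma>R] by blast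
  \<comment> \<open>The truncation vanishes at \<open>x d\<close>, so the value of \<open>u\<close>
    there comes from the tail alone; the quotient \<open>w\<close> carries this smallness over to
    \<open>\<gamma>\<close>.\<close>
  have tail: "absval (ps_eval u \<gamma>) \<le> max (absval (x d - \<gamma>) * gauss_norm r w) (SUP n\<in>{N+d<..}. t n)" for d
  proof -
    have xr: "absval (x d) \<le> r" and xR: "absval (x d) < R" using x(1)[of d] r by auto
    have "ps_eval u (x d) = ps_eval (fps_const (ps_eval u \<gamma>) + lin_fps \<gamma> * w) (x d)" using w(2) by simp
    also have "\<dots> = ps_eval u \<gamma> + (x d - \<gamma>) * ps_eval w (x d)"
      using xR w(1) by (simp add: ps_eval_add ps_eval_mult analytic_intros)
    finally have *: "ps_eval u \<gamma> = ps_eval u (x d) - (x d - \<gamma>) * ps_eval w (x d)" by simp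
    have a: "absval ((x d - \<gamma>) * ps_eval w (x d)) \<le> absval (x d - \<gamma>) * gauss_norm r w"
      unfolding absval_mult using absval_ps_eval_le[OF w(1) xr r] by (rule mult_left_mono) simp
    define v where "v = u - fps_of_poly (p d)"
    have v: "v \<in> A" unfolding v_def by (intro analytic_diff assms analytic_poly)
    have bdd: "bdd_above (t ` {N+d<..})" using tle by (meson bdd_aboveI2)
    have "ps_eval u (x d) = ps_eval v (x d)"
      unfolding v_def using ps_eval_diff[OF assms(1) analytic_poly xR] x(1)[of d] by simp
    also have "absval \<dots> \<le> gauss_norm r v" by (rule absval_ps_eval_le[OF v xr r])
    also have "\<dots> \<le> (SUP n\<in>{N+d<..}. t n)"
    proof (rule gauss_norm_le)
      fix n
      have t1: "t (Suc (N + d)) \<le> (SUP n\<in>{N+d<..}. t n)" by (rule cSUP_upper[OF _ bdd]) simp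
      have t2: "t (Suc (N + d)) \<ge> 0" using r unfolding t_def by (intro mult_nonneg_nonneg) auto
      show "absval (fps_nth v n) * r ^ n \<le> (SUP n\<in>{N+d<..}. t n)"
      proof (cases "n \<le> N + d")
        case True then show ?thesis using t1 t2 by (simp add: v_def cp)
      next
        case False
        then have "t n \<le> (SUP n\<in>{N+d<..}. t n)" by (intro cSUP_upper[OF _ bdd]) simp
        then show ?thesis using False by (simp add: v_def cp t_def)
      qed
    qed
    finally have b: "absval (ps_eval u (x d)) \<le> (SUP n\<in>{N+d<..}. t n)" .
    show ?thesis unfolding * using order_trans[OF absval_diff_le_max max.mono[OF b a]]
      by (simp add: max.commute)
  qed
  have "ps_eval u \<gamma> = 0"
  proof (rule ccontr)
    assume nz: "ps_eval u \<gamma> \<noteq> 0"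
    define e where "e = absval (ps_eval u \<gamma>) / 2"
    have e: "e > 0" using nz by (simp add: e_def)
    have "(\<lambda>d. absval (x d - \<gamma>) * gauss_norm r w) \<longlonglongrightarrow> 0 * gauss_norm r w"
      using lim by (intro tendsto_mult tendsto_const) (simp add: tendsto_absval_iff)
    then have "(\<lambda>d. absval (x d - \<gamma>) * gauss_norm r w) \<longlonglongrightarrow> 0" by simp
    then have "\<forall>\<^sub>F d in sequentially. absval (x d - \<gamma>) * gauss_norm r w < e"
      by (rule order_tendstoD(2)) (rule e)
    moreover have "\<forall>\<^sub>F d in sequentially. t d < e" using t0 e by (rule order_tendstoD(2))
    then have "\<forall>\<^sub>F d in sequentially. \<forall>n\<ge>d. t n < e"
      by (rule eventually_all_ge_at_top)
    ultimately have "\<forall>\<^sub>F d in sequentially. absval (x d - \<gamma>) * gauss_norm r w < e \<and> (\<forall>n\<ge>d. t n < e)"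
      by (rule eventually_conj)
    then obtain d where d: "absval (x d - \<gamma>) * gauss_norm r w < e" "\<And>n. n \<ge> d \<Longrightarrow> t n < e"
      unfolding eventually_sequentially by blast
    have "(SUP n\<in>{N+d<..}. t n) \<le> e"
      by (rule cSUP_least) (use d(2) in \<open>auto intro: less_imp_le\<close>)
    then have "absval (ps_eval u \<gamma>) \<le> e" using tail[of d] d(1) by simp
    then show False using e unfolding e_def by simp
  qed
  then show ?thesis using \<gamma> that by blast
qed

lemma dom_index_0_imp_no_zero:
  assumes "u \<in> A" "u \<noteq> 0" "absval x \<le> r" "0 < r" "r < R" "dom_index r u = 0"
  shows "ps_eval u x \<noteq> 0"
  using absval_ps_eval_dom_0[OF assms] gauss_norm_pos[OF conv[OF assms(1,4,5)] assms(4,2)] by auto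

end

section \<open>Meromorphic functions: orders and Gauss norms\<close>

definition lin_fls :: "'k::ultrametric_field \<Rightarrow> 'k fls" where
  "lin_fls \<gamma> = fls_X - fls_const \<gamma>"

lemma fps_to_fls_lin [simp]: "fps_to_fls (lin_fps \<gamma>) = lin_fls \<gamma>"
  by (simp add: lin_fps_def lin_fls_def)

lemma fls_deriv_lin [simp]: "fls_deriv (lin_fls \<gamma>) = 1"
  by (simp add: lin_fls_def)

lemma has_order_at_iff:
  "has_order_at R h \<gamma> m \<longleftrightarrow> (\<exists>u\<in>analytic_disk R. \<exists>v\<in>analytic_disk R.
     ps_eval u \<gamma> \<noteq> 0 \<and> ps_eval v \<gamma> \<noteq> 0 \<and>
     h = lin_fls \<gamma> powi m * (fps_to_fls u / fps_to_fls v))"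
  by (simp add: has_order_at_def lin_fls_def)

lemma lin_fls_nonzero [simp]: "lin_fls \<gamma> \<noteq> 0"
  using lin_fps_nonzero[of \<gamma>] unfolding fps_to_fls_lin[symmetric] fps_to_fls_eq_0_iff .

lemma fls_deriv_lin_powi:
  "fls_deriv (lin_fls (\<gamma>::'k::ultrametric_field) powi m) = of_int m * lin_fls \<gamma> powi (m - 1)"
proof (cases "m \<ge> 0")
  case True
  then obtain k where m: "m = int k" by (metis nonneg_int_cases)
  show ?thesis
  proof (cases k)
    case (Suc j)
    then have "lin_fls \<gamma> powi (m - 1) = lin_fls \<gamma> ^ j" by (simp add: m)
    moreover have "lin_fls \<gamma> powi m = lin_fls \<gamma> ^ Suc j" by (simp only: m Suc power_int_of_nat)
    moreover have "(of_int m :: 'k fls) = of_nat (Suc j)" by (simp only: m Suc of_int_of_nat_eq)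
    ultimately show ?thesis by (simp only: fls_deriv_power fls_deriv_lin diff_Suc_1 mult_1_right)
  qed (simp add: m)
next
  case False
  define k where "k = nat (- m)"
  have m: "m = - int k" and k: "k > 0" using False by (auto simp: k_def)
  have "lin_fls \<gamma> powi m = inverse (lin_fls \<gamma> ^ k)" by (simp add: m power_int_minus)
  then have "fls_deriv (lin_fls \<gamma> powi m) = - (of_nat k * lin_fls \<gamma> ^ (k - 1)) * (inverse (lin_fls \<gamma> ^ k))\<^sup>2"
    by (simp add: fls_inverse_deriv fls_deriv_power)
  also have "\<dots> = - of_nat k * inverse (lin_fls \<gamma> ^ Suc k)"
  proof -
    have "lin_fls \<gamma> ^ k = lin_fls \<gamma> ^ (k - 1) * lin_fls \<gamma>" using k by (metis power_minus_mult)
    moreover have id: "- (n * a) * (inverse (a * l))\<^sup>2 = - n * inverse (a * l * l)"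
      if "a \<noteq> 0" "l \<noteq> 0" for n a l :: "'k fls"
      using that by (simp add: field_simps power2_eq_square)
    ultimately show ?thesis
      using id[of "lin_fls \<gamma> ^ (k - 1)" "lin_fls \<gamma>" "of_nat k"]
      by (simp only: power_Suc2 power_not_zero lin_fls_nonzero not_False_eq_True simp_thms)
  qed
  also have "inverse (lin_fls \<gamma> ^ Suc k) = lin_fls \<gamma> powi (m - 1)"
  proof -
    have "m - 1 = - int (Suc k)" by (simp add: m)
    then show ?thesis by (simp only: power_int_minus power_int_of_nat)
  qed
  also have "- of_nat k = of_int m" by (simp add: m)
  finally show ?thesis .
qed

lemma fls_deriv_quotient:
  fixes u v :: "'a::field fls"
  assumes "v \<noteq> 0"
  shows "fls_deriv (u / v) = (fls_deriv u * v - u * fls_deriv v) / v\<^sup>2"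
  using assms by (simp add: divide_inverse fls_inverse_deriv) (simp add: field_simps power2_eq_square)

text \<open>Independent of the chosen quotient because the Gauss norm is multiplicative
  (\<open>nrm_eq\<close>).\<close>

definition mero_norm :: "real \<Rightarrow> real \<Rightarrow> 'k::ultrametric_field fls \<Rightarrow> real" where
  "mero_norm R r h = (THE y. \<exists>u\<in>analytic_disk R. \<exists>v\<in>analytic_disk R. v \<noteq> 0 \<and>
     h = fps_to_fls u / fps_to_fls v \<and> y = gauss_norm r u / gauss_norm r v)"

context ultrametric_disk
begin

abbreviation M :: "'k fls set" where "M \<equiv> mero_disk R"
abbreviation ord :: "'k \<Rightarrow> 'k fls \<Rightarrow> int" where "ord \<gamma> h \<equiv> omega R \<gamma> h"
abbreviation nrm :: "real \<Rightarrow> 'k fls \<Rightarrow> real" where "nrm r h \<equiv> mero_norm R r h"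

lemma mero_I: "u \<in> A \<Longrightarrow> v \<in> A \<Longrightarrow> v \<noteq> 0 \<Longrightarrow> fps_to_fls u / fps_to_fls v \<in> M"
  by (auto simp: mero_disk_def)

lemma mero_E:
  assumes "h \<in> M"
  obtains u v where "u \<in> A" "v \<in> A" "v \<noteq> 0" "h = fps_to_fls u / fps_to_fls v"
  using assms by (auto simp: mero_disk_def)

lemma mero_analytic: "u \<in> A \<Longrightarrow> fps_to_fls u \<in> M"
  using mero_I[of u 1] by simp

lemma mero_const [simp]: "fls_const c \<in> M"
  using mero_analytic[OF analytic_const, of c] by simp

lemma mero_zero [simp]: "0 \<in> M" using mero_const[of 0] by simp
lemma mero_one [simp]: "1 \<in> M" using mero_const[of 1] by simp
lemma mero_of_nat [simp]: "of_nat n \<in> M" using mero_const[of "of_nat n"] by (simp add: fls_of_nat)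

lemma mero_add:
  assumes "g \<in> M" "h \<in> M"
  shows "g + h \<in> M"
proof -
  obtain u v where 1: "u \<in> A" "v \<in> A" "v \<noteq> 0" "g = fps_to_fls u / fps_to_fls v"
    using assms(1) by (rule mero_E)
  obtain w z where 2: "w \<in> A" "z \<in> A" "z \<noteq> 0" "h = fps_to_fls w / fps_to_fls z"
    using assms(2) by (rule mero_E)
  have "g + h = fps_to_fls (u * z + w * v) / fps_to_fls (v * z)"
    using 1 2 by (simp add: fls_times_fps_to_fls field_simps)
  also have "\<dots> \<in> M" using 1 2 by (intro mero_I analytic_intros) auto
  finally show ?thesis .
qed

lemma mero_mult:
  assumes "g \<in> M" "h \<in> M"
  shows "g * h \<in> M"
proof -
  obtain u v where 1: "u \<in> A" "v \<in> A" "v \<noteq> 0" "g = fps_to_fls u / fps_to_fls v"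
    using assms(1) by (rule mero_E)
  obtain w z where 2: "w \<in> A" "z \<in> A" "z \<noteq> 0" "h = fps_to_fls w / fps_to_fls z"
    using assms(2) by (rule mero_E)
  have "g * h = fps_to_fls (u * w) / fps_to_fls (v * z)"
    using 1 2 by (simp add: fls_times_fps_to_fls)
  then show ?thesis using 1 2 by (auto intro!: mero_I analytic_intros)
qed

lemma mero_inverse:
  assumes "h \<in> M"
  shows "inverse h \<in> M"
proof -
  obtain u v where 1: "u \<in> A" "v \<in> A" "v \<noteq> 0" "h = fps_to_fls u / fps_to_fls v"
    using assms(1) by (rule mero_E)
  show ?thesis
  proof (cases "u = 0")
    case False
    then show ?thesis using 1 by (auto intro!: mero_I)
  qed (use 1 in simp)
qed

lemma mero_divide: "g \<in> M \<Longrightarrow> h \<in> M \<Longrightarrow> g / h \<in> M"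
  by (simp add: divide_inverse mero_mult mero_inverse)

lemma mero_uminus: "h \<in> M \<Longrightarrow> - h \<in> M"
  using mero_mult[OF mero_const[of "-1"], of h] by simp

lemma mero_diff: "g \<in> M \<Longrightarrow> h \<in> M \<Longrightarrow> g - h \<in> M"
  using mero_add[OF _ mero_uminus, of g h] by simp

lemma mero_power: "h \<in> M \<Longrightarrow> h ^ n \<in> M"
  by (induction n) (simp_all add: mero_mult)

lemma mero_powi: "h \<in> M \<Longrightarrow> h powi m \<in> M"
  by (simp add: power_int_def mero_power mero_inverse)

lemma mero_lin: "lin_fls \<gamma> \<in> M"
  using mero_analytic[OF analytic_lin] by simp

lemma mero_deriv:
  assumes "h \<in> M"
  shows "fls_deriv h \<in> M"
proof -
  obtain u v where 1: "u \<in> A" "v \<in> A" "v \<noteq> 0" "h = fps_to_fls u / fps_to_fls v"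
    using assms(1) by (rule mero_E)
  have "fls_deriv h = fps_to_fls (fps_deriv u * v - u * fps_deriv v) / fps_to_fls (v * v)"
    unfolding 1(4) using 1(3)
    by (subst fls_deriv_quotient)
      (simp_all add: fls_deriv_fps_to_fls fls_times_fps_to_fls power2_eq_square)
  also have "\<dots> \<in> M" using 1 by (intro mero_I analytic_intros) auto
  finally show ?thesis .
qed

lemmas mero_intros = mero_const mero_zero mero_one mero_of_nat mero_add mero_mult mero_inverse
  mero_divide mero_uminus mero_diff mero_power mero_deriv mero_lin

subsection \<open>Orders\<close>

text \<open>At a radius beyond \<open>absval \<gamma>\<close> each division by
  \<open>lin_fps \<gamma>\<close> lowers \<open>dom_index\<close> by one, so the divisions come to
  an end and the order is finite.\<close>

lemma analytic_factor:
  assumes "u \<in> A" "u \<noteq> 0" "absval \<gamma> < R"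
  obtains k u0 where "u0 \<in> A" "u = lin_fps \<gamma> ^ k * u0" "ps_eval u0 \<gamma> \<noteq> 0"
proof -
  obtain r where r: "absval \<gamma> < r" "r < R" using Rats_dense_in_real[OF assms(3)] by blast
  then have r0: "r > 0" using absval_nonneg[of \<gamma>] by linarith
  have "\<exists>k u0. u0 \<in> A \<and> u = lin_fps \<gamma> ^ k * u0 \<and> ps_eval u0 \<gamma> \<noteq> 0"
    using assms(1,2)
  proof (induction "dom_index r u" arbitrary: u rule: less_induct)
    case less
    show ?case
    proof (cases "ps_eval u \<gamma> = 0")
      case True
      obtain w where w: "w \<in> A" "u = fps_const (ps_eval u \<gamma>) + lin_fps \<gamma> * w"
        using analytic_division[OF less.prems(1) assms(3)] by blast
      then have uw: "u = lin_fps \<gamma> * w" using True by simp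
      have w0: "w \<noteq> 0" using uw less.prems(2) by auto
      have "dom_index r u = 1 + dom_index r w"
        unfolding uw using dom_index_mult[OF conv_at_lin conv[OF w(1) r0 r(2)] r0 lin_fps_nonzero w0]
          gauss_norm_lin(2)[OF r0, of \<gamma>] r by simp
      then obtain k u0 where "u0 \<in> A" "w = lin_fps \<gamma> ^ k * u0" "ps_eval u0 \<gamma> \<noteq> 0"
        using less.hyps[OF _ w(1) w0] by auto
      then show ?thesis using uw by (intro exI[of _ "Suc k"] exI[of _ u0]) (simp add: mult.assoc)
    next
      case False
      then show ?thesis using less.prems(1) by (intro exI[of _ 0] exI[of _ u]) simp
    qed
  qed
  then show ?thesis using that by blast
qed

text \<open>Two different orders would leave a factor \<open>lin_fps \<gamma>\<close> in a series
  that does not vanish at \<open>\<gamma>\<close>.\<close>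

lemma has_order_unique_le:
  fixes \<gamma> :: 'k
  assumes "has_order_at R h \<gamma> m" "has_order_at R h \<gamma> m'" "absval \<gamma> < R" "m \<le> m'"
  shows "m = (m'::int)"
proof (rule ccontr)
  assume "m \<noteq> m'"
  define k where "k = nat (m' - m) - 1"
  have k: "m' = m + int (Suc k)" using assms(4) \<open>m \<noteq> m'\<close> by (simp add: k_def)
  obtain u v where 1: "u \<in> A" "v \<in> A" "ps_eval u \<gamma> \<noteq> 0" "ps_eval v \<gamma> \<noteq> 0"
    "h = lin_fls \<gamma> powi m * (fps_to_fls u / fps_to_fls v)"
    using assms(1) by (auto simp: has_order_at_iff)
  obtain w z where 2: "w \<in> A" "z \<in> A" "ps_eval w \<gamma> \<noteq> 0" "ps_eval z \<gamma> \<noteq> 0"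
    "h = lin_fls \<gamma> powi m' * (fps_to_fls w / fps_to_fls z)"
    using assms(2) by (auto simp: has_order_at_iff)
  have nz: "v \<noteq> 0" "z \<noteq> 0" using 1 2 by auto
  have "lin_fls \<gamma> powi m * (fps_to_fls u / fps_to_fls v)
      = lin_fls \<gamma> powi m * (lin_fls \<gamma> ^ Suc k * (fps_to_fls w / fps_to_fls z))"
    unfolding 1(5)[symmetric] unfolding 2(5) k
    by (simp add: power_int_add mult.assoc del: power_Suc of_nat_Suc)
  then have "fps_to_fls u / fps_to_fls v = lin_fls \<gamma> ^ Suc k * (fps_to_fls w / fps_to_fls z)"
    unfolding mult_cancel_left by (auto simp: power_int_0_left_if)
  then have "fps_to_fls (u * z) = fps_to_fls (lin_fps \<gamma> * (lin_fps \<gamma> ^ k * w * v))"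
    using nz by (simp add: fls_times_fps_to_fls fps_to_fls_power field_simps)
  then have "u * z = lin_fps \<gamma> * (lin_fps \<gamma> ^ k * w * v)" by (simp only: fps_to_fls_eq_iff)
  moreover have "ps_eval (u * z) \<gamma> \<noteq> 0" using 1 2 assms(3) by (simp add: ps_eval_mult)
  moreover have "ps_eval (lin_fps \<gamma> * (lin_fps \<gamma> ^ k * w * v)) \<gamma> = 0"
    using 1 2 assms(3) by (intro ps_eval_root analytic_intros)
  ultimately show False by simp
qed

lemma has_order_unique:
  fixes \<gamma> :: 'k
  assumes "has_order_at R h \<gamma> m" "has_order_at R h \<gamma> m'" "absval \<gamma> < R"
  shows "m = m'"
  using has_order_unique_le[OF assms] has_order_unique_le[OF assms(2,1,3)] by linarith

lemma ord_eqI: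
  fixes \<gamma> :: 'k
  assumes "has_order_at R h \<gamma> m" "absval \<gamma> < R"
  shows "ord \<gamma> h = m"
proof -
  have "(THE m. has_order_at R h \<gamma> m) = m"
    by (rule the_equality[of "has_order_at R h \<gamma>", OF assms(1)]) (rule has_order_unique[OF _ assms])
  then show ?thesis unfolding omega_def using assms(1) by auto
qed

lemma has_order_mult:
  fixes \<gamma> :: 'k
  assumes "has_order_at R g \<gamma> m" "has_order_at R h \<gamma> m'" "absval \<gamma> < R"
  shows "has_order_at R (g * h) \<gamma> (m + m')"
proof -
  obtain u v where 1: "u \<in> A" "v \<in> A" "ps_eval u \<gamma> \<noteq> 0" "ps_eval v \<gamma> \<noteq> 0"
    "g = lin_fls \<gamma> powi m * (fps_to_fls u / fps_to_fls v)"
    using assms(1) by (auto simp: has_order_at_iff)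
  obtain w z where 2: "w \<in> A" "z \<in> A" "ps_eval w \<gamma> \<noteq> 0" "ps_eval z \<gamma> \<noteq> 0"
    "h = lin_fls \<gamma> powi m' * (fps_to_fls w / fps_to_fls z)"
    using assms(2) by (auto simp: has_order_at_iff)
  show ?thesis unfolding has_order_at_iff
  proof (intro bexI conjI)
    show "ps_eval (u * w) \<gamma> \<noteq> 0" "ps_eval (v * z) \<gamma> \<noteq> 0"
      using 1 2 assms(3) by (simp_all add: ps_eval_mult)
    show "g * h = lin_fls \<gamma> powi (m + m') * (fps_to_fls (u * w) / fps_to_fls (v * z))"
      unfolding 1(5) 2(5) by (simp add: power_int_add fls_times_fps_to_fls)
  qed (use 1 2 in \<open>auto intro: analytic_intros\<close>)
qed

lemma has_order_inverse:
  fixes \<gamma> :: 'k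
  assumes "has_order_at R h \<gamma> m"
  shows "has_order_at R (inverse h) \<gamma> (- m)"
proof -
  obtain u v where 1: "u \<in> A" "v \<in> A" "ps_eval u \<gamma> \<noteq> 0" "ps_eval v \<gamma> \<noteq> 0"
    "h = lin_fls \<gamma> powi m * (fps_to_fls u / fps_to_fls v)"
    using assms(1) by (auto simp: has_order_at_iff)
  then have "inverse h = lin_fls \<gamma> powi (- m) * (fps_to_fls v / fps_to_fls u)"
    unfolding 1(5) power_int_minus divide_inverse by (simp add: mult_ac)
  then show ?thesis unfolding has_order_at_iff using 1 by blast
qed

lemma has_order_analytic:
  assumes "u \<in> A" "u \<noteq> 0" "absval \<gamma> < R"
  obtains k where "has_order_at R (fps_to_fls u) \<gamma> (int k)" "ps_eval u \<gamma> \<noteq> 0 \<longleftrightarrow> k = 0"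
proof -
  obtain k u0 where k: "u0 \<in> A" "u = lin_fps \<gamma> ^ k * u0" "ps_eval u0 \<gamma> \<noteq> 0"
    using analytic_factor[OF assms] .
  have "has_order_at R (fps_to_fls u) \<gamma> (int k)" unfolding has_order_at_iff
  proof (intro bexI conjI)
    show "fps_to_fls u = lin_fls \<gamma> powi int k * (fps_to_fls u0 / fps_to_fls 1)"
      unfolding k(2) by (simp add: fls_times_fps_to_fls fps_to_fls_power)
  qed (use k in auto)
  moreover have "ps_eval u \<gamma> \<noteq> 0 \<longleftrightarrow> k = 0"
  proof (cases k)
    case 0 then show ?thesis using k by simp
  next
    case (Suc j)
    have "u = lin_fps \<gamma> * (lin_fps \<gamma> ^ j * u0)" using k(2) Suc by (simp add: mult.assoc)
    then have "ps_eval u \<gamma> = 0" using k(1) assms(3) by (simp only: ps_eval_root analytic_intros)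
    then show ?thesis using Suc by simp
  qed
  ultimately show ?thesis using that by blast
qed

lemma has_order:
  assumes "h \<in> M" "h \<noteq> 0" "absval \<gamma> < R"
  shows "has_order_at R h \<gamma> (ord \<gamma> h)"
proof -
  obtain u v where 1: "u \<in> A" "v \<in> A" "v \<noteq> 0" "h = fps_to_fls u / fps_to_fls v"
    using assms(1) by (rule mero_E)
  then have "u \<noteq> 0" using assms(2) by auto
  obtain k where k: "has_order_at R (fps_to_fls u) \<gamma> (int k)"
    using has_order_analytic[OF 1(1) \<open>u \<noteq> 0\<close> assms(3)] by blast
  obtain j where j: "has_order_at R (fps_to_fls v) \<gamma> (int j)"
    using has_order_analytic[OF 1(2) \<open>v \<noteq> 0\<close> assms(3)] by blast
  have "has_order_at R h \<gamma> (int k + - int j)"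
    unfolding 1(4) divide_inverse using has_order_mult[OF k has_order_inverse[OF j] assms(3)] .
  then show ?thesis using ord_eqI[OF _ assms(3)] by metis
qed

text \<open>This is the default value of \<open>omega\<close>. As a consequence a nonzero order
  already implies a nonzero function, as in \<open>ord_deriv\<close>.\<close>

lemma ord_zero [simp]: "ord \<gamma> 0 = 0"
proof -
  have "\<not> has_order_at R 0 \<gamma> m" for m
  proof
    assume "has_order_at R 0 \<gamma> m"
    then obtain u v :: "'k fps" where "ps_eval u \<gamma> \<noteq> 0" "ps_eval v \<gamma> \<noteq> 0"
      "0 = lin_fls \<gamma> powi m * (fps_to_fls u / fps_to_fls v)"
      unfolding has_order_at_iff by blast
    then show False by auto
  qed
  then show ?thesis by (simp add: omega_def)
qed

lemma ord_mult:
  assumes "g \<in> M" "h \<in> M" "g \<noteq> 0" "h \<noteq> 0" "absval \<gamma> < R"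
  shows "ord \<gamma> (g * h) = ord \<gamma> g + ord \<gamma> h"
  using assms by (intro ord_eqI has_order_mult has_order)

lemma ord_inverse:
  assumes "h \<in> M" "absval \<gamma> < R"
  shows "ord \<gamma> (inverse h) = - ord \<gamma> h"
  using assms by (cases "h = 0") (simp, intro ord_eqI has_order_inverse has_order)

lemma ord_divide:
  assumes "g \<in> M" "h \<in> M" "g \<noteq> 0" "h \<noteq> 0" "absval \<gamma> < R"
  shows "ord \<gamma> (g / h) = ord \<gamma> g - ord \<gamma> h"
  unfolding divide_inverse using assms by (simp add: ord_mult ord_inverse mero_inverse)

lemma ord_const [simp]:
  assumes "absval \<gamma> < R"
  shows "ord \<gamma> (fls_const c) = 0"
proof (cases "c = 0")
  case False
  have "has_order_at R (fls_const c) \<gamma> 0" unfolding has_order_at_iff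
    using False by (intro bexI[of _ "fps_const c"] bexI[of _ 1]) auto
  then show ?thesis by (rule ord_eqI) fact
qed (use assms in simp)

lemma ord_one [simp]: "absval \<gamma> < R \<Longrightarrow> ord \<gamma> 1 = 0"
  using ord_const[of \<gamma> 1] by simp

lemma ord_power:
  assumes "h \<in> M" "absval \<gamma> < R" "h \<noteq> 0"
  shows "ord \<gamma> (h ^ n) = int n * ord \<gamma> h"
  using assms by (induction n) (simp_all add: ord_mult mero_power algebra_simps)

lemma ord_analytic_nonneg:
  assumes "u \<in> A" "absval \<gamma> < R"
  shows "ord \<gamma> (fps_to_fls u) \<ge> 0"
proof (cases "u = 0")
  case False
  obtain k where k: "has_order_at R (fps_to_fls u) \<gamma> (int k)"
    using has_order_analytic[OF assms(1) False assms(2)] by blast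
  then show ?thesis using ord_eqI[OF k assms(2)] by simp
qed (use assms in simp)

lemma ord_analytic_zero_iff:
  assumes "u \<in> A" "u \<noteq> 0" "absval \<gamma> < R"
  shows "ord \<gamma> (fps_to_fls u) = 0 \<longleftrightarrow> ps_eval u \<gamma> \<noteq> 0"
proof -
  obtain k where k: "has_order_at R (fps_to_fls u) \<gamma> (int k)" "ps_eval u \<gamma> \<noteq> 0 \<longleftrightarrow> k = 0"
    using has_order_analytic[OF assms] by blast
  then show ?thesis using ord_eqI[OF k(1) assms(3)] by simp
qed

lemma ord_lin:
  assumes "absval \<gamma> < R"
  shows "ord \<gamma> (lin_fls \<beta>) = (if \<gamma> = \<beta> then 1 else 0)"
proof (cases "\<gamma> = \<beta>")
  case True
  have "has_order_at R (lin_fls \<beta>) \<gamma> 1" unfolding has_order_at_iff True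
    by (intro bexI[of _ 1] bexI[of _ 1]) auto
  then show ?thesis using ord_eqI[OF _ assms] True by simp
next
  case False
  then show ?thesis using ord_analytic_zero_iff[OF analytic_lin lin_fps_nonzero assms, of \<beta>] assms by simp
qed

lemma ord_add_ge_le:
  assumes "g \<in> M" "h \<in> M" "g \<noteq> 0" "h \<noteq> 0" "g + h \<noteq> 0" "absval \<gamma> < R" "ord \<gamma> g \<le> ord \<gamma> h"
  shows "ord \<gamma> (g + h) \<ge> ord \<gamma> g"
proof -
  define m where "m = ord \<gamma> g"
  define k where "k = nat (ord \<gamma> h - m)"
  have k: "ord \<gamma> h = m + int k" using assms(7) by (simp add: k_def m_def)
  obtain u v where 1: "u \<in> A" "v \<in> A" "ps_eval u \<gamma> \<noteq> 0" "ps_eval v \<gamma> \<noteq> 0"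
    "g = lin_fls \<gamma> powi m * (fps_to_fls u / fps_to_fls v)"
    using has_order[OF assms(1,3,6)] by (auto simp: has_order_at_iff m_def)
  obtain w z where 2: "w \<in> A" "z \<in> A" "ps_eval w \<gamma> \<noteq> 0" "ps_eval z \<gamma> \<noteq> 0"
    "h = lin_fls \<gamma> powi (m + int k) * (fps_to_fls w / fps_to_fls z)"
    using has_order[OF assms(2,4,6)] by (auto simp: has_order_at_iff k)
  have nz: "v \<noteq> 0" "z \<noteq> 0" using 1 2 by auto
  define y where "y = u * z + lin_fps \<gamma> ^ k * w * v"
  have y: "y \<in> A" unfolding y_def using 1 2 by (intro analytic_intros)
  have vz: "v * z \<in> A" "ps_eval (v * z) \<gamma> \<noteq> 0" "v * z \<noteq> 0"
    using 1 2 nz assms(6) by (auto simp: ps_eval_mult intro: analytic_intros)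
  have gh: "g + h = lin_fls \<gamma> powi m * (fps_to_fls y / fps_to_fls (v * z))"
    unfolding 1(5) 2(5) y_def using nz
    by (simp add: power_int_add fls_times_fps_to_fls fps_to_fls_power field_simps)
  then have y0: "y \<noteq> 0" using assms(5) by auto
  have "ord \<gamma> (lin_fls \<gamma> powi m) = m"
    by (rule ord_eqI[OF _ assms(6)]) (unfold has_order_at_iff, intro bexI[of _ 1] bexI[of _ 1], auto)
  then have "ord \<gamma> (g + h) = m + (ord \<gamma> (fps_to_fls y) - ord \<gamma> (fps_to_fls (v * z)))"
    unfolding gh using y y0 vz assms(6)
    by (subst ord_mult) (auto simp: ord_divide mero_powi mero_lin mero_analytic mero_divide)
  also have "ord \<gamma> (fps_to_fls (v * z)) = 0" using ord_analytic_zero_iff[OF vz(1,3) assms(6)] vz(2) by simp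
  finally show ?thesis using ord_analytic_nonneg[OF y assms(6)] by (simp add: m_def)
qed

lemma ord_add_ge:
  assumes "g \<in> M" "h \<in> M" "g \<noteq> 0" "h \<noteq> 0" "g + h \<noteq> 0" "absval \<gamma> < R"
  shows "ord \<gamma> (g + h) \<ge> min (ord \<gamma> g) (ord \<gamma> h)"
  using ord_add_ge_le[OF assms] ord_add_ge_le[OF assms(2,1,4,3) _ assms(6)] assms(5)
  by (auto simp: add.commute min_def)

lemma ord_uminus:
  assumes "h \<in> M" "absval \<gamma> < R"
  shows "ord \<gamma> (- h) = ord \<gamma> h"
proof (cases "h = 0")
  case False
  then have "ord \<gamma> (fls_const (-1) * h) = ord \<gamma> (fls_const (-1)) + ord \<gamma> h"
    using assms mero_const[of "-1"] by (intro ord_mult) auto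
  then show ?thesis using assms ord_const[OF assms(2), of "-1"] by simp
qed simp

lemma ord_add_eq:
  assumes "g \<in> M" "h \<in> M" "g \<noteq> 0" "absval \<gamma> < R" "h \<noteq> 0 \<Longrightarrow> ord \<gamma> g < ord \<gamma> h"
  shows "ord \<gamma> (g + h) = ord \<gamma> g" "g + h \<noteq> 0"
proof -
  have "ord \<gamma> (g + h) = ord \<gamma> g \<and> g + h \<noteq> 0"
  proof (cases "h = 0")
    case False
    have nz: "g + h \<noteq> 0"
    proof
      assume "g + h = 0"
      then have "g = - h" by (simp add: eq_neg_iff_add_eq_0)
      then show False using assms(5)[OF False] ord_uminus[OF assms(2,4)] by simp
    qed
    have "ord \<gamma> (g + h) \<ge> ord \<gamma> g"
      using ord_add_ge[OF assms(1-3) False nz assms(4)] assms(5)[OF False] by simp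
    moreover have "ord \<gamma> ((g + h) + - h) \<ge> min (ord \<gamma> (g + h)) (ord \<gamma> (- h))"
      using assms False nz by (intro ord_add_ge mero_intros) auto
    ultimately show ?thesis using assms(5)[OF False] nz ord_uminus[OF assms(2,4)] by simp
  qed (use assms in simp)
  then show "ord \<gamma> (g + h) = ord \<gamma> g" "g + h \<noteq> 0" by auto
qed

text \<open>The claim on \<open>fls_deriv q\<close> holds because the quotient rule only squares a
  denominator that does not vanish at \<open>\<gamma>\<close>; it controls the remainder in
  \<open>ord_deriv\<close>.\<close>

lemma mero_at_point:
  assumes "h \<in> M" "h \<noteq> 0" "absval \<gamma> < R"
  obtains q where "q \<in> M" "q \<noteq> 0" "ord \<gamma> q = 0" "h = lin_fls \<gamma> powi ord \<gamma> h * q"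
    "fls_deriv q \<noteq> 0 \<Longrightarrow> ord \<gamma> (fls_deriv q) \<ge> 0"
proof -
  obtain u v where 1: "u \<in> A" "v \<in> A" "ps_eval u \<gamma> \<noteq> 0" "ps_eval v \<gamma> \<noteq> 0"
    "h = lin_fls \<gamma> powi ord \<gamma> h * (fps_to_fls u / fps_to_fls v)"
    using has_order[OF assms] by (auto simp: has_order_at_iff)
  define q where "q = fps_to_fls u / fps_to_fls v"
  have nz: "u \<noteq> 0" "v \<noteq> 0" using 1 by auto
  have q: "q \<in> M" "q \<noteq> 0" unfolding q_def using nz 1 by (auto intro: mero_I)
  have "has_order_at R q \<gamma> 0" unfolding has_order_at_iff q_def using 1 by auto
  then have "ord \<gamma> q = 0" by (rule ord_eqI) fact
  moreover have "ord \<gamma> (fls_deriv q) \<ge> 0"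
  proof -
    define y where "y = fps_deriv u * v - u * fps_deriv v"
    have y: "y \<in> A" unfolding y_def using 1 by (intro analytic_intros)
    have vz: "v * v \<in> A" "ps_eval (v * v) \<gamma> \<noteq> 0" "v * v \<noteq> 0"
      using 1 nz assms by (auto simp: ps_eval_mult intro: analytic_intros)
    have eq: "fls_deriv q = fps_to_fls y / fps_to_fls (v * v)"
      unfolding q_def y_def using nz by (subst fls_deriv_quotient)
      (simp_all add: fls_deriv_fps_to_fls fls_times_fps_to_fls power2_eq_square)
    show ?thesis
    proof (cases "y = 0")
      case False
      have "ord \<gamma> (fls_deriv q) = ord \<gamma> (fps_to_fls y) - ord \<gamma> (fps_to_fls (v * v))"
        unfolding eq using y vz False assms(3) by (intro ord_divide mero_analytic) auto
      also have "ord \<gamma> (fps_to_fls (v * v)) = 0" using ord_analytic_zero_iff[OF vz(1,3) assms(3)] vz(2) by simp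
      finally show ?thesis using ord_analytic_nonneg[OF y assms(3)] by simp
    qed (use assms(3) in \<open>simp add: eq\<close>)
  qed
  ultimately show ?thesis using q 1(5) by (intro that[of q]) (auto simp: q_def)
qed

lemma ord_lin_powi: "absval \<gamma> < R \<Longrightarrow> ord \<gamma> (lin_fls \<gamma> powi m) = m"
  by (rule ord_eqI) (unfold has_order_at_iff, intro bexI[of _ 1] bexI[of _ 1], auto)

text \<open>In the product rule for \<open>lin_fls \<gamma> powi m * q\<close> the summand that
  differentiates the power has strictly smaller order than the other, because \<open>m\<close> is
  nonzero in characteristic 0.\<close>

lemma ord_deriv:
  assumes "h \<in> M" "absval \<gamma> < R" "ord \<gamma> h \<noteq> 0"
  shows "ord \<gamma> (fls_deriv h) = ord \<gamma> h - 1" "fls_deriv h \<noteq> 0"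
proof -
  have h0: "h \<noteq> 0" using assms by auto
  define m where "m = ord \<gamma> h"
  obtain q where q: "q \<in> M" "q \<noteq> 0" "ord \<gamma> q = 0" "h = lin_fls \<gamma> powi m * q"
    "fls_deriv q \<noteq> 0 \<Longrightarrow> ord \<gamma> (fls_deriv q) \<ge> 0"
    using mero_at_point[OF assms(1) h0 assms(2)] by (auto simp: m_def)
  define g where "g = of_int m * lin_fls \<gamma> powi (m - 1) * q"
  define k where "k = lin_fls \<gamma> powi m * fls_deriv q"
  have eq: "fls_deriv h = g + k"
    unfolding q(4) g_def k_def by (simp add: fls_deriv_lin_powi)
  have m0: "(of_int m :: 'k fls) \<noteq> 0" using assms(3) by (simp add: m_def)
  have mc: "(of_int m :: 'k fls) = fls_const (of_int m)" by (simp add: fls_of_int)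
  have Mm: "(of_int m :: 'k fls) \<in> M" unfolding mc by simp
  have Mp: "lin_fls \<gamma> powi j \<in> M" for j by (intro mero_powi mero_lin)
  have gM: "g \<in> M" "g \<noteq> 0" "k \<in> M"
    unfolding g_def k_def using q m0 Mm Mp by (auto intro!: mero_mult mero_deriv)
  have og: "ord \<gamma> g = m - 1"
    unfolding g_def using q m0 assms(2) Mm Mp
    by (subst ord_mult, simp_all add: mero_mult)+ (simp add: ord_lin_powi mc)
  have ok: "k \<noteq> 0 \<Longrightarrow> ord \<gamma> k \<ge> m"
    unfolding k_def using q assms(2) Mp
    by (subst ord_mult) (auto simp: ord_lin_powi mero_deriv)
  show "ord \<gamma> (fls_deriv h) = ord \<gamma> h - 1" "fls_deriv h \<noteq> 0"
    unfolding eq using ord_add_eq[OF gM(1,3,2) assms(2)] og ok by (force simp: m_def)+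
qed

lemma ord_deriv_nonneg:
  assumes "h \<in> M" "absval \<gamma> < R" "ord \<gamma> h \<ge> 0"
  shows "ord \<gamma> (fls_deriv h) \<ge> 0"
proof (cases "ord \<gamma> h = 0")
  case True
  show ?thesis
  proof (cases "fls_deriv h = 0")
    case False
    then have h0: "h \<noteq> 0" by auto
    obtain q where "h = lin_fls \<gamma> powi ord \<gamma> h * q" "fls_deriv q \<noteq> 0 \<Longrightarrow> ord \<gamma> (fls_deriv q) \<ge> 0"
      using mero_at_point[OF assms(1) h0 assms(2)] by blast
    then show ?thesis using False True by simp
  qed (use assms in simp)
qed (use ord_deriv[OF assms(1,2)] assms in simp)

lemma ord_deriv_ge:
  assumes "h \<in> M" "absval \<gamma> < R"
  shows "ord \<gamma> (fls_deriv h) \<ge> ord \<gamma> h - 1"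
  using ord_deriv[OF assms] ord_deriv_nonneg[OF assms] by (cases "ord \<gamma> h = 0") auto

end

section \<open>Locally finite divisors and their counting functions\<close>

definition divisor_locfin :: "real \<Rightarrow> ('k::ultrametric_field \<Rightarrow> real) \<Rightarrow> bool" where
  "divisor_locfin R D \<longleftrightarrow> (\<forall>r<R. finite {\<gamma>. absval \<gamma> \<le> r \<and> D \<gamma> \<noteq> 0})"

text \<open>Counting function of a divisor, as the integral of \<open>n(t) / t\<close> from \<open>\<rho>\<close> to \<open>r\<close>. Compared with the
  usual one it differs by a bounded amount, and the origin may belong to the divisor.\<close>

definition counting :: "real \<Rightarrow> real \<Rightarrow> ('k::ultrametric_field \<Rightarrow> real) \<Rightarrow> real" where
  "counting \<rho> r D = (\<Sum>\<gamma> | absval \<gamma> \<le> r \<and> D \<gamma> \<noteq> 0. D \<gamma> * (ln r - ln (max \<rho> (absval \<gamma>))))"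

lemma counting_eq_sum:
  assumes "finite S" "S \<subseteq> {\<gamma>. absval \<gamma> \<le> r}" "{\<gamma>. absval \<gamma> \<le> r \<and> D \<gamma> \<noteq> 0} \<subseteq> S"
  shows "counting \<rho> r D = (\<Sum>\<gamma>\<in>S. D \<gamma> * (ln r - ln (max \<rho> (absval \<gamma>))))"
  unfolding counting_def using assms by (intro sum.mono_neutral_left) auto

lemma counting_weight_nonneg:
  fixes \<gamma> :: "'k::ultrametric_field"
  assumes "0 < \<rho>" "\<rho> \<le> r" "absval \<gamma> \<le> r"
  shows "ln r - ln (max \<rho> (absval \<gamma>)) \<ge> 0"
proof -
  have "0 < max \<rho> (absval \<gamma>)" "max \<rho> (absval \<gamma>) \<le> r" using assms by auto
  then show ?thesis by (simp add: ln_mono)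
qed

lemma counting_nonneg:
  assumes "0 < \<rho>" "\<rho> \<le> r" "\<And>\<gamma>. D \<gamma> \<ge> 0"
  shows "counting \<rho> r D \<ge> 0"
  unfolding counting_def
  by (intro sum_nonneg mult_nonneg_nonneg assms(3) counting_weight_nonneg) (use assms in auto)

lemma counting_zero [simp]: "counting \<rho> r (\<lambda>_. 0) = 0"
  by (simp add: counting_def)

lemma divisor_locfin_zero [simp]: "divisor_locfin R (\<lambda>_. 0)"
  by (simp add: divisor_locfin_def)

lemma divisor_locfin_subset:
  assumes "divisor_locfin R D" "\<And>\<gamma>. absval \<gamma> < R \<Longrightarrow> E \<gamma> \<noteq> 0 \<Longrightarrow> D \<gamma> \<noteq> 0"
  shows "divisor_locfin R E"
  unfolding divisor_locfin_def
proof (intro allI impI)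
  fix r assume r: "r < R"
  show "finite {\<gamma>. absval \<gamma> \<le> r \<and> E \<gamma> \<noteq> 0}"
    by (rule finite_subset[of _ "{\<gamma>. absval \<gamma> \<le> r \<and> D \<gamma> \<noteq> 0}"])
      (use assms r in \<open>auto simp: divisor_locfin_def\<close>)
qed

lemma divisor_locfin_Un:
  assumes "divisor_locfin R D" "divisor_locfin R E"
    "\<And>\<gamma>. absval \<gamma> < R \<Longrightarrow> F \<gamma> \<noteq> 0 \<Longrightarrow> D \<gamma> \<noteq> 0 \<or> E \<gamma> \<noteq> 0"
  shows "divisor_locfin R F"
  unfolding divisor_locfin_def
proof (intro allI impI)
  fix r assume r: "r < R"
  show "finite {\<gamma>. absval \<gamma> \<le> r \<and> F \<gamma> \<noteq> 0}"
    by (rule finite_subset[of _ "{\<gamma>. absval \<gamma> \<le> r \<and> D \<gamma> \<noteq> 0} \<union> {\<gamma>. absval \<gamma> \<le> r \<and> E \<gamma> \<noteq> 0}"])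
      (use assms r in \<open>auto simp: divisor_locfin_def\<close>)
qed

lemma divisor_locfin_add:
  "divisor_locfin R D \<Longrightarrow> divisor_locfin R E \<Longrightarrow> divisor_locfin R (\<lambda>\<gamma>. D \<gamma> + E \<gamma>)"
  by (erule (1) divisor_locfin_Un) auto

lemma divisor_locfin_cmult: "divisor_locfin R D \<Longrightarrow> divisor_locfin R (\<lambda>\<gamma>. c * D \<gamma>)"
  by (erule divisor_locfin_subset) auto

lemma counting_add:
  assumes "divisor_locfin R D" "divisor_locfin R E" "r < R"
  shows "counting \<rho> r (\<lambda>\<gamma>. D \<gamma> + E \<gamma>) = counting \<rho> r D + counting \<rho> r E"
proof -
  define S where "S = {\<gamma>. absval \<gamma> \<le> r \<and> D \<gamma> \<noteq> 0} \<union> {\<gamma>. absval \<gamma> \<le> r \<and> E \<gamma> \<noteq> 0}"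
  have S: "finite S" "S \<subseteq> {\<gamma>. absval \<gamma> \<le> r}"
    using assms unfolding S_def divisor_locfin_def by blast+
  note c = counting_eq_sum[OF S]
  have "counting \<rho> r (\<lambda>\<gamma>. D \<gamma> + E \<gamma>) = (\<Sum>\<gamma>\<in>S. (D \<gamma> + E \<gamma>) * (ln r - ln (max \<rho> (absval \<gamma>))))"
    by (rule c) (auto simp: S_def)
  moreover have "counting \<rho> r D = (\<Sum>\<gamma>\<in>S. D \<gamma> * (ln r - ln (max \<rho> (absval \<gamma>))))"
    by (rule c) (auto simp: S_def)
  moreover have "counting \<rho> r E = (\<Sum>\<gamma>\<in>S. E \<gamma> * (ln r - ln (max \<rho> (absval \<gamma>))))"
    by (rule c) (auto simp: S_def)
  ultimately show ?thesis by (simp add: distrib_right sum.distrib)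
qed

lemma counting_cmult: "counting \<rho> r (\<lambda>\<gamma>. c * D \<gamma>) = c * counting \<rho> r D"
proof (cases "c = 0")
  case False
  then show ?thesis unfolding counting_def by (simp add: sum_distrib_left mult.assoc)
qed simp

lemma counting_mono:
  assumes "divisor_locfin R D" "divisor_locfin R E" "r < R" "0 < \<rho>" "\<rho> \<le> r"
    and "\<And>\<gamma>. absval \<gamma> < R \<Longrightarrow> D \<gamma> \<le> E \<gamma>"
  shows "counting \<rho> r D \<le> counting \<rho> r E"
proof -
  define S where "S = {\<gamma>. absval \<gamma> \<le> r \<and> D \<gamma> \<noteq> 0} \<union> {\<gamma>. absval \<gamma> \<le> r \<and> E \<gamma> \<noteq> 0}"
  have S: "finite S" "S \<subseteq> {\<gamma>. absval \<gamma> \<le> r}"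
    using assms(1-3) unfolding S_def divisor_locfin_def by blast+
  note c = counting_eq_sum[OF S]
  have "counting \<rho> r D = (\<Sum>\<gamma>\<in>S. D \<gamma> * (ln r - ln (max \<rho> (absval \<gamma>))))"
    by (rule c) (auto simp: S_def)
  also have "\<dots> \<le> (\<Sum>\<gamma>\<in>S. E \<gamma> * (ln r - ln (max \<rho> (absval \<gamma>))))"
  proof (rule sum_mono)
    fix \<gamma> assume "\<gamma> \<in> S"
    then have "absval \<gamma> \<le> r" using S by auto
    then show "D \<gamma> * (ln r - ln (max \<rho> (absval \<gamma>))) \<le> E \<gamma> * (ln r - ln (max \<rho> (absval \<gamma>)))"
      using assms(3-6) by (intro mult_right_mono counting_weight_nonneg) auto
  qed
  also have "\<dots> = counting \<rho> r E"
    by (rule c[symmetric]) (auto simp: S_def)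
  finally show ?thesis .
qed

lemma counting_mono_radius:
  assumes "divisor_locfin R D" "s < R" "0 < \<rho>" "\<rho> \<le> r" "r \<le> s" "\<And>\<gamma>. D \<gamma> \<ge> 0"
  shows "counting \<rho> r D \<le> counting \<rho> s D"
proof -
  have "counting \<rho> r D \<le> (\<Sum>\<gamma> | absval \<gamma> \<le> r \<and> D \<gamma> \<noteq> 0. D \<gamma> * (ln s - ln (max \<rho> (absval \<gamma>))))"
    unfolding counting_def using assms by (intro sum_mono mult_left_mono) auto
  also have "\<dots> \<le> counting \<rho> s D"
    unfolding counting_def
  proof (rule sum_mono2)
    show "finite {\<gamma>. absval \<gamma> \<le> s \<and> D \<gamma> \<noteq> 0}" using assms by (auto simp: divisor_locfin_def)
    fix \<gamma> assume "\<gamma> \<in> {\<gamma>. absval \<gamma> \<le> s \<and> D \<gamma> \<noteq> 0} - {\<gamma>. absval \<gamma> \<le> r \<and> D \<gamma> \<noteq> 0}"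
    then show "0 \<le> D \<gamma> * (ln s - ln (max \<rho> (absval \<gamma>)))"
      using assms by (intro mult_nonneg_nonneg counting_weight_nonneg) auto
  qed (use assms in auto)
  finally show ?thesis .
qed

context ultrametric_disk
begin

subsection \<open>Gauss norms of meromorphic functions\<close>

lemma nrm_eq:
  assumes "u \<in> A" "v \<in> A" "v \<noteq> 0" "0 < r" "r < R"
  shows "nrm r (fps_to_fls u / fps_to_fls v) = gauss_norm r u / gauss_norm r v"
  unfolding mero_norm_def
proof (rule the_equality)
  show "\<exists>u'\<in>A. \<exists>v'\<in>A. v' \<noteq> 0 \<and> fps_to_fls u / fps_to_fls v = fps_to_fls u' / fps_to_fls v' \<and>
      gauss_norm r u / gauss_norm r v = gauss_norm r u' / gauss_norm r v'"
    using assms by blast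
next
  fix y assume "\<exists>u'\<in>A. \<exists>v'\<in>A. v' \<noteq> 0 \<and> fps_to_fls u / fps_to_fls v = fps_to_fls u' / fps_to_fls v' \<and>
      y = gauss_norm r u' / gauss_norm r v'"
  then obtain u' v' where *: "u' \<in> A" "v' \<in> A" "v' \<noteq> 0"
    "fps_to_fls u / fps_to_fls v = fps_to_fls u' / fps_to_fls v'"
    "y = gauss_norm r u' / gauss_norm r v'" by blast
  have "fps_to_fls (u * v') = fps_to_fls (u' * v)"
    using *(3,4) assms(3) by (simp add: fls_times_fps_to_fls field_simps)
  then have "u * v' = u' * v" by (simp only: fps_to_fls_eq_iff)
  then have "gauss_norm r u * gauss_norm r v' = gauss_norm r u' * gauss_norm r v"
    using * assms by (metis gauss_norm_mult conv)
  moreover have "gauss_norm r v > 0" "gauss_norm r v' > 0"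
    using gauss_norm_pos[OF conv] * assms by blast+
  ultimately show "y = gauss_norm r u / gauss_norm r v"
    unfolding *(5) by (subst frac_eq_eq) auto
qed

lemma nrm_analytic:
  assumes "u \<in> A" "0 < r" "r < R"
  shows "nrm r (fps_to_fls u) = gauss_norm r u"
  using nrm_eq[OF assms(1) analytic_one _ assms(2,3)] gauss_norm_const[OF assms(2), of "1::'k"] by simp

context
  fixes r :: real
  assumes r: "0 < r" "r < R"
begin

lemma nrm_const [simp]: "nrm r (fls_const c) = absval c"
  using nrm_analytic[OF analytic_const r, of c] r by simp

lemma nrm_zero [simp]: "nrm r 0 = 0" using nrm_const[of 0] by simp
lemma nrm_one [simp]: "nrm r 1 = 1" using nrm_const[of 1] by simp

lemma nrm_mult:
  assumes "g \<in> M" "h \<in> M"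
  shows "nrm r (g * h) = nrm r g * nrm r h"
proof -
  obtain u v where 1: "u \<in> A" "v \<in> A" "v \<noteq> 0" "g = fps_to_fls u / fps_to_fls v"
    using assms(1) by (rule mero_E)
  obtain w z where 2: "w \<in> A" "z \<in> A" "z \<noteq> 0" "h = fps_to_fls w / fps_to_fls z"
    using assms(2) by (rule mero_E)
  have "g * h = fps_to_fls (u * w) / fps_to_fls (v * z)"
    using 1 2 by (simp add: fls_times_fps_to_fls)
  then have "nrm r (g * h) = gauss_norm r (u * w) / gauss_norm r (v * z)"
    using 1 2 r by (simp only: nrm_eq analytic_intros no_zero_divisors simp_thms)
  also have "\<dots> = nrm r g * nrm r h"
    unfolding 1(4) 2(4) nrm_eq[OF 1(1-3) r] nrm_eq[OF 2(1-3) r]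
    using 1 2 r by (simp add: gauss_norm_mult conv)
  finally show ?thesis .
qed

lemma nrm_pos:
  assumes "h \<in> M" "h \<noteq> 0"
  shows "nrm r h > 0"
proof -
  obtain u v where 1: "u \<in> A" "v \<in> A" "v \<noteq> 0" "h = fps_to_fls u / fps_to_fls v"
    using assms(1) by (rule mero_E)
  then have "u \<noteq> 0" using assms by auto
  then show ?thesis unfolding 1(4) nrm_eq[OF 1(1-3) r]
    using gauss_norm_pos[OF conv[OF 1(1) r] r(1)] gauss_norm_pos[OF conv[OF 1(2) r] r(1) 1(3)] by simp
qed

lemma nrm_nonneg: "h \<in> M \<Longrightarrow> nrm r h \<ge> 0"
  using nrm_pos[of h] by (cases "h = 0") auto

lemma nrm_add_le:
  assumes "g \<in> M" "h \<in> M"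
  shows "nrm r (g + h) \<le> max (nrm r g) (nrm r h)"
proof -
  obtain u v where 1: "u \<in> A" "v \<in> A" "v \<noteq> 0" "g = fps_to_fls u / fps_to_fls v"
    using assms(1) by (rule mero_E)
  obtain w z where 2: "w \<in> A" "z \<in> A" "z \<noteq> 0" "h = fps_to_fls w / fps_to_fls z"
    using assms(2) by (rule mero_E)
  have vz: "v * z \<in> A" "v * z \<noteq> 0" using 1 2 by (auto intro: analytic_intros)
  have uz: "u * z \<in> A" "w * v \<in> A" using 1 2 by (auto intro: analytic_intros)
  have g: "g = fps_to_fls (u * z) / fps_to_fls (v * z)"
    using 1 2 by (simp add: fls_times_fps_to_fls)
  have h: "h = fps_to_fls (w * v) / fps_to_fls (v * z)"
    using 1 2 by (simp add: fls_times_fps_to_fls)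
  have gh: "g + h = fps_to_fls (u * z + w * v) / fps_to_fls (v * z)"
    unfolding g h by (simp add: add_divide_distrib)
  have pos: "gauss_norm r (v * z) > 0" by (rule gauss_norm_pos[OF conv[OF vz(1) r] r(1) vz(2)])
  have "nrm r (g + h) = gauss_norm r (u * z + w * v) / gauss_norm r (v * z)"
    unfolding gh by (rule nrm_eq[OF analytic_add[OF uz] vz r])
  also have "\<dots> \<le> max (gauss_norm r (u * z)) (gauss_norm r (w * v)) / gauss_norm r (v * z)"
    using pos by (intro divide_right_mono gauss_norm_add_le conv uz r) simp
  also have "\<dots> = max (gauss_norm r (u * z) / gauss_norm r (v * z)) (gauss_norm r (w * v) / gauss_norm r (v * z))"
    using pos by (simp add: max_def divide_le_cancel)
  also have "\<dots> = max (nrm r g) (nrm r h)"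
    unfolding g h by (simp only: nrm_eq[OF uz(1) vz r] nrm_eq[OF uz(2) vz r])
  finally show ?thesis .
qed

lemma nrm_uminus: "h \<in> M \<Longrightarrow> nrm r (- h) = nrm r h"
  using nrm_mult[OF mero_const[of "-1"], of h] nrm_const[of "-1"] by simp

lemma nrm_add_eq:
  assumes "g \<in> M" "h \<in> M" "nrm r g < nrm r h"
  shows "nrm r (g + h) = nrm r h"
proof (rule antisym)
  show "nrm r (g + h) \<le> nrm r h" using nrm_add_le[OF assms(1,2)] assms(3) by simp
  have "nrm r ((g + h) + - g) \<le> max (nrm r (g + h)) (nrm r (- g))"
    using assms by (intro nrm_add_le mero_intros)
  then show "nrm r h \<le> nrm r (g + h)" using assms nrm_uminus[OF assms(1)] by (simp add: le_max_iff_disj)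
qed

lemma nrm_inverse:
  assumes "h \<in> M"
  shows "nrm r (inverse h) = inverse (nrm r h)"
proof (cases "h = 0")
  case False
  have "nrm r h * nrm r (inverse h) = 1"
    using nrm_mult[OF assms mero_inverse[OF assms]] False by simp
  then show ?thesis using nrm_pos[OF assms False] by (simp add: field_simps)
qed simp

lemma nrm_divide: "g \<in> M \<Longrightarrow> h \<in> M \<Longrightarrow> nrm r (g / h) = nrm r g / nrm r h"
  by (simp add: divide_inverse nrm_mult nrm_inverse mero_inverse)

lemma nrm_power: "h \<in> M \<Longrightarrow> nrm r (h ^ n) = nrm r h ^ n"
  by (induction n) (simp_all add: nrm_mult mero_power)

text \<open>Lemma on the logarithmic derivative: in the quotient rule both summands of the numerator
  have norm at most \<open>gauss_norm r u * gauss_norm r v / r\<close>, by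
  \<open>conv_at_deriv\<close>. Unlike its complex counterpart it has no error term.\<close>

lemma nrm_deriv_le:
  assumes "h \<in> M"
  shows "nrm r (fls_deriv h) \<le> nrm r h / r"
proof -
  obtain u v where 1: "u \<in> A" "v \<in> A" "v \<noteq> 0" "h = fps_to_fls u / fps_to_fls v"
    using assms(1) by (rule mero_E)
  have pos: "gauss_norm r v > 0" by (rule gauss_norm_pos[OF conv[OF 1(2) r] r(1) 1(3)])
  have upos: "gauss_norm r u \<ge> 0" by (rule gauss_norm_nonneg[OF conv[OF 1(1) r]])
  have vv: "v * v \<in> A" "v * v \<noteq> 0" using 1 by (auto intro: analytic_intros)
  have a: "fps_deriv u * v \<in> A" "u * fps_deriv v \<in> A" using 1 by (auto intro: analytic_intros)
  have "fls_deriv h = fps_to_fls (fps_deriv u * v - u * fps_deriv v) / fps_to_fls (v * v)"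
    unfolding 1(4) using 1(3)
    by (subst fls_deriv_quotient)
      (simp_all add: fls_deriv_fps_to_fls fls_times_fps_to_fls power2_eq_square)
  then have "nrm r (fls_deriv h) = gauss_norm r (fps_deriv u * v + - (u * fps_deriv v)) / gauss_norm r (v * v)"
    using nrm_eq[OF analytic_diff[OF a] vv r] by simp
  also have "\<dots> \<le> (gauss_norm r u * gauss_norm r v / r) / gauss_norm r (v * v)"
  proof (rule divide_right_mono)
    have "gauss_norm r (fps_deriv u * v + - (u * fps_deriv v))
      \<le> max (gauss_norm r (fps_deriv u * v)) (gauss_norm r (- (u * fps_deriv v)))"
      using a r by (intro gauss_norm_add_le) (simp_all add: conv)
    also have "gauss_norm r (fps_deriv u * v) = gauss_norm r (fps_deriv u) * gauss_norm r v"
      using 1 r by (simp add: gauss_norm_mult conv analytic_deriv)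
    also have "gauss_norm r (- (u * fps_deriv v)) = gauss_norm r u * gauss_norm r (fps_deriv v)"
      using 1 r by (simp add: gauss_norm_mult conv analytic_deriv)
    also have "max (gauss_norm r (fps_deriv u) * gauss_norm r v) (gauss_norm r u * gauss_norm r (fps_deriv v))
        \<le> gauss_norm r u * gauss_norm r v / r"
      using mult_right_mono[OF conv_at_deriv(2)[OF conv[OF 1(1) r] r(1)] less_imp_le[OF pos]]
        mult_left_mono[OF conv_at_deriv(2)[OF conv[OF 1(2) r] r(1)] upos] by simp
    finally show "gauss_norm r (fps_deriv u * v + - (u * fps_deriv v)) \<le> gauss_norm r u * gauss_norm r v / r" .
    show "0 \<le> gauss_norm r (v * v)" by (rule gauss_norm_nonneg[OF conv[OF vv(1) r]])
  qed
  also have "gauss_norm r (v * v) = gauss_norm r v * gauss_norm r v"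
    using 1 r by (simp add: gauss_norm_mult conv)
  also have "gauss_norm r u * gauss_norm r v / r / (gauss_norm r v * gauss_norm r v) = nrm r h / r"
    unfolding 1(4) nrm_eq[OF 1(1-3) r] using pos by simp
  finally show ?thesis .
qed

end

subsection \<open>Jensen's formula\<close>

lemma dom_index_lin_mult:
  assumes "w \<in> A" "w \<noteq> 0" "0 < r" "r < R" "absval \<beta> \<le> r"
  shows "dom_index r (lin_fps \<beta> * w) = Suc (dom_index r w)"
  using dom_index_mult[OF conv_at_lin conv[OF assms(1,3,4)] assms(3) lin_fps_nonzero assms(2), of \<beta>]
    gauss_norm_lin(2)[OF assms(3), of \<beta>] assms(5) by simp

text \<open>Weierstrass preparation as an induction rule: \<open>exists_zero\<close> and division
  split off the zeros in the closed disk until the index is 0.\<close>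

lemma zero_induct [consumes 4, case_names no_zero zero]:
  assumes "u \<in> A" "u \<noteq> 0" "0 < r" "r < R"
    and "\<And>u. u \<in> A \<Longrightarrow> u \<noteq> 0 \<Longrightarrow> dom_index r u = 0 \<Longrightarrow> P u"
    and "\<And>\<beta> w. w \<in> A \<Longrightarrow> w \<noteq> 0 \<Longrightarrow> absval \<beta> \<le> r \<Longrightarrow> P w \<Longrightarrow> P (lin_fps \<beta> * w)"
  shows "P u"
  using assms(1,2)
proof (induction "dom_index r u" arbitrary: u)
  case 0
  then show ?case using assms(5) by simp
next
  case (Suc n)
  obtain \<beta> where \<beta>: "absval \<beta> \<le> r" "ps_eval u \<beta> = 0"
    using exists_zero[OF Suc.prems assms(3,4)] Suc.hyps(2) by (metis zero_less_Suc)
  then have "absval \<beta> < R" using assms(4) by simp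
  then obtain w where w: "w \<in> A" "u = lin_fps \<beta> * w"
    using analytic_division[OF Suc.prems(1), of \<beta>] \<beta>(2) by (metis add_0_left fps_const_0_eq_0)
  then have "w \<noteq> 0" using Suc.prems(2) by auto
  then show ?case unfolding w(2)
    using w \<beta>(1) Suc.hyps(1)[of w] Suc.hyps(2) dom_index_lin_mult[OF w(1) _ assms(3,4) \<beta>(1)]
    by (intro assms(6)) auto
qed

text \<open>The weight of the constant term does not depend on the radius, and all other weights
  only decrease with it.\<close>

lemma gauss_norm_dom_0:
  assumes "u \<in> A" "u \<noteq> 0" "0 < \<rho>" "\<rho> \<le> r" "r < R" "dom_index r u = 0"
  shows "gauss_norm \<rho> u = gauss_norm r u"
proof -
  have r: "0 < r" using assms by linarith
  have \<rho>: "\<rho> < R" using assms by linarith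
  have 0: "absval (fps_nth u 0) = gauss_norm r u"
    using dom_index(1)[OF conv[OF assms(1) r assms(5)] r assms(2)] assms(6) by simp
  show ?thesis
  proof (rule antisym)
    show "gauss_norm \<rho> u \<le> gauss_norm r u"
    proof (rule gauss_norm_le)
      fix n
      have "absval (fps_nth u n) * \<rho> ^ n \<le> absval (fps_nth u n) * r ^ n"
        using assms by (intro mult_left_mono power_mono) auto
      then show "absval (fps_nth u n) * \<rho> ^ n \<le> gauss_norm r u"
        using gauss_norm_ge[OF conv[OF assms(1) r assms(5)], of n] by linarith
    qed
    show "gauss_norm r u \<le> gauss_norm \<rho> u"
      using gauss_norm_ge[OF conv[OF assms(1,3) \<rho>], of 0] 0 by simp
  qed
qed

text \<open>Both sides are additive under products. A factor without zeros has the same norm at both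
  radii, and \<open>lin_fps \<beta>\<close> contributes
  \<open>ln r - ln (max \<rho> (absval \<beta>))\<close>, which is its weight in
  \<open>counting\<close>.\<close>

lemma jensen_analytic:
  assumes "u \<in> A" "u \<noteq> 0" "0 < \<rho>" "\<rho> \<le> r" "r < R"
  shows "finite {\<gamma>. absval \<gamma> \<le> r \<and> ord \<gamma> (fps_to_fls u) \<noteq> 0}"
    and "ln (gauss_norm r u) - ln (gauss_norm \<rho> u) = counting \<rho> r (\<lambda>\<gamma>. of_int (ord \<gamma> (fps_to_fls u)))"
proof -
  have r: "0 < r" using assms by linarith
  have \<rho>: "\<rho> < R" using assms by linarith
  have "finite {\<gamma>. absval \<gamma> \<le> r \<and> ord \<gamma> (fps_to_fls u) \<noteq> 0} \<and>
    ln (gauss_norm r u) - ln (gauss_norm \<rho> u) = counting \<rho> r (\<lambda>\<gamma>. of_int (ord \<gamma> (fps_to_fls u)))"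
    using assms(1,2) r assms(5)
  proof (induction u rule: zero_induct)
    case (no_zero u)
    have e: "{\<gamma>. absval \<gamma> \<le> r \<and> ord \<gamma> (fps_to_fls u) \<noteq> 0} = {}"
      using dom_index_0_imp_no_zero[OF no_zero(1,2) _ r assms(5) no_zero(3)]
        ord_analytic_zero_iff[OF no_zero(1,2)] assms(5) by force
    then have "counting \<rho> r (\<lambda>\<gamma>. of_int (ord \<gamma> (fps_to_fls u))) = 0"
      unfolding counting_def of_int_eq_0_iff by simp
    then show ?case unfolding e using gauss_norm_dom_0[OF no_zero(1,2) assms(3-5) no_zero(3)] by simp
  next
    case (zero \<beta> w)
    let ?S = "insert \<beta> {\<gamma>. absval \<gamma> \<le> r \<and> ord \<gamma> (fps_to_fls w) \<noteq> 0}"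
    let ?w = "\<lambda>\<gamma>::'k. ln r - ln (max \<rho> (absval \<gamma>))"
    have ord: "ord \<gamma> (fps_to_fls (lin_fps \<beta> * w)) = (if \<gamma> = \<beta> then 1 else 0) + ord \<gamma> (fps_to_fls w)"
      if "absval \<gamma> \<le> r" for \<gamma>
      using that zero(1,2) assms(5)
      by (simp add: fls_times_fps_to_fls ord_mult ord_lin mero_lin mero_analytic)
    have sub: "{\<gamma>. absval \<gamma> \<le> r \<and> ord \<gamma> (fps_to_fls (lin_fps \<beta> * w)) \<noteq> 0} \<subseteq> ?S"
      using ord by auto
    have S: "finite ?S" "?S \<subseteq> {\<gamma>. absval \<gamma> \<le> r}" using zero by auto
    have "counting \<rho> r (\<lambda>\<gamma>. of_int (ord \<gamma> (fps_to_fls (lin_fps \<beta> * w))))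
        = (\<Sum>\<gamma>\<in>?S. of_int (ord \<gamma> (fps_to_fls (lin_fps \<beta> * w))) * ?w \<gamma>)"
      using S sub by (intro counting_eq_sum) auto
    also have "\<dots> = (\<Sum>\<gamma>\<in>?S. (if \<gamma> = \<beta> then ?w \<gamma> else 0) + of_int (ord \<gamma> (fps_to_fls w)) * ?w \<gamma>)"
      by (intro sum.cong) (use S(2) ord in \<open>auto simp: algebra_simps\<close>)
    also have "\<dots> = ?w \<beta> + (\<Sum>\<gamma>\<in>?S. of_int (ord \<gamma> (fps_to_fls w)) * ?w \<gamma>)"
      unfolding sum.distrib using S(1) by (subst sum.delta) auto
    also have "(\<Sum>\<gamma>\<in>?S. of_int (ord \<gamma> (fps_to_fls w)) * ?w \<gamma>)
        = counting \<rho> r (\<lambda>\<gamma>. of_int (ord \<gamma> (fps_to_fls w)))"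
      using S by (intro counting_eq_sum[symmetric]) auto
    also have "?w \<beta> + \<dots> = ln (gauss_norm r (lin_fps \<beta> * w)) - ln (gauss_norm \<rho> (lin_fps \<beta> * w))"
    proof -
      have "gauss_norm r w > 0" "gauss_norm \<rho> w > 0"
        using gauss_norm_pos[OF conv[OF zero(1) r assms(5)] r zero(2)]
          gauss_norm_pos[OF conv[OF zero(1) assms(3) \<rho>] assms(3) zero(2)] by auto
      moreover have "gauss_norm r (lin_fps \<beta> * w) = r * gauss_norm r w"
        using gauss_norm_mult[OF conv_at_lin conv[OF zero(1) r assms(5)] r] gauss_norm_lin(1)[OF r, of \<beta>] zero(3)
        by (simp add: max_absorb1)
      moreover have "gauss_norm \<rho> (lin_fps \<beta> * w) = max \<rho> (absval \<beta>) * gauss_norm \<rho> w"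
        using gauss_norm_mult[OF conv_at_lin conv[OF zero(1) assms(3) \<rho>] assms(3)]
          gauss_norm_lin(1)[OF assms(3), of \<beta>] by simp
      moreover have "max \<rho> (absval \<beta>) > 0" using assms(3) by simp
      ultimately show ?thesis using zero(4) r by (simp add: ln_mult_pos)
    qed
    finally show ?case using finite_subset[OF sub S(1)] by simp
  qed
  then show "finite {\<gamma>. absval \<gamma> \<le> r \<and> ord \<gamma> (fps_to_fls u) \<noteq> 0}"
    and "ln (gauss_norm r u) - ln (gauss_norm \<rho> u) = counting \<rho> r (\<lambda>\<gamma>. of_int (ord \<gamma> (fps_to_fls u)))"
    by auto
qed

lemma ord_locfin:
  assumes "h \<in> M"
  shows "divisor_locfin R (\<lambda>\<gamma>. of_int (ord \<gamma> h))"
proof -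
  have a: "divisor_locfin R (\<lambda>\<gamma>. of_int (ord \<gamma> (fps_to_fls u)))" if "u \<in> A" for u
    unfolding divisor_locfin_def
  proof (intro allI impI)
    fix r assume r: "r < R"
    \<comment> \<open>Jensen's formula asks for a positive radius, whereas \<open>r\<close> may be 0
      or negative.\<close>
    define s where "s = max r (R / 2)"
    have s: "0 < s" "s \<le> s" "s < R" "r \<le> s" using r R_pos by (auto simp: s_def)
    show "finite {\<gamma>. absval \<gamma> \<le> r \<and> of_int (ord \<gamma> (fps_to_fls u)) \<noteq> (0::real)}"
    proof (cases "u = 0")
      case False
      show ?thesis
        by (rule finite_subset[OF _ jensen_analytic(1)[OF that False s(1-3)]]) (use s(4) in auto)
    qed simp
  qed
  obtain u v where 1: "u \<in> A" "v \<in> A" "v \<noteq> 0" "h = fps_to_fls u / fps_to_fls v"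
    using assms by (rule mero_E)
  show ?thesis
  proof (cases "u = 0")
    case False
    show ?thesis
      by (rule divisor_locfin_Un[OF a[OF 1(1)] a[OF 1(2)]])
        (use 1 False in \<open>auto simp: ord_divide mero_analytic\<close>)
  qed (use 1 in simp)
qed

lemma jensen:
  assumes "h \<in> M" "h \<noteq> 0" "0 < \<rho>" "\<rho> \<le> r" "r < R"
  shows "ln (nrm r h) - ln (nrm \<rho> h) = counting \<rho> r (\<lambda>\<gamma>. of_int (ord \<gamma> h))"
proof -
  have r: "0 < r" using assms by linarith
  have \<rho>: "\<rho> < R" using assms by linarith
  obtain u v where 1: "u \<in> A" "v \<in> A" "v \<noteq> 0" "h = fps_to_fls u / fps_to_fls v"
    using assms(1) by (rule mero_E)
  have u0: "u \<noteq> 0" using 1 assms(2) by auto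
  have pos: "gauss_norm r u > 0" "gauss_norm r v > 0" "gauss_norm \<rho> u > 0" "gauss_norm \<rho> v > 0"
    using gauss_norm_pos[OF conv[OF _ r assms(5)] r] gauss_norm_pos[OF conv[OF _ assms(3) \<rho>] assms(3)]
      1 u0 by auto
  let ?u = "\<lambda>\<gamma>. real_of_int (ord \<gamma> (fps_to_fls u))" and ?v = "\<lambda>\<gamma>. real_of_int (ord \<gamma> (fps_to_fls v))"
  have lf: "divisor_locfin R ?u" "divisor_locfin R ?v"
    using 1 by (auto intro: ord_locfin mero_analytic)
  have "counting \<rho> r (\<lambda>\<gamma>. of_int (ord \<gamma> h)) = counting \<rho> r (\<lambda>\<gamma>. ?u \<gamma> + (-1) * ?v \<gamma>)"
    unfolding counting_def
    by (intro sum.cong) (use 1 u0 assms(5) in \<open>auto simp: ord_divide mero_analytic\<close>)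
  also have "\<dots> = counting \<rho> r ?u - counting \<rho> r ?v"
    unfolding counting_add[OF lf(1) divisor_locfin_cmult[OF lf(2)] assms(5)] counting_cmult by simp
  also have "\<dots> = (ln (gauss_norm r u) - ln (gauss_norm r v)) - (ln (gauss_norm \<rho> u) - ln (gauss_norm \<rho> v))"
    using jensen_analytic(2)[OF 1(1) u0 assms(3-5)] jensen_analytic(2)[OF 1(2,3) assms(3-5)] by simp
  also have "\<dots> = ln (nrm r h) - ln (nrm \<rho> h)"
    unfolding 1(4) nrm_eq[OF 1(1-3) r assms(5)] nrm_eq[OF 1(1-3) assms(3) \<rho>]
    using pos by (simp add: ln_div)
  finally show ?thesis by simp
qed

end

section \<open>Zero and pole divisors and the characteristic function\<close>

definition zero_divisor :: "real \<Rightarrow> 'k::ultrametric_field fls \<Rightarrow> 'k \<Rightarrow> real" where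
  "zero_divisor R h \<gamma> = of_int (max (omega R \<gamma> h) 0)"

definition pole_divisor :: "real \<Rightarrow> 'k::ultrametric_field fls \<Rightarrow> 'k \<Rightarrow> real" where
  "pole_divisor R h \<gamma> = of_int (max (- omega R \<gamma> h) 0)"

text \<open>Counting starts at \<open>\<rho>\<close>, so the value at the origin does not appear;
  the difference from \<open>Tchar\<close> is bounded (\<open>Tchar_char_fun\<close>).\<close>

definition char_fun :: "real \<Rightarrow> real \<Rightarrow> real \<Rightarrow> 'k::ultrametric_field fls \<Rightarrow> real" where
  "char_fun R \<rho> r h = max (counting \<rho> r (zero_divisor R h)) (counting \<rho> r (pole_divisor R h))"

lemma zero_divisor_nonneg [simp]: "zero_divisor R h \<gamma> \<ge> 0"
  and pole_divisor_nonneg [simp]: "pole_divisor R h \<gamma> \<ge> 0"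
  by (simp_all add: zero_divisor_def pole_divisor_def)

section \<open>Infinite products of power series\<close>

lemma gauss_norm_mono:
  assumes "conv_at R u" "0 < s" "s \<le> R"
  shows "gauss_norm s u \<le> gauss_norm R u"
proof (rule gauss_norm_le)
  fix n
  have "absval (fps_nth u n) * s ^ n \<le> absval (fps_nth u n) * R ^ n"
    using assms by (intro mult_left_mono power_mono) auto
  also have "\<dots> \<le> gauss_norm R u" by (rule gauss_norm_ge[OF assms(1)])
  finally show "absval (fps_nth u n) * s ^ n \<le> gauss_norm R u" .
qed

lemma conv_at_one [simp]: "conv_at r 1" using conv_at_const[of r 1] by simp

lemma gauss_norm_one: "r > 0 \<Longrightarrow> gauss_norm r (1::'k::ultrametric_field fps) = 1"
  using gauss_norm_const[of r "1::'k"] by simp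

lemma conv_at_prod:
  assumes "\<And>i. i \<in> I \<Longrightarrow> conv_at r (F i)" "r > 0"
  shows "conv_at r (prod F I)"
  using assms
proof (induction I rule: infinite_finite_induct)
  case (insert x S)
  then show ?case by (simp add: conv_at_mult)
qed simp_all

lemma gauss_norm_prod:
  assumes "\<And>i. i \<in> I \<Longrightarrow> conv_at r (F i)" "r > 0"
  shows "gauss_norm r (prod F I) = (\<Prod>i\<in>I. gauss_norm r (F i))"
  using assms
proof (induction I rule: infinite_finite_induct)
  case (insert x S)
  then show ?case by (simp add: gauss_norm_mult conv_at_prod)
qed (simp_all add: gauss_norm_one)

lemma conv_at_power: "conv_at r u \<Longrightarrow> r > 0 \<Longrightarrow> conv_at r (u ^ n)"
  using conv_at_prod[of "{..<n}" r "\<lambda>_. u"] by simp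

lemma gauss_norm_power: "conv_at r u \<Longrightarrow> r > 0 \<Longrightarrow> gauss_norm r (u ^ n) = gauss_norm r u ^ n"
  using gauss_norm_prod[of "{..<n}" r "\<lambda>_. u"] by simp

text \<open>From \<open>u * v - 1 = u * (v - 1) + (u - 1)\<close>, where \<open>u\<close> has norm
  at most 1. So closeness to 1 does not deteriorate with the number of factors.\<close>

lemma gauss_norm_near_one_mult:
  assumes "conv_at r u" "conv_at r v" "r > 0" "\<epsilon> \<le> 1"
    and "gauss_norm r (u - 1) \<le> \<epsilon>" "gauss_norm r (v - 1) \<le> \<epsilon>"
  shows "gauss_norm r (u * v - 1) \<le> \<epsilon>"
proof -
  have c: "conv_at r (u - 1)" "conv_at r (v - 1)"
    using assms by (auto intro: conv_at_diff)
  have u: "gauss_norm r u \<le> 1"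
    using gauss_norm_add_le[OF c(1) conv_at_one assms(3)] assms(4,5) gauss_norm_one[OF assms(3), where 'k='a]
    by simp
  have "u * v - 1 = u * (v - 1) + (u - 1)" by (simp add: algebra_simps)
  then have "gauss_norm r (u * v - 1) \<le> max (gauss_norm r (u * (v - 1))) (gauss_norm r (u - 1))"
    using gauss_norm_add_le[OF conv_at_mult[OF assms(1) c(2) assms(3)] c(1) assms(3)] by (simp only:)
  moreover have "gauss_norm r (u * (v - 1)) \<le> \<epsilon>"
  proof -
    have "gauss_norm r (u * (v - 1)) = gauss_norm r u * gauss_norm r (v - 1)"
      by (rule gauss_norm_mult[OF assms(1) c(2) assms(3)])
    also have "\<dots> \<le> 1 * gauss_norm r (v - 1)"
      using u gauss_norm_nonneg[OF c(2)] assms(3) by (intro mult_right_mono) auto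
    finally show ?thesis using assms(6) by simp
  qed
  ultimately show ?thesis using assms(5) by simp
qed

lemma gauss_norm_near_one_prod:
  assumes "\<And>i. i \<in> I \<Longrightarrow> conv_at r (F i)" "r > 0" "0 \<le> \<epsilon>" "\<epsilon> \<le> 1"
    and "\<And>i. i \<in> I \<Longrightarrow> gauss_norm r (F i - 1) \<le> \<epsilon>"
  shows "gauss_norm r (prod F I - 1) \<le> \<epsilon>"
  using assms(1,5)
proof (induction I rule: infinite_finite_induct)
  case (insert x S)
  then show ?case using assms(2-4)
    by (simp add: gauss_norm_near_one_mult conv_at_prod)
qed (use assms(3) in simp_all)

text \<open>Two radii are at work. Consecutive partial products differ by
  \<open>P k * (E k - 1)\<close>, which is small at the inner radius \<open>s\<close>; this makes
  each coefficient converge. The bound \<open>C\<close> at the outer radius \<open>R\<close> passes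
  to the limit coefficient by coefficient. The free starting index \<open>i\<close> also provides
  the tails of the product.\<close>

lemma infinite_product:
  fixes E :: "nat \<Rightarrow> 'k::{ultrametric_field, complete_space} fps"
  assumes "0 < s" "s \<le> R"
    and E: "\<And>k. conv_at R (E k)"
    and bound: "\<And>k. gauss_norm R (\<Prod>j\<in>{i..<k}. E j) \<le> C"
    and small: "(\<lambda>k. gauss_norm s (E k - 1)) \<longlonglongrightarrow> 0"
    and one: "\<And>k. fps_nth (E k) 0 = 1"
  obtains v where "\<And>n. (\<lambda>k. fps_nth (\<Prod>j\<in>{i..<k}. E j) n) \<longlonglongrightarrow> fps_nth v n"
    "\<And>n. absval (fps_nth v n) * R ^ n \<le> C" "fps_nth v 0 = 1"
proof -
  have R: "R > 0" using assms by linarith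
  have Es: "conv_at s (E k)" for k
    unfolding conv_at_def
  proof (rule tendsto_sandwich[OF _ _ tendsto_const E[unfolded conv_at_def]])
    show "\<forall>\<^sub>F n in sequentially. absval (fps_nth (E k) n) * s ^ n \<le> absval (fps_nth (E k) n) * R ^ n"
      using assms(1,2) by (intro always_eventually allI mult_left_mono power_mono) auto
    show "\<forall>\<^sub>F n in sequentially. 0 \<le> absval (fps_nth (E k) n) * s ^ n"
      using assms(1) by (intro always_eventually allI mult_nonneg_nonneg) auto
  qed
  define P where "P k = (\<Prod>j\<in>{i..<k}. E j)" for k
  have cP: "conv_at R (P k)" "conv_at s (P k)" for k
    unfolding P_def using E Es R assms(1) by (auto intro: conv_at_prod)
  have "\<exists>L. (\<lambda>k. fps_nth (P k) n) \<longlonglongrightarrow> L" for n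
  proof -
    have le: "absval (fps_nth (P (Suc k)) n - fps_nth (P k) n) \<le> C / s ^ n * gauss_norm s (E k - 1)" if "k \<ge> i" for k
    proof -
      have "P (Suc k) - P k = P k * (E k - 1)"
        using that by (simp add: P_def algebra_simps)
      then have "absval (fps_nth (P (Suc k)) n - fps_nth (P k) n) * s ^ n \<le> gauss_norm s (P k * (E k - 1))"
        using gauss_norm_ge[OF conv_at_mult[OF cP(2) conv_at_diff[OF Es conv_at_one]], of k k n] assms(1)
        by (simp flip: fps_sub_nth)
      also have "\<dots> = gauss_norm s (P k) * gauss_norm s (E k - 1)"
        using assms(1) by (intro gauss_norm_mult cP conv_at_diff Es) auto
      also have "\<dots> \<le> C * gauss_norm s (E k - 1)"
      proof (rule mult_right_mono)
        show "gauss_norm s (P k) \<le> C"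
          using gauss_norm_mono[OF cP(1)[of k] assms(1,2)] bound[of k] unfolding P_def by linarith
        show "0 \<le> gauss_norm s (E k - 1)"
          using assms(1) by (intro gauss_norm_nonneg conv_at_diff Es) auto
      qed
      finally show ?thesis using assms(1) by (simp add: field_simps)
    qed
    have "(\<lambda>k. C / s ^ n * gauss_norm s (E k - 1)) \<longlonglongrightarrow> C / s ^ n * 0"
      by (intro tendsto_mult tendsto_const small)
    then have lim: "(\<lambda>k. C / s ^ n * gauss_norm s (E k - 1)) \<longlonglongrightarrow> 0" by simp
    have "(\<lambda>k. absval (fps_nth (P (Suc k)) n - fps_nth (P k) n)) \<longlonglongrightarrow> 0"
      by (rule tendsto_sandwich[OF _ _ tendsto_const lim])
        (use le in \<open>auto simp: eventually_sequentially\<close>)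
    then have "Cauchy (\<lambda>k. fps_nth (P k) n)" by (rule Cauchy_of_diff_null)
    then show ?thesis unfolding Cauchy_convergent_iff convergent_def .
  qed
  then obtain L where L: "\<And>n. (\<lambda>k. fps_nth (P k) n) \<longlonglongrightarrow> L n" by metis
  define v where "v = Abs_fps L"
  have v: "(\<lambda>k. fps_nth (P k) n) \<longlonglongrightarrow> fps_nth v n" for n using L by (simp add: v_def)
  have "absval (fps_nth v n) \<le> C / R ^ n" for n
  proof (rule absval_lim_le[OF v])
    fix k
    have "absval (fps_nth (P k) n) * R ^ n \<le> C"
      using gauss_norm_ge[OF cP(1), of k n] bound[of k] by (simp add: P_def order_trans)
    then show "absval (fps_nth (P k) n) \<le> C / R ^ n" using R by (simp add: pos_le_divide_eq)
  qed
  then have "absval (fps_nth v n) * R ^ n \<le> C" for n using R by (simp add: pos_le_divide_eq)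
  moreover have "fps_nth v 0 = 1"
  proof -
    have "fps_nth (prod E I) 0 = 1" for I
      by (induction I rule: infinite_finite_induct) (simp_all add: one)
    then have "(\<lambda>k. fps_nth (P k) 0) \<longlonglongrightarrow> 1" by (simp add: P_def)
    with v[of 0] show ?thesis by (rule LIMSEQ_unique)
  qed
  ultimately show ?thesis using v by (intro that[of v]) (simp_all add: P_def)
qed

text \<open>A polynomial vanishing at \<open>\<gamma>\<close> which for large \<open>d\<close> is close to 1 on the smaller disks.\<close>

definition unit_factor_poly :: "'k::field \<Rightarrow> nat \<Rightarrow> 'k poly" where
  "unit_factor_poly \<gamma> d = 1 - monom (inverse \<gamma> ^ d) d"

lemma conv_at_poly [simp]: "conv_at r (fps_of_poly p)"
  by (auto intro!: conv_at_eventually_zero[of "Suc (degree p)"] coeff_eq_0)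

lemma unit_factor_poly:
  fixes \<gamma> :: "'k::ultrametric_field"
  assumes "\<gamma> \<noteq> 0" "d > 0"
  shows "poly (unit_factor_poly \<gamma> d) \<gamma> = 0"
    and "fps_nth (fps_of_poly (unit_factor_poly \<gamma> d)) 0 = 1"
    and "r > 0 \<Longrightarrow> gauss_norm r (fps_of_poly (unit_factor_poly \<gamma> d) - 1) \<le> (r / absval \<gamma>) ^ d"
    and "r \<ge> absval \<gamma> \<Longrightarrow> gauss_norm r (fps_of_poly (unit_factor_poly \<gamma> d)) \<le> (r / absval \<gamma>) ^ d"
proof -
  show "poly (unit_factor_poly \<gamma> d) \<gamma> = 0"
    using assms by (simp add: unit_factor_poly_def poly_monom power_mult_distrib[symmetric])
  show 1: "fps_nth (fps_of_poly (unit_factor_poly \<gamma> d)) 0 = 1"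
    using assms by (simp add: unit_factor_poly_def)
  have nth: "fps_nth (fps_of_poly (unit_factor_poly \<gamma> d)) n
      = (if n = 0 then 1 else 0) - (if n = d then inverse \<gamma> ^ d else 0)" for n
    by (simp add: unit_factor_poly_def)
  have q: "absval (inverse \<gamma> ^ d) * r ^ d = (r / absval \<gamma>) ^ d" for r
    by (simp add: absval_inverse power_mult_distrib power_inverse divide_inverse mult.commute)
  show "gauss_norm r (fps_of_poly (unit_factor_poly \<gamma> d) - 1) \<le> (r / absval \<gamma>) ^ d" if "r > 0"
  proof (rule gauss_norm_le)
    fix n show "absval (fps_nth (fps_of_poly (unit_factor_poly \<gamma> d) - 1) n) * r ^ n \<le> (r / absval \<gamma>) ^ d"
      using q[of r] that by (cases "n = d") (simp_all only: fps_sub_nth nth, auto)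
  qed
  show "gauss_norm r (fps_of_poly (unit_factor_poly \<gamma> d)) \<le> (r / absval \<gamma>) ^ d" if "r \<ge> absval \<gamma>"
  proof (rule gauss_norm_le)
    fix n
    have "absval \<gamma> > 0" using assms by simp
    then have "1 \<le> (r / absval \<gamma>) ^ d" using that by (intro one_le_power) (simp add: pos_le_divide_eq)
    then show "absval (fps_nth (fps_of_poly (unit_factor_poly \<gamma> d)) n) * r ^ n \<le> (r / absval \<gamma>) ^ d"
      unfolding nth using q[of r] assms(2) by (cases "n = d"; cases "n = 0") auto
  qed
qed

section \<open>Bounded functions with prescribed zeros, and quotients without poles\<close>

context ultrametric_disk
begin

lemma analytic_prod: "(\<And>i. i \<in> I \<Longrightarrow> F i \<in> A) \<Longrightarrow> prod F I \<in> A"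
  by (induction I rule: infinite_finite_induct) (simp_all add: analytic_mult)

lemma analytic_bounded:
  assumes "\<And>n. absval (fps_nth v n) * R ^ n \<le> C"
  shows "v \<in> A"
  unfolding analytic_iff conv_at_def
proof (intro allI impI)
  fix s assume s: "0 < s" "s < R"
  have "(\<lambda>n. (s / R) ^ n) \<longlonglongrightarrow> 0" using s by (intro LIMSEQ_power_zero) simp
  then have "(\<lambda>n. C * (s / R) ^ n) \<longlonglongrightarrow> C * 0" by (intro tendsto_mult tendsto_const)
  then have lim: "(\<lambda>n. C * (s / R) ^ n) \<longlonglongrightarrow> 0" by simp
  show "(\<lambda>n. absval (fps_nth v n) * s ^ n) \<longlonglongrightarrow> 0"
  proof (rule tendsto_sandwich[OF _ _ tendsto_const lim])
    show "\<forall>\<^sub>F n in sequentially. absval (fps_nth v n) * s ^ n \<le> C * (s / R) ^ n"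
    proof (intro always_eventually allI)
      fix n
      have "absval (fps_nth v n) * s ^ n = (absval (fps_nth v n) * R ^ n) * (s / R) ^ n"
        using R_pos by (simp add: power_divide)
      also have "\<dots> \<le> C * (s / R) ^ n" using assms s by (intro mult_right_mono) auto
      finally show "absval (fps_nth v n) * s ^ n \<le> C * (s / R) ^ n" .
    qed
    show "\<forall>\<^sub>F n in sequentially. 0 \<le> absval (fps_nth v n) * s ^ n"
      using s by (intro always_eventually allI mult_nonneg_nonneg) auto
  qed
qed

lemma ord_dvd:
  assumes "u \<in> A" "v \<in> A" "u \<noteq> 0" "v \<noteq> 0" "absval \<gamma> < R"
  shows "ord \<gamma> (fps_to_fls (u * v)) \<ge> ord \<gamma> (fps_to_fls u)"
  using assms ord_analytic_nonneg[OF assms(2,5)]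
  by (simp add: fls_times_fps_to_fls ord_mult mero_analytic)

lemma ord_prod_ge:
  assumes "finite I" "i \<in> I" "\<And>i. i \<in> I \<Longrightarrow> F i \<in> A" "\<And>i. i \<in> I \<Longrightarrow> F i \<noteq> 0" "absval \<gamma> < R"
  shows "ord \<gamma> (fps_to_fls (prod F I)) \<ge> ord \<gamma> (fps_to_fls (F i))"
  unfolding prod.remove[OF assms(1,2)] using assms
  by (intro ord_dvd analytic_prod) auto

lemma ord_power_ge:
  assumes "u \<in> A" "u \<noteq> 0" "absval \<gamma> < R" "ps_eval u \<gamma> = 0"
  shows "ord \<gamma> (fps_to_fls (u ^ m)) \<ge> int m"
proof -
  have "ord \<gamma> (fps_to_fls u) \<ge> 1"
    using ord_analytic_zero_iff[OF assms(1-3)] ord_analytic_nonneg[OF assms(1,3)] assms(4) by simp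
  then have "int m * 1 \<le> int m * ord \<gamma> (fps_to_fls u)" by (intro mult_left_mono) auto
  then show ?thesis using assms by (simp add: fps_to_fls_power ord_power mero_analytic)
qed

text \<open>The zeros are imposed by factors \<open>1 - (x / \<gamma>)\<^sup>d\<close>. Since the counting function is bounded, the degrees
  \<open>d\<close> can grow so slowly that the product of the norms \<open>(R / |\<gamma>|)\<^sup>d\<close> still converges, while the
  product itself converges because \<open>d\<close> tends to infinity. No spherical completeness is needed.\<close>

lemma bounded_function_with_zeros:
  fixes m :: "'k \<Rightarrow> nat"
  assumes lf: "divisor_locfin R (\<lambda>\<gamma>. real (m \<gamma>))" and \<rho>: "0 < \<rho>" "\<rho> < R"
    and bnd: "\<And>r. \<rho> \<le> r \<Longrightarrow> r < R \<Longrightarrow> counting \<rho> r (\<lambda>\<gamma>. real (m \<gamma>)) \<le> B"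
  obtains w where "w \<in> bdd_analytic_disk R" "w \<noteq> 0"
    "\<And>\<gamma>. absval \<gamma> < R \<Longrightarrow> ord \<gamma> (fps_to_fls w) \<ge> int (m \<gamma>)"
proof -
  define S where "S r = {\<gamma>. absval \<gamma> \<le> r \<and> m \<gamma> \<noteq> 0}" for r
  have finS: "finite (S r)" if "r < R" for r
    using lf that by (auto simp: divisor_locfin_def S_def)
  \<comment> \<open>The counting function of the zeros up to \<open>s\<close> with the outer radius
    already moved to \<open>R\<close>. It stays below \<open>B\<close>, as a limit of sums that are
    below the counting functions at radii near \<open>R\<close>.\<close>
  define V where "V s = (\<Sum>\<gamma>\<in>S s. real (m \<gamma>) * (ln R - ln (max \<rho> (absval \<gamma>))))" for s
  have wt: "ln R - ln (max \<rho> (absval \<gamma>)) \<ge> 0" if "absval \<gamma> < R" for \<gamma> :: 'k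
    using counting_weight_nonneg[of \<rho> R \<gamma>] \<rho> that by simp
  have VB: "V s \<le> B" if s: "\<rho> \<le> s" "s < R" for s
  proof -
    have "((\<lambda>r. \<Sum>\<gamma>\<in>S s. real (m \<gamma>) * (ln r - ln (max \<rho> (absval \<gamma>)))) \<longlongrightarrow> V s) (at_left R)"
      unfolding V_def using R_pos by (intro tendsto_intros) auto
    moreover have "\<forall>\<^sub>F r in at_left R. (\<Sum>\<gamma>\<in>S s. real (m \<gamma>) * (ln r - ln (max \<rho> (absval \<gamma>)))) \<le> B"
      using eventually_at_left_real[OF s(2)]
    proof eventually_elim
      case (elim r)
      have "(\<Sum>\<gamma>\<in>S s. real (m \<gamma>) * (ln r - ln (max \<rho> (absval \<gamma>))))
          \<le> (\<Sum>\<gamma>\<in>S r. real (m \<gamma>) * (ln r - ln (max \<rho> (absval \<gamma>))))"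
        using elim finS[of r] s \<rho>
        by (intro sum_mono2 mult_nonneg_nonneg counting_weight_nonneg) (auto simp: S_def)
      also have "\<dots> = counting \<rho> r (\<lambda>\<gamma>. real (m \<gamma>))"
        by (simp add: counting_def S_def)
      also have "\<dots> \<le> B" using elim s by (intro bnd) auto
      finally show ?case .
    qed
    ultimately show ?thesis by (rule tendsto_upperbound) simp
  qed
  have Vmono: "V t - V s = (\<Sum>\<gamma>\<in>S t - S s. real (m \<gamma>) * (ln R - ln (max \<rho> (absval \<gamma>))))"
    if "s \<le> t" "t < R" for s t
    unfolding V_def using that finS[OF that(2)] by (subst sum_diff) (auto simp: S_def)
  define \<sigma> where "\<sigma> = (SUP s\<in>{\<rho>..<R}. V s)"
  have bddV: "bdd_above (V ` {\<rho>..<R})" using VB by (auto intro!: bdd_aboveI2)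
  have V\<sigma>: "V s \<le> \<sigma>" if "\<rho> \<le> s" "s < R" for s
    unfolding \<sigma>_def using that by (intro cSUP_upper[OF _ bddV]) auto
  \<comment> \<open>The factors of block \<open>k\<close> have degree \<open>k + 1\<close>, so a
    block of mass at most \<open>\<delta> k\<close> adds at most \<open>(1/2) ^ k\<close> to the
    logarithm of the norm, which is summable.\<close>
  define \<delta> where "\<delta> k = (1/2) ^ k / real (k + 1)" for k
  have \<delta>: "\<delta> k > 0" for k by (simp add: \<delta>_def)
  \<comment> \<open>Besides leaving a mass below \<open>\<delta> k\<close>, the radius
    \<open>r k\<close> is forced to tend to \<open>R\<close> by the last condition, so that every
    zero is reached.\<close>
  define P where "P k r \<longleftrightarrow> \<rho> \<le> r \<and> r < R \<and> V r > \<sigma> - \<delta> k \<and> r \<ge> R - (R - \<rho>) / real (k + 1)" for k r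
  have ex: "\<exists>r. P k r \<and> t \<le> r" if "\<rho> \<le> t" "t < R" for k t
  proof -
    have "\<exists>s\<in>{\<rho>..<R}. \<sigma> - \<delta> k < V s"
      using \<rho> \<delta>[of k] less_cSUP_iff[OF _ bddV, of "\<sigma> - \<delta> k"] by (simp add: \<sigma>_def)
    then obtain s where s: "\<rho> \<le> s" "s < R" "\<sigma> - \<delta> k < V s" by auto
    define r where "r = max (max s t) (R - (R - \<rho>) / real (k + 1))"
    have "(R - \<rho>) / real (k + 1) > 0" using \<rho> by simp
    then have r: "r < R" "s \<le> r" "t \<le> r" "R - (R - \<rho>) / real (k + 1) \<le> r"
      using s that by (auto simp: r_def)
    have "V r - V s \<ge> 0" unfolding Vmono[OF r(2,1)]
      using r by (intro sum_nonneg mult_nonneg_nonneg wt) (auto simp: S_def)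
    then show ?thesis using r s unfolding P_def by (intro exI[of _ r]) auto
  qed
  obtain r where r: "\<And>k. P k (r k)" "\<And>k. r k \<le> r (Suc k)"
  proof -
    have "\<exists>x. P 0 x" using ex[of \<rho> 0] \<rho> by auto
    moreover have "\<exists>y. P (Suc n) y \<and> x \<le> y" if "P n x" for x n
      using ex[of x "Suc n"] that by (auto simp: P_def)
    ultimately show ?thesis using dependent_nat_choice[of P "\<lambda>_ x y. x \<le> y"] that by metis
  qed
  have rR: "\<rho> \<le> r k" "r k < R" and rV: "V (r k) > \<sigma> - \<delta> k"
    and rk: "r k \<ge> R - (R - \<rho>) / real (k + 1)" for k
    using r(1)[of k] by (auto simp: P_def)
  define T where "T k = S (r (Suc k)) - S (r k)" for k
  have T: "finite (T k)" "\<And>\<gamma>. \<gamma> \<in> T k \<Longrightarrow> r k < absval \<gamma> \<and> absval \<gamma> < R \<and> \<gamma> \<noteq> 0" for k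
  proof -
    show "finite (T k)" unfolding T_def using finS rR by blast
    fix \<gamma> assume "\<gamma> \<in> T k"
    then have *: "r k < absval \<gamma>" "absval \<gamma> < R" using rR(2)[of "Suc k"] by (auto simp: T_def S_def)
    then have "absval \<gamma> > 0" using rR(1)[of k] \<rho> by linarith
    then show "r k < absval \<gamma> \<and> absval \<gamma> < R \<and> \<gamma> \<noteq> 0" using * by simp
  qed
  define e where "e k \<gamma> = fps_of_poly (unit_factor_poly \<gamma> (Suc k))" for k and \<gamma> :: 'k
  define E where "E k = (\<Prod>\<gamma>\<in>T k. e k \<gamma> ^ m \<gamma>)" for k
  have e1: "fps_nth (e k \<gamma>) 0 = 1" and e0: "e k \<gamma> \<noteq> 0" and eA: "e k \<gamma> \<in> A" if "\<gamma> \<in> T k" for k \<gamma>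
  proof -
    show 1: "fps_nth (e k \<gamma>) 0 = 1" using T(2)[OF that] unfolding e_def by (intro unit_factor_poly) auto
    then show "e k \<gamma> \<noteq> 0" by auto
    show "e k \<gamma> \<in> A" unfolding e_def by simp
  qed
  have cE: "conv_at t (E k)" if "t > 0" for t k
    unfolding E_def e_def using that by (intro conv_at_prod conv_at_power) auto
  have E1: "fps_nth (E k) 0 = 1" for k
  proof -
    have "(\<Prod>\<gamma>\<in>I. fps_nth (e k \<gamma> ^ m \<gamma>) 0) = fps_nth (\<Prod>\<gamma>\<in>I. e k \<gamma> ^ m \<gamma>) 0" for I
      by (induction I rule: infinite_finite_induct) simp_all
    moreover have "(\<Prod>\<gamma>\<in>T k. fps_nth (e k \<gamma> ^ m \<gamma>) 0) = 1"
      using e1 by (intro prod.neutral) (simp add: fps_nth_power_0)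
    ultimately show ?thesis by (simp add: E_def)
  qed
  have E0: "E k \<noteq> 0" for k using E1[of k] by auto
  have EA: "E k \<in> A" for k unfolding analytic_iff using cE by simp
  \<comment> \<open>All zeros in the blocks lie outside the disk of radius \<open>\<rho>\<close>, so
    at radius \<open>\<rho> / 2\<close> the monomial in each factor has norm at most
    \<open>(1/2) ^ Suc k\<close>.\<close>
  have small: "gauss_norm (\<rho> / 2) (E k - 1) \<le> (1/2) ^ Suc k" for k
    unfolding E_def
  proof (rule gauss_norm_near_one_prod)
    show half: "(1/2::real) ^ Suc k \<le> 1" by (rule power_le_one) auto
    fix \<gamma> assume \<gamma>: "\<gamma> \<in> T k"
    have "gauss_norm (\<rho> / 2) ((\<Prod>i<m \<gamma>. e k \<gamma>) - 1) \<le> (1/2) ^ Suc k"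
    proof (rule gauss_norm_near_one_prod)
      have "gauss_norm (\<rho> / 2) (e k \<gamma> - 1) \<le> (\<rho> / 2 / absval \<gamma>) ^ Suc k"
        unfolding e_def using T(2)[OF \<gamma>] \<rho> by (intro unit_factor_poly) auto
      also have "\<dots> \<le> (1/2) ^ Suc k"
      proof (rule power_mono)
        have "\<rho> \<le> absval \<gamma>" "absval \<gamma> > 0" using T(2)[OF \<gamma>] rR(1)[of k] by auto
        then show "\<rho> / 2 / absval \<gamma> \<le> 1 / 2" by (simp add: pos_divide_le_eq)
      qed (use \<rho> in simp)
      finally show "gauss_norm (\<rho> / 2) (e k \<gamma> - 1) \<le> (1/2) ^ Suc k" .
    qed (use \<rho> half in \<open>auto simp: e_def\<close>)
    then show "gauss_norm (\<rho> / 2) (e k \<gamma> ^ m \<gamma> - 1) \<le> (1/2) ^ Suc k" by simp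
  qed (use \<rho> in \<open>auto simp: e_def intro: conv_at_power\<close>)
  have "(\<lambda>k. gauss_norm (\<rho> / 2) (E k - 1)) \<longlonglongrightarrow> 0"
  proof (rule tendsto_sandwich[OF _ _ tendsto_const])
    show "(\<lambda>k. (1/2::real) ^ Suc k) \<longlonglongrightarrow> 0"
      by (intro LIMSEQ_Suc LIMSEQ_power_zero) simp
    show "\<forall>\<^sub>F k in sequentially. gauss_norm (\<rho> / 2) (E k - 1) \<le> (1/2) ^ Suc k"
      using small by (intro always_eventually allI)
    show "\<forall>\<^sub>F k in sequentially. 0 \<le> gauss_norm (\<rho> / 2) (E k - 1)"
      using \<rho> by (intro always_eventually allI gauss_norm_nonneg conv_at_diff cE) auto
  qed
  note small_lim = this
  have normE: "gauss_norm R (E k) \<le> exp ((1/2) ^ k)" for k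
  proof -
    have "gauss_norm R (E k) = (\<Prod>\<gamma>\<in>T k. gauss_norm R (e k \<gamma>) ^ m \<gamma>)"
      unfolding E_def e_def using R_pos
      by (simp add: gauss_norm_prod gauss_norm_power conv_at_power)
    also have "\<dots> \<le> (\<Prod>\<gamma>\<in>T k. exp (real (k + 1) * (real (m \<gamma>) * (ln R - ln (max \<rho> (absval \<gamma>))))))"
    proof (rule prod_mono)
      fix \<gamma> assume \<gamma>: "\<gamma> \<in> T k"
      note t = T(2)[OF \<gamma>]
      have pos: "absval \<gamma> > 0" using t by simp
      have mx: "max \<rho> (absval \<gamma>) = absval \<gamma>" using t rR(1)[of k] by simp
      have "gauss_norm R (e k \<gamma>) \<le> (R / absval \<gamma>) ^ Suc k"
        unfolding e_def using t by (intro unit_factor_poly) auto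
      also have "R / absval \<gamma> = exp (ln R - ln (absval \<gamma>))"
        using pos R_pos by (simp add: exp_diff)
      also have "\<dots> ^ Suc k = exp (real (k + 1) * (ln R - ln (absval \<gamma>)))"
        by (simp only: exp_of_nat_mult[symmetric] Suc_eq_plus1)
      finally have "gauss_norm R (e k \<gamma>) ^ m \<gamma> \<le> exp (real (k + 1) * (ln R - ln (absval \<gamma>))) ^ m \<gamma>"
        using R_pos by (intro power_mono gauss_norm_nonneg) (auto simp: e_def)
      also have "\<dots> = exp (real (k + 1) * (real (m \<gamma>) * (ln R - ln (absval \<gamma>))))"
        by (simp only: exp_of_nat_mult[symmetric] mult_ac)
      finally show "0 \<le> gauss_norm R (e k \<gamma>) ^ m \<gamma> \<and> gauss_norm R (e k \<gamma>) ^ m \<gamma>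
          \<le> exp (real (k + 1) * (real (m \<gamma>) * (ln R - ln (max \<rho> (absval \<gamma>)))))"
        unfolding mx using gauss_norm_nonneg[of R "e k \<gamma>"] by (simp add: e_def)
    qed
    also have "\<dots> = exp (real (k + 1) * (V (r (Suc k)) - V (r k)))"
      unfolding Vmono[OF r(2) rR(2)] T_def[symmetric] using T(1) by (simp only: exp_sum sum_distrib_left)
    also have "\<dots> \<le> exp ((1/2) ^ k)"
    proof -
      have "V (r (Suc k)) - V (r k) \<le> \<delta> k"
        using rV[of k] V\<sigma>[OF rR(1,2), of "Suc k"] by simp
      then have "real (k + 1) * (V (r (Suc k)) - V (r k)) \<le> real (k + 1) * \<delta> k"
        by (intro mult_left_mono) auto
      then show ?thesis by (simp add: \<delta>_def)
    qed
    finally show ?thesis .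
  qed
  have bound: "gauss_norm R (\<Prod>j\<in>{i..<k}. E j) \<le> exp 2" for i k
  proof -
    have "gauss_norm R (\<Prod>j\<in>{i..<k}. E j) = (\<Prod>j\<in>{i..<k}. gauss_norm R (E j))"
      by (rule gauss_norm_prod) (use cE R_pos in auto)
    also have "\<dots> \<le> (\<Prod>j\<in>{i..<k}. exp ((1/2) ^ j))"
      using normE gauss_norm_nonneg[OF cE[OF R_pos]] by (intro prod_mono) auto
    also have "\<dots> = exp (\<Sum>j\<in>{i..<k}. (1/2) ^ j)" by (simp add: exp_sum)
    also have "(\<Sum>j\<in>{i..<k}. (1/2::real) ^ j) \<le> (\<Sum>j<k. (1/2) ^ j)"
      by (intro sum_mono2) auto
    also have "\<dots> \<le> 2" by (simp add: sum_gp_strict)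
    finally show ?thesis by simp
  qed
  \<comment> \<open>The finitely many zeros in the first disk get linear factors: the origin may be
    among them, and there \<open>unit_factor_poly\<close> does not vanish.\<close>
  define W where "W k = (\<Prod>\<gamma>\<in>S (r 0). lin_fps \<gamma> ^ m \<gamma>) * (\<Prod>j\<in>{0..<k}. E j)" for k
  have WA: "W k \<in> A" for k unfolding W_def by (intro analytic_mult analytic_prod analytic_power analytic_lin EA)
  have W0: "W k \<noteq> 0" for k unfolding W_def using E0 finS[OF rR(2)] by (simp add: prod_zero_iff)
  have tail: "\<exists>v. (\<forall>n. (\<lambda>k. fps_nth (\<Prod>j\<in>{i..<k}. E j) n) \<longlonglongrightarrow> fps_nth v n) \<and>
    (\<forall>n. absval (fps_nth v n) * R ^ n \<le> exp 2) \<and> fps_nth v 0 = 1" for i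
    by (rule infinite_product[of "\<rho> / 2" R E i "exp 2"])
      (use \<rho> cE R_pos bound small_lim E1 in auto)
  then obtain v where v: "\<And>i n. (\<lambda>k. fps_nth (\<Prod>j\<in>{i..<k}. E j) n) \<longlonglongrightarrow> fps_nth (v i) n"
    "\<And>i n. absval (fps_nth (v i) n) * R ^ n \<le> exp 2" "\<And>i. fps_nth (v i) 0 = 1" by metis
  have vA: "v i \<in> A" for i using v(2) by (rule analytic_bounded)
  have v0: "v i \<noteq> 0" for i using v(3)[of i] by auto
  \<comment> \<open>A coefficientwise limit could lose zeros. With the tail product as an analytic
    cofactor, the zeros of each finite product survive in the limit.\<close>
  have vrec: "v 0 = (\<Prod>j\<in>{0..<i}. E j) * v i" for i
  proof (rule fps_ext)
    fix n
    define Q where "Q = (\<Prod>j\<in>{0..<i}. E j)"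
    have "(\<lambda>k. \<Sum>l=0..n. fps_nth Q l * fps_nth (\<Prod>j\<in>{i..<k}. E j) (n - l))
        \<longlonglongrightarrow> (\<Sum>l=0..n. fps_nth Q l * fps_nth (v i) (n - l))"
    proof (rule tendsto_sum)
      fix l
      have "(\<lambda>k. absval (fps_nth Q l) * absval (fps_nth (\<Prod>j\<in>{i..<k}. E j) (n - l) - fps_nth (v i) (n - l)))
          \<longlonglongrightarrow> absval (fps_nth Q l) * 0"
        by (intro tendsto_mult tendsto_const) (rule tendsto_absval_iff[THEN iffD1, OF v(1)])
      then show "(\<lambda>k. fps_nth Q l * fps_nth (\<Prod>j\<in>{i..<k}. E j) (n - l)) \<longlonglongrightarrow> fps_nth Q l * fps_nth (v i) (n - l)"
        by (subst tendsto_absval_iff) (simp add: absval_mult[symmetric] right_diff_distrib)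
    qed
    then have "(\<lambda>k. fps_nth (Q * (\<Prod>j\<in>{i..<k}. E j)) n) \<longlonglongrightarrow> fps_nth (Q * v i) n"
      by (simp only: fps_mult_nth)
    moreover have "\<forall>\<^sub>F k in sequentially. fps_nth (Q * (\<Prod>j\<in>{i..<k}. E j)) n = fps_nth (\<Prod>j\<in>{0..<k}. E j) n"
      unfolding eventually_sequentially Q_def
      by (intro exI[of _ i]) (simp add: prod.atLeastLessThan_concat)
    ultimately have "(\<lambda>k. fps_nth (\<Prod>j\<in>{0..<k}. E j) n) \<longlonglongrightarrow> fps_nth (Q * v i) n"
      by (simp add: tendsto_cong)
    with v(1)[where i=0 and n=n] show "fps_nth (v 0) n = fps_nth ((\<Prod>j\<in>{0..<i}. E j) * v i) n"
      unfolding Q_def by (rule LIMSEQ_unique)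
  qed
  define w where "w = W 0 * v 0"
  have w: "w = W i * v i" for i
    unfolding w_def W_def using vrec[of i] by (simp add: mult.assoc)
  have w0: "w \<noteq> 0" unfolding w_def using W0 v0 by simp
  have wA: "w \<in> A" unfolding w_def by (intro analytic_mult WA vA)
  have "w \<in> bdd_analytic_disk R"
  proof -
    have cW: "conv_at R (W 0)" unfolding W_def using R_pos
      by (intro conv_at_mult conv_at_prod conv_at_power cE) auto
    have "absval (fps_nth w n) * R ^ n \<le> gauss_norm R (W 0) * exp 2" for n
    proof -
      have "absval (fps_nth w n) \<le> gauss_norm R (W 0) * exp 2 / R ^ n"
        unfolding w_def fps_mult_nth
      proof (rule absval_sum_le)
        show "0 \<le> gauss_norm R (W 0) * exp 2 / R ^ n" using gauss_norm_nonneg[OF cW] R_pos by simp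
        fix l assume "l \<in> {0..n}"
        then have l: "l \<le> n" by simp
        have "(absval (fps_nth (W 0) l) * R ^ l) * (absval (fps_nth (v 0) (n - l)) * R ^ (n - l))
            \<le> gauss_norm R (W 0) * exp 2"
          using gauss_norm_ge[OF cW] v(2) gauss_norm_nonneg[OF cW] R_pos by (intro mult_mono) auto
        then show "absval (fps_nth (W 0) l * fps_nth (v 0) (n - l)) \<le> gauss_norm R (W 0) * exp 2 / R ^ n"
          unfolding absval_mult_weight[OF l] using R_pos by (simp add: pos_le_divide_eq)
      qed
      then show ?thesis using R_pos by (simp add: pos_le_divide_eq)
    qed
    then show ?thesis using wA unfolding bdd_analytic_disk_def by (auto intro!: bdd_aboveI2)
  qed
  moreover have "ord \<gamma> (fps_to_fls w) \<ge> int (m \<gamma>)" if \<gamma>: "absval \<gamma> < R" for \<gamma>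
  proof (cases "m \<gamma> = 0")
    case True
    then show ?thesis using ord_analytic_nonneg[OF wA \<gamma>] by simp
  next
    case False
    have Wi: "ord \<gamma> (fps_to_fls w) \<ge> ord \<gamma> (fps_to_fls (W i))" for i
      unfolding w[of i] by (rule ord_dvd[OF WA vA W0 v0 \<gamma>])
    define Q where "Q = (\<Prod>\<gamma>\<in>S (r 0). lin_fps \<gamma> ^ m \<gamma>)"
    have Q: "Q \<in> A" "Q \<noteq> 0" unfolding Q_def using finS[OF rR(2)]
      by (auto intro!: analytic_prod analytic_intros simp: prod_zero_iff)
    have PE: "(\<Prod>j\<in>{0..<i}. E j) \<in> A" "(\<Prod>j\<in>{0..<i}. E j) \<noteq> 0" for i
      using EA E0 by (auto intro: analytic_prod)
    show ?thesis
    proof (cases "absval \<gamma> \<le> r 0")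
      case True
      have "int (m \<gamma>) \<le> ord \<gamma> (fps_to_fls (lin_fps \<gamma> ^ m \<gamma>))"
        using \<gamma> by (intro ord_power_ge) auto
      also have "\<dots> \<le> ord \<gamma> (fps_to_fls Q)"
        unfolding Q_def using True False finS[OF rR(2)] \<gamma>
        by (intro ord_prod_ge[where F = "\<lambda>\<gamma>. lin_fps \<gamma> ^ m \<gamma>"]) (auto simp: S_def intro: analytic_intros)
      also have "\<dots> \<le> ord \<gamma> (fps_to_fls (W 0))"
        unfolding W_def Q_def[symmetric] using Q PE \<gamma> by (intro ord_dvd) auto
      finally show ?thesis using Wi[of 0] by linarith
    next
      case gt: False
      have "\<exists>k. absval \<gamma> \<le> r k"
      proof -
        obtain k :: nat where "(R - \<rho>) / (R - absval \<gamma>) < real k" using reals_Archimedean2 by blast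
        then have "(R - \<rho>) / (R - absval \<gamma>) < real (k + 1)" by simp
        then have "(R - \<rho>) / real (k + 1) < R - absval \<gamma>"
          using \<gamma> by (simp add: field_simps)
        then show ?thesis using rk[of k] by (intro exI[of _ k]) linarith
      qed
      define k where "k = (LEAST k. absval \<gamma> \<le> r k)"
      have k: "absval \<gamma> \<le> r k" unfolding k_def using \<open>\<exists>k. absval \<gamma> \<le> r k\<close> by (rule LeastI_ex)
      then obtain j where j: "k = Suc j" using gt by (cases k) auto
      have "\<not> absval \<gamma> \<le> r j" using not_less_Least[of j "\<lambda>k. absval \<gamma> \<le> r k"] j by (simp add: k_def)
      then have \<gamma>T: "\<gamma> \<in> T j" using k False j by (auto simp: T_def S_def)
      have "ps_eval (e j \<gamma>) \<gamma> = 0"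
        unfolding e_def ps_eval_poly using T(2)[OF \<gamma>T] by (intro unit_factor_poly) auto
      then have "int (m \<gamma>) \<le> ord \<gamma> (fps_to_fls (e j \<gamma> ^ m \<gamma>))"
        using \<gamma> e0[OF \<gamma>T] eA[OF \<gamma>T] by (intro ord_power_ge) auto
      also have "\<dots> \<le> ord \<gamma> (fps_to_fls (E j))"
        unfolding E_def using \<gamma>T \<gamma> T(1) eA e0
        by (intro ord_prod_ge[where F = "\<lambda>\<gamma>. e j \<gamma> ^ m \<gamma>"]) (auto intro: analytic_intros)
      also have "\<dots> \<le> ord \<gamma> (fps_to_fls (\<Prod>j\<in>{0..<k}. E j))"
        using j EA E0 \<gamma> by (intro ord_prod_ge) auto
      also have "\<dots> \<le> ord \<gamma> (fps_to_fls ((\<Prod>j\<in>{0..<k}. E j) * Q))"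
        using Q PE \<gamma> by (intro ord_dvd) auto
      also have "(\<Prod>j\<in>{0..<k}. E j) * Q = W k" by (simp add: W_def Q_def mult.commute)
      finally show ?thesis using Wi[of k] by linarith
    qed
  qed
  ultimately show ?thesis using w0 that by blast
qed

text \<open>The zeros of \<open>v\<close> in the closed disk are cancelled one by one against zeros
  of \<open>u\<close>; what remains of \<open>v\<close> has a dominant constant term and can be
  inverted by a recursion with controlled coefficients. The recursion yields boundedness at
  \<open>r\<close> instead of convergence, which suffices because \<open>r\<close> can be taken
  slightly larger.\<close>

lemma division_bounded:
  assumes "u \<in> A" "v \<in> A" "v \<noteq> 0" "0 < r" "r < R"
    and "\<And>\<gamma>. absval \<gamma> \<le> r \<Longrightarrow> ord \<gamma> (fps_to_fls u / fps_to_fls v) \<ge> 0"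
  obtains q B where "u = q * v" "\<And>n. absval (fps_nth q n) * r ^ n \<le> B"
proof -
  note r = assms(4,5)
  have "\<forall>u\<in>A. (\<forall>\<gamma>. absval \<gamma> \<le> r \<longrightarrow> ord \<gamma> (fps_to_fls u / fps_to_fls v) \<ge> 0) \<longrightarrow>
      (\<exists>q B. u = q * v \<and> (\<forall>n. absval (fps_nth q n) * r ^ n \<le> B))"
    using assms(2-5)
  proof (induction v rule: zero_induct)
    case (no_zero v)
    show ?case
    proof (intro ballI impI)
      fix u :: "'k fps" assume u: "u \<in> A"
      note cv = conv[OF no_zero(1) r]
      note cu = conv[OF u r]
      define c where "c = fps_nth v 0"
      have c: "absval c = gauss_norm r v"
        using dom_index(1)[OF cv r(1) no_zero(2)] no_zero(3) by (simp add: c_def)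
      have c0: "absval c > 0" unfolding c by (rule gauss_norm_pos[OF cv r(1) no_zero(2)])
      then have cnz: "c \<noteq> 0" by simp
      define q where "q = u * inverse v"
      have qv: "u = q * v"
        unfolding q_def using cnz by (simp add: mult.assoc inverse_mult_eq_1 c_def)
      define B where "B = gauss_norm r u / absval c"
      have B: "B \<ge> 0" unfolding B_def using gauss_norm_nonneg[OF cu] c0 by simp
      have "absval (fps_nth q n) * r ^ n \<le> B" for n
      proof (induction n rule: less_induct)
        case (less n)
        have "fps_nth u n = fps_nth v 0 * fps_nth q n + (\<Sum>i\<in>{0..n}-{0}. fps_nth v i * fps_nth q (n - i))"
          unfolding qv mult.commute[of q v] fps_mult_nth by (subst sum.remove[of _ 0]) auto
        then have eq: "c * fps_nth q n = fps_nth u n - (\<Sum>i\<in>{0..n}-{0}. fps_nth v i * fps_nth q (n - i))"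
          by (simp add: c_def)
        have "absval (c * fps_nth q n) \<le> gauss_norm r u / r ^ n"
          unfolding eq
        proof (rule absval_diff_le)
          show "absval (fps_nth u n) \<le> gauss_norm r u / r ^ n"
            using gauss_norm_ge[OF cu, of n] r by (simp add: pos_le_divide_eq)
          show "absval (\<Sum>i\<in>{0..n}-{0}. fps_nth v i * fps_nth q (n - i)) \<le> gauss_norm r u / r ^ n"
          proof (rule absval_sum_le)
            show "0 \<le> gauss_norm r u / r ^ n" using gauss_norm_nonneg[OF cu] r by simp
            fix i assume i: "i \<in> {0..n} - {0}"
            then have "i \<le> n" by simp
            have "(absval (fps_nth v i) * r ^ i) * (absval (fps_nth q (n - i)) * r ^ (n - i)) \<le> absval c * B"
              using gauss_norm_ge[OF cv, of i] less[of "n - i"] i c0 B c r by (intro mult_mono) auto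
            then show "absval (fps_nth v i * fps_nth q (n - i)) \<le> gauss_norm r u / r ^ n"
              unfolding absval_mult_weight[OF \<open>i \<le> n\<close>] using r c0 by (simp add: pos_le_divide_eq B_def)
          qed
        qed
        then show ?case unfolding B_def absval_mult using r c0 by (simp add: field_simps)
      qed
      then show "\<exists>q B. u = q * v \<and> (\<forall>n. absval (fps_nth q n) * r ^ n \<le> B)" using qv by blast
    qed
  next
    case (zero \<beta> w)
    show ?case
    proof (intro ballI impI)
      fix u :: "'k fps" assume u: "u \<in> A" and
        o: "\<forall>\<gamma>. absval \<gamma> \<le> r \<longrightarrow> ord \<gamma> (fps_to_fls u / fps_to_fls (lin_fps \<beta> * w)) \<ge> 0"
      have \<beta>R: "absval \<beta> < R" using zero(3) r by linarith
      show "\<exists>q B. u = q * (lin_fps \<beta> * w) \<and> (\<forall>n. absval (fps_nth q n) * r ^ n \<le> B)"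
      proof (cases "u = 0")
        case True
        then show ?thesis by (intro exI[of _ 0]) auto
      next
        case False
        have "ord \<beta> (fps_to_fls u / fps_to_fls (lin_fps \<beta> * w))
            = ord \<beta> (fps_to_fls u) - (1 + ord \<beta> (fps_to_fls w))"
          using zero(1,2) u False \<beta>R
          by (simp add: fls_times_fps_to_fls ord_divide ord_mult ord_lin mero_analytic mero_mult mero_lin)
        then have "ord \<beta> (fps_to_fls u) \<noteq> 0"
          using o zero(3) ord_analytic_nonneg[OF zero(1) \<beta>R] by force
        then have "ps_eval u \<beta> = 0" using ord_analytic_zero_iff[OF u False \<beta>R] by blast
        then obtain u1 where u1: "u1 \<in> A" "u = lin_fps \<beta> * u1"
          using analytic_division[OF u \<beta>R] by (metis add_0_left fps_const_0_eq_0)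
        have "fps_to_fls u / fps_to_fls (lin_fps \<beta> * w) = fps_to_fls u1 / fps_to_fls w"
          unfolding u1(2) by (simp add: fls_times_fps_to_fls)
        then have "\<forall>\<gamma>. absval \<gamma> \<le> r \<longrightarrow> ord \<gamma> (fps_to_fls u1 / fps_to_fls w) \<ge> 0" using o by simp
        then obtain q B where "u1 = q * w" "\<forall>n. absval (fps_nth q n) * r ^ n \<le> B"
          using zero(4) u1(1) by blast
        then show ?thesis unfolding u1(2) by (intro exI[of _ q] exI[of _ B]) (simp add: mult_ac)
      qed
    qed
  qed
  then show ?thesis using assms(1,6) that by blast
qed

lemma analytic_of_ord_nonneg:
  assumes "h \<in> M" "\<And>\<gamma>. absval \<gamma> < R \<Longrightarrow> ord \<gamma> h \<ge> 0"
  obtains q where "q \<in> A" "h = fps_to_fls q"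
proof -
  obtain u v where 1: "u \<in> A" "v \<in> A" "v \<noteq> 0" "h = fps_to_fls u / fps_to_fls v"
    using assms(1) by (rule mero_E)
  have ex: "\<exists>q B. u = q * v \<and> (\<forall>n. absval (fps_nth q n) * r ^ n \<le> B)" if r: "0 < r" "r < R" for r
  proof -
    have "ord \<gamma> (fps_to_fls u / fps_to_fls v) \<ge> 0" if "absval \<gamma> \<le> r" for \<gamma>
      unfolding 1(4)[symmetric] using that r by (intro assms(2)) simp
    then show ?thesis using division_bounded[OF 1(1-3) r] by blast
  qed
  \<comment> \<open>The equation \<open>u = q * v\<close> determines \<open>q\<close>, so the
    quotient found at the radius \<open>R / 2\<close> is the quotient for every radius.\<close>
  obtain q where q: "u = q * v" using ex[of "R / 2"] R_pos by auto
  have "conv_at s q" if s: "0 < s" "s < R" for s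
  proof -
    obtain r where r: "s < r" "r < R" using dense_order_class.dense[OF s(2)] by blast
    then obtain B where B: "\<And>n. absval (fps_nth q n) * r ^ n \<le> B"
      using ex[of r] s q 1(3) by auto
    \<comment> \<open>In the disk of radius \<open>r\<close>, bounded coefficients at the boundary
      give convergence at the smaller \<open>s\<close>.\<close>
    interpret d: ultrametric_disk r K by standard (use r s dense in auto)
    show ?thesis by (rule d.conv[OF d.analytic_bounded[OF B] s(1) r(1)])
  qed
  then have "q \<in> A" unfolding analytic_iff by blast
  moreover have "h = fps_to_fls q" unfolding 1(4) q using 1(3) by (simp add: fls_times_fps_to_fls)
  ultimately show ?thesis using that by blast
qed

subsection \<open>Characteristic functions\<close>

lemma zero_divisor_locfin: "h \<in> M \<Longrightarrow> divisor_locfin R (zero_divisor R h)"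
  by (rule divisor_locfin_subset[OF ord_locfin[of h]]) (auto simp: zero_divisor_def)

lemma pole_divisor_locfin: "h \<in> M \<Longrightarrow> divisor_locfin R (pole_divisor R h)"
  by (rule divisor_locfin_subset[OF ord_locfin[of h]]) (auto simp: pole_divisor_def)

lemma jensen_zero_pole:
  assumes "h \<in> M" "h \<noteq> 0" "0 < \<rho>" "\<rho> \<le> r" "r < R"
  shows "counting \<rho> r (zero_divisor R h) - counting \<rho> r (pole_divisor R h) = ln (nrm r h) - ln (nrm \<rho> h)"
proof -
  have "(\<lambda>\<gamma>. real_of_int (ord \<gamma> h)) = (\<lambda>\<gamma>. zero_divisor R h \<gamma> + (-1) * pole_divisor R h \<gamma>)"
    by (auto simp: zero_divisor_def pole_divisor_def max_def)
  then show ?thesis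
    unfolding jensen[OF assms]
    using counting_add[OF zero_divisor_locfin[OF assms(1)] divisor_locfin_cmult[OF pole_divisor_locfin[OF assms(1)]] assms(5)]
    by (simp only: counting_cmult)
qed

lemma char_fun_nonneg: "0 < \<rho> \<Longrightarrow> \<rho> \<le> r \<Longrightarrow> char_fun R \<rho> r h \<ge> 0"
  unfolding char_fun_def by (simp add: counting_nonneg le_max_iff_disj)

lemma char_fun_mono:
  assumes "h \<in> M" "0 < \<rho>" "\<rho> \<le> r" "r \<le> s" "s < R"
  shows "char_fun R \<rho> r h \<le> char_fun R \<rho> s h"
  unfolding char_fun_def
  by (intro max.mono counting_mono_radius) (use assms zero_divisor_locfin pole_divisor_locfin in auto)

text \<open>The hypothesis bounds the pole count, so some bounded series \<open>w\<close> cancels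
  the poles; through Jensen's formula it also bounds the Gauss norms of \<open>f\<close>, so the
  analytic function \<open>f * fps_to_fls w\<close> has bounded coefficients as well.\<close>

lemma bounded_of_char_fun_bounded:
  assumes "f \<in> M" "0 < \<rho>" "\<rho> < R" "\<And>r. \<rho> \<le> r \<Longrightarrow> r < R \<Longrightarrow> char_fun R \<rho> r f \<le> B"
  shows "f \<in> bdd_mero_disk R"
proof (cases "f = 0")
  case True
  have "(1::'k fps) \<in> bdd_analytic_disk R" "(0::'k fps) \<in> bdd_analytic_disk R"
    using conv_at_bdd[OF conv_at_one, of R] conv_at_bdd[OF conv_at_zero, of R]
    by (simp_all add: bdd_analytic_disk_def)
  moreover have "f = fps_to_fls 0 / fps_to_fls 1" using True by simp
  ultimately show ?thesis unfolding bdd_mero_disk_def using one_neq_zero by blast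
next
  case f0: False
  define m where "m \<gamma> = nat (- ord \<gamma> f)" for \<gamma>
  have m: "(\<lambda>\<gamma>. real (m \<gamma>)) = pole_divisor R f" by (auto simp: m_def pole_divisor_def)
  have "counting \<rho> r (\<lambda>\<gamma>. real (m \<gamma>)) \<le> B" if "\<rho> \<le> r" "r < R" for r
    unfolding m using assms(4)[OF that] by (simp add: char_fun_def)
  moreover have "divisor_locfin R (\<lambda>\<gamma>. real (m \<gamma>))"
    unfolding m by (rule pole_divisor_locfin[OF assms(1)])
  ultimately obtain w where w: "w \<in> bdd_analytic_disk R" "w \<noteq> 0"
    "\<And>\<gamma>. absval \<gamma> < R \<Longrightarrow> ord \<gamma> (fps_to_fls w) \<ge> int (m \<gamma>)"
    using bounded_function_with_zeros[of m \<rho> B] assms(2,3) by blast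
  have wA: "w \<in> A" using w(1) by (simp add: bdd_analytic_disk_def)
  define g where "g = f * fps_to_fls w"
  have gM: "g \<in> M" unfolding g_def using assms(1) wA by (intro mero_mult mero_analytic)
  have "ord \<gamma> g \<ge> 0" if "absval \<gamma> < R" for \<gamma>
    unfolding g_def using w(2) w(3)[OF that] that f0 assms(1) wA
    by (simp add: ord_mult mero_analytic m_def split: if_splits)
  then obtain q where q: "q \<in> A" "g = fps_to_fls q" using analytic_of_ord_nonneg[OF gM] by blast
  obtain C where C: "\<And>n. absval (fps_nth w n) * R ^ n \<le> C"
    using w(1) by (auto simp: bdd_analytic_disk_def bdd_above_def)
  define K where "K = exp (B + ln (nrm \<rho> f)) * C"
  have qr: "absval (fps_nth q n) * r ^ n \<le> K" if r: "\<rho> \<le> r" "r < R" for r n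
  proof -
    have r0: "0 < r" using r assms(2) by linarith
    have "ln (nrm r f) \<le> B + ln (nrm \<rho> f)"
      using jensen_zero_pole[OF assms(1) f0 assms(2) r] assms(4)[OF r]
        counting_nonneg[OF assms(2) r(1), of "pole_divisor R f"] by (simp add: char_fun_def)
    then have nf: "nrm r f \<le> exp (B + ln (nrm \<rho> f))"
      using nrm_pos[OF r0 r(2) assms(1) f0] by (metis exp_le_cancel_iff exp_ln)
    have gw: "gauss_norm r w \<le> C"
    proof (rule gauss_norm_le)
      fix n
      have "absval (fps_nth w n) * r ^ n \<le> absval (fps_nth w n) * R ^ n"
        using r r0 by (intro mult_left_mono power_mono) auto
      then show "absval (fps_nth w n) * r ^ n \<le> C" using C[of n] by linarith
    qed
    have "gauss_norm r q = nrm r f * gauss_norm r w"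
      using nrm_mult[OF r0 r(2) assms(1) mero_analytic[OF wA]] q nrm_analytic[OF _ r0 r(2)] wA
      by (simp add: g_def)
    also have "\<dots> \<le> K" unfolding K_def
      using nf gw gauss_norm_nonneg[OF conv[OF wA r0 r(2)]] by (intro mult_mono) auto
    finally show ?thesis using gauss_norm_ge[OF conv[OF q(1) r0 r(2)], of n] by linarith
  qed
  have "absval (fps_nth q n) * R ^ n \<le> K" for n
  proof (rule tendsto_upperbound)
    show "((\<lambda>r. absval (fps_nth q n) * r ^ n) \<longlongrightarrow> absval (fps_nth q n) * R ^ n) (at_left R)"
      by (intro tendsto_intros)
    show "\<forall>\<^sub>F r in at_left R. absval (fps_nth q n) * r ^ n \<le> K"
      using eventually_at_left_real[OF assms(3)] by eventually_elim (use qr in auto)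
  qed simp
  then have "q \<in> bdd_analytic_disk R" using q(1) by (auto simp: bdd_analytic_disk_def intro!: bdd_aboveI2)
  moreover have "f = fps_to_fls q / fps_to_fls w" using q(2) w(2) by (simp add: g_def field_simps)
  ultimately show ?thesis unfolding bdd_mero_disk_def using w by blast
qed

lemma char_fun_unbounded:
  fixes f :: "'k fls"
  assumes "f \<in> unbdd_mero_disk R" "0 < \<rho>" "\<rho> < R"
  shows "\<forall>\<^sub>F r in at_left R. char_fun R \<rho> r f > B"
proof -
  have f: "f \<in> M" "f \<notin> bdd_mero_disk R" using assms(1) by (auto simp: unbdd_mero_disk_def)
  obtain s where s: "\<rho> \<le> s" "s < R" "char_fun R \<rho> s f > B"
    using bounded_of_char_fun_bounded[OF f(1) assms(2,3)] f(2) by (meson not_le)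
  show ?thesis using eventually_at_left_real[OF s(2)]
  proof eventually_elim
    case (elim r)
    then show ?case using char_fun_mono[OF f(1) assms(2) s(1), of r] s(3) by auto
  qed
qed

text \<open>For zeros beyond \<open>\<rho>\<close> the isosceles principle gives
  \<open>absval (\<gamma> - c) = absval \<gamma>\<close>. The two counts therefore differ only at
  the finitely many zeros in the closed disk of radius \<open>\<rho>\<close>, by an amount
  independent of \<open>r\<close>.\<close>

lemma Zcount_counting:
  assumes "h \<in> M" "0 < \<rho>" "\<rho> < R" "absval c < \<rho>"
  obtains C where "\<And>r. \<rho> \<le> r \<Longrightarrow> r < R \<Longrightarrow> Zcount R c r h = counting \<rho> r (zero_divisor R h) + C"
proof -
  define S where "S r = {\<gamma>. absval \<gamma> \<le> r \<and> ord \<gamma> h > 0}" for r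
  have fin: "finite (S r)" if "r < R" for r
    using ord_locfin[OF assms(1)] that
    by (auto simp: divisor_locfin_def S_def elim!: finite_subset[rotated])
  define C where "C = (\<Sum>\<gamma>\<in>S \<rho>. of_int (ord \<gamma> h) * (ln (max \<rho> (absval \<gamma>)) - ln (absval (\<gamma> - c))))"
  have "Zcount R c r h = counting \<rho> r (zero_divisor R h) + C" if r: "\<rho> \<le> r" "r < R" for r
  proof -
    have "absval (\<gamma> - c) \<le> r \<longleftrightarrow> absval \<gamma> \<le> r" for \<gamma>
      using absval_diff_le_max[of \<gamma> c] absval_add_le_max[of "\<gamma> - c" c] r assms(4) by auto
    then have Z: "Zcount R c r h = (\<Sum>\<gamma>\<in>S r. of_int (ord \<gamma> h) * (ln r - ln (absval (\<gamma> - c))))"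
      unfolding Zcount_def S_def by (intro sum.cong) auto
    have cnt: "counting \<rho> r (zero_divisor R h) = (\<Sum>\<gamma>\<in>S r. of_int (ord \<gamma> h) * (ln r - ln (max \<rho> (absval \<gamma>))))"
      unfolding counting_def S_def zero_divisor_def by (intro sum.cong) auto
    have "Zcount R c r h - counting \<rho> r (zero_divisor R h)
        = (\<Sum>\<gamma>\<in>S r. of_int (ord \<gamma> h) * (ln (max \<rho> (absval \<gamma>)) - ln (absval (\<gamma> - c))))"
      unfolding Z cnt sum_subtractf[symmetric] by (intro sum.cong) (simp_all add: algebra_simps)
    also have "\<dots> = C" unfolding C_def
    proof (rule sum.mono_neutral_right)
      show "finite (S r)" by (rule fin[OF r(2)])
      show "S \<rho> \<subseteq> S r" using r by (auto simp: S_def)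
      show "\<forall>\<gamma>\<in>S r - S \<rho>. of_int (ord \<gamma> h) * (ln (max \<rho> (absval \<gamma>)) - ln (absval (\<gamma> - c))) = 0"
      proof
        fix \<gamma> assume "\<gamma> \<in> S r - S \<rho>"
        then have "absval \<gamma> > \<rho>" by (auto simp: S_def)
        then have "absval (\<gamma> - c) = absval \<gamma>" using absval_diff_eq[of c \<gamma>] assms(4) by simp
        then show "of_int (ord \<gamma> h) * (ln (max \<rho> (absval \<gamma>)) - ln (absval (\<gamma> - c))) = 0"
          using \<open>absval \<gamma> > \<rho>\<close> by simp
      qed
    qed
    finally show ?thesis by simp
  qed
  then show ?thesis using that by blast
qed

lemma Tchar_char_fun:
  assumes "h \<in> M" "0 < \<rho>" "\<rho> < R" "absval c < \<rho>"
  obtains C where "\<And>r. \<rho> \<le> r \<Longrightarrow> r < R \<Longrightarrow> \<bar>Tchar R c r h - char_fun R \<rho> r h\<bar> \<le> C"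
proof -
  obtain C1 where C1: "\<And>r. \<rho> \<le> r \<Longrightarrow> r < R \<Longrightarrow> Zcount R c r h = counting \<rho> r (zero_divisor R h) + C1"
    using Zcount_counting[OF assms] by blast
  have h': "1 / h \<in> M" using assms(1) by (intro mero_divide mero_one)
  obtain C2 where C2: "\<And>r. \<rho> \<le> r \<Longrightarrow> r < R \<Longrightarrow> Zcount R c r (1 / h) = counting \<rho> r (zero_divisor R (1 / h)) + C2"
    using Zcount_counting[OF h' assms(2-4)] by blast
  have eq: "counting \<rho> r (zero_divisor R (1 / h)) = counting \<rho> r (pole_divisor R h)" if "r < R" for r
    unfolding counting_def
    by (intro sum.cong) (use that assms(1) ord_inverse[of h] in \<open>auto simp: zero_divisor_def pole_divisor_def inverse_eq_divide\<close>)
  have "\<bar>Tchar R c r h - char_fun R \<rho> r h\<bar> \<le> \<bar>C1 + ln (absval (mero_eval R h c))\<bar> + \<bar>C2\<bar>"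
    if "\<rho> \<le> r" "r < R" for r
    using C1[OF that] C2[OF that] eq[OF that(2)]
    unfolding Tchar_def Ncount_def char_fun_def by (auto simp: max_def)
  then show ?thesis using that by blast
qed

text \<open>The bound \<open>\<rho>0\<close> is the absolute value of the origin that
  \<open>small_wrt\<close> provides. Bounded differences between \<open>Tchar\<close> and
  \<open>char_fun\<close> disappear because the characteristic function of \<open>f\<close> exceeds
  every bound.\<close>

lemma small_wrt_char_fun:
  fixes f :: "'k fls"
  assumes "small_wrt R \<alpha> f" "f \<in> unbdd_mero_disk R" "\<alpha> \<in> M"
  obtains \<rho>0 where "\<rho>0 < R" "\<And>\<rho> \<epsilon>. \<rho>0 < \<rho> \<Longrightarrow> 0 < \<rho> \<Longrightarrow> \<rho> < R \<Longrightarrow> \<epsilon> > 0 \<Longrightarrow>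
    \<forall>\<^sub>F r in at_left R. char_fun R \<rho> r \<alpha> \<le> \<epsilon> * char_fun R \<rho> r f"
proof -
  obtain c where c: "absval c < R" and lim: "((\<lambda>r. Tchar R c r \<alpha> / Tchar R c r f) \<longlongrightarrow> 0) (at_left R)"
    using assms(1) by (auto simp: small_wrt_def open_disk_def)
  have f: "f \<in> M" using assms(2) by (simp add: unbdd_mero_disk_def)
  have "\<forall>\<^sub>F r in at_left R. char_fun R \<rho> r \<alpha> \<le> \<epsilon> * char_fun R \<rho> r f"
    if \<rho>: "absval c < \<rho>" "0 < \<rho>" "\<rho> < R" and \<epsilon>: "\<epsilon> > 0" for \<rho> \<epsilon>
  proof -
    obtain C1 where C1: "\<And>r. \<rho> \<le> r \<Longrightarrow> r < R \<Longrightarrow> \<bar>Tchar R c r \<alpha> - char_fun R \<rho> r \<alpha>\<bar> \<le> C1"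
      using Tchar_char_fun[OF assms(3) \<rho>(2,3,1)] by blast
    obtain C2 where C2: "\<And>r. \<rho> \<le> r \<Longrightarrow> r < R \<Longrightarrow> \<bar>Tchar R c r f - char_fun R \<rho> r f\<bar> \<le> C2"
      using Tchar_char_fun[OF f \<rho>(2,3,1)] by blast
    have C: "C1 \<ge> 0" "C2 \<ge> 0" using C1[of \<rho>] C2[of \<rho>] \<rho> by auto
    have "\<forall>\<^sub>F r in at_left R. Tchar R c r \<alpha> / Tchar R c r f < \<epsilon> / 2"
      using lim by (rule order_tendstoD(2)) (use \<epsilon> in simp)
    \<comment> \<open>Beyond \<open>C2\<close> the denominator is positive; the rest of the
      threshold makes the errors \<open>C1\<close> and \<open>C2\<close> fit into the second half of
      \<open>\<epsilon>\<close>.\<close>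
    moreover have "\<forall>\<^sub>F r in at_left R. char_fun R \<rho> r f > C2 + (C1 + \<epsilon> * C2) * 2 / \<epsilon>"
      by (rule char_fun_unbounded[OF assms(2) \<rho>(2,3)])
    moreover have "\<forall>\<^sub>F r in at_left R. r \<in> {\<rho><..<R}" by (rule eventually_at_left_real[OF \<rho>(3)])
    ultimately show ?thesis
    proof eventually_elim
      case (elim r)
      have r: "\<rho> \<le> r" "r < R" using elim(3) by auto
      have "(C1 + \<epsilon> * C2) * 2 / \<epsilon> \<ge> 0" using C \<epsilon> by simp
      then have big: "char_fun R \<rho> r f > C2" using elim(2) by linarith
      then have pos: "Tchar R c r f > 0" using C2[OF r] by linarith
      have "Tchar R c r \<alpha> \<le> \<epsilon> / 2 * Tchar R c r f"
        using elim(1) pos by (simp add: pos_divide_less_eq less_imp_le)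
      also have "\<dots> \<le> \<epsilon> / 2 * (char_fun R \<rho> r f + C2)"
        using C2[OF r] \<epsilon> by (intro mult_left_mono) auto
      finally have 1: "char_fun R \<rho> r \<alpha> \<le> \<epsilon> / 2 * (char_fun R \<rho> r f + C2) + C1" using C1[OF r] by linarith
      have "(C1 + \<epsilon> * C2) * 2 / \<epsilon> < char_fun R \<rho> r f" using elim(2) C by linarith
      then have "(C1 + \<epsilon> * C2) * 2 < \<epsilon> * char_fun R \<rho> r f" using \<epsilon> by (simp add: pos_divide_less_eq mult.commute)
      moreover have "\<epsilon> * C2 \<ge> 0" using \<epsilon> C by simp
      ultimately show ?case using 1 by (simp add: algebra_simps)
    qed
  qed
  then show ?thesis using c that by blast
qed

end

text \<open>If all absolute values were at most 1, those of nonzero elements would equal 1. Then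
  every analytic series is bounded: clearly for \<open>R \<le> 1\<close>, and for
  \<open>R > 1\<close> because convergence at 1 leaves finitely many nonzero coefficients. So some
  \<open>y\<close> has \<open>absval y > 1\<close>, and powers of a root of \<open>y\<close> of high
  order have absolute values in any given interval.\<close>

lemma ultrametric_disk_of_unbounded:
  fixes f :: "'k::{ultrametric_field, complete_space, alg_closed_field, field_char_0} fls"
  assumes "R > 0" "f \<in> unbdd_mero_disk R"
  shows "ultrametric_disk TYPE('k) R"
proof -
  have "\<exists>y::'k. absval y > 1"
  proof (rule ccontr)
    assume no: "\<nexists>y::'k. absval y > 1"
    have triv: "absval y = 1" if "y \<noteq> 0" for y :: 'k
    proof -
      have le: "absval z \<le> 1" for z :: 'k using no by (meson not_le)
      have pos: "absval y > 0" using that by simp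
      have "inverse (absval y) \<le> 1" using le[of "inverse y"] by (simp only: absval_inverse)
      then have "1 \<le> absval y" using pos by (simp add: inverse_le_1_iff)
      then show ?thesis using le[of y] by linarith
    qed
    have "u \<in> bdd_analytic_disk R" if u: "u \<in> analytic_disk R" for u :: "'k fps"
    proof (cases "R \<le> 1")
      case True
      have "absval (fps_nth u n) * R ^ n \<le> 1 * 1" for n
        using no True assms(1) by (intro mult_mono power_le_one) (auto simp: not_less)
      then show ?thesis using u by (auto simp: bdd_analytic_disk_def intro!: bdd_aboveI2)
    next
      case False
      then have "(1::'k) \<in> open_disk R" by (simp add: open_disk_def)
      then have "summable (\<lambda>n. fps_nth u n * 1 ^ n)"
        using u unfolding analytic_disk_def by blast
      then have "(\<lambda>n. absval (fps_nth u n)) \<longlonglongrightarrow> 0" using summable_imp_null by force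
      then have "\<forall>\<^sub>F n in sequentially. absval (fps_nth u n) < 1" by (rule order_tendstoD(2)) simp
      then obtain N where N: "\<And>n. n \<ge> N \<Longrightarrow> absval (fps_nth u n) < 1" unfolding eventually_sequentially by blast
      have "fps_nth u n = 0" if "n \<ge> N" for n using N[OF that] triv by force
      then have "conv_at R u" by (rule conv_at_eventually_zero)
      then show ?thesis using u conv_at_bdd by (auto simp: bdd_analytic_disk_def)
    qed
    then have "mero_disk R \<subseteq> (bdd_mero_disk R :: 'k fls set)"
      unfolding mero_disk_def bdd_mero_disk_def by blast
    then show False using assms(2) by (auto simp: unbdd_mero_disk_def)
  qed
  then obtain y :: 'k where y: "absval y > 1" by blast
  show ?thesis
  proof
    fix s t :: real assume st: "0 < s" "s < t"
    define \<delta> where "\<delta> = ln t - ln s"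
    have \<delta>: "\<delta> > 0" using st by (simp add: \<delta>_def)
    have L: "ln (absval y) > 0" using y by (rule ln_gt_zero)
    obtain n :: nat where n: "ln (absval y) / \<delta> < real n" using reals_Archimedean2 by blast
    have "0 < ln (absval y) / \<delta>" using L \<delta> by simp
    then have n0: "n > 0" using n by (cases n) auto
    obtain z :: 'k where z: "z ^ n = y" using nth_root_exists[OF n0] by blast
    have zpos: "absval z > 0" using z y n0 by (cases "z = 0") (auto simp: zero_power)
    have lz: "ln (absval z) = ln (absval y) / real n"
      using z[symmetric] n0 zpos by (simp add: ln_realpow)
    define l where "l = ln (absval z)"
    have l: "0 < l" "l < \<delta>"
      unfolding l_def lz using L n n0 \<delta> by (simp_all add: pos_divide_less_eq mult.commute)
    define k where "k = \<lfloor>ln s / l\<rfloor> + 1"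
    have "of_int k > ln s / l" "of_int k \<le> ln s / l + 1" unfolding k_def by linarith+
    then have k: "of_int k * l > ln s" "of_int k * l \<le> ln s + l"
      using l by (simp_all add: field_simps)
    then have k2: "of_int k * l < ln t" using l by (simp add: \<delta>_def)
    define x where "x = (if k \<ge> 0 then z ^ nat k else inverse (z ^ nat (- k)))"
    have x: "absval x > 0" "ln (absval x) = of_int k * l"
      using zpos by (auto simp: x_def absval_inverse ln_inverse ln_realpow l_def)
    have "ln s < ln (absval x)" "ln (absval x) < ln t" using k(1) k2 x(2) by simp_all
    then have "s < absval x" "absval x < t" using x(1) st by simp_all
    then show "\<exists>x::'k. s < absval x \<and> absval x < t" by blast
  qed (rule assms(1))
qed

section \<open>Nevanlinna theory in the disk\<close>

locale nevanlinna_disk = ultrametric_disk R K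
  for R :: real and K :: "'k::{ultrametric_field, complete_space, alg_closed_field, field_char_0} itself" +
  fixes \<rho> :: real
  assumes \<rho>: "0 < \<rho>" "\<rho> < R"
begin

abbreviation Z :: "real \<Rightarrow> 'k fls \<Rightarrow> real" where "Z r h \<equiv> counting \<rho> r (zero_divisor R h)"
abbreviation N :: "real \<Rightarrow> 'k fls \<Rightarrow> real" where "N r h \<equiv> counting \<rho> r (pole_divisor R h)"
abbreviation T :: "real \<Rightarrow> 'k fls \<Rightarrow> real" where "T r h \<equiv> char_fun R \<rho> r h"
abbreviation ordr :: "'k fls \<Rightarrow> 'k \<Rightarrow> real" where "ordr h \<gamma> \<equiv> of_int (ord \<gamma> h)"

text \<open>Bounded terms are harmless because the characteristic functions in question exceed every
  bound near \<open>R\<close> (\<open>growth_contradiction\<close>).\<close>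

definition le_up_to_const :: "(real \<Rightarrow> real) \<Rightarrow> (real \<Rightarrow> real) \<Rightarrow> bool" (infix "\<lesssim>" 50) where
  "P \<lesssim> Q \<longleftrightarrow> (\<exists>C. \<forall>r. \<rho> < r \<longrightarrow> r < R \<longrightarrow> P r \<le> Q r + C)"

lemma le_up_to_constI: "(\<And>r. \<rho> < r \<Longrightarrow> r < R \<Longrightarrow> P r \<le> Q r + C) \<Longrightarrow> P \<lesssim> Q"
  unfolding le_up_to_const_def by blast

lemma le_up_to_const_trans [trans]: "P \<lesssim> Q \<Longrightarrow> Q \<lesssim> S \<Longrightarrow> P \<lesssim> S"
proof -
  assume *: "P \<lesssim> Q" "Q \<lesssim> S"
  obtain C where C: "\<And>r. \<rho> < r \<Longrightarrow> r < R \<Longrightarrow> P r \<le> Q r + C"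
    using *(1) unfolding le_up_to_const_def by blast
  obtain C' where C': "\<And>r. \<rho> < r \<Longrightarrow> r < R \<Longrightarrow> Q r \<le> S r + C'"
    using *(2) unfolding le_up_to_const_def by blast
  show ?thesis by (rule le_up_to_constI[where C = "C + C'"]) (use C C' in fastforce)
qed

lemma r_pos: "\<rho> < r \<Longrightarrow> r > 0" using \<rho> by linarith

lemma T_ge: "Z r h \<le> T r h" "N r h \<le> T r h" by (simp_all add: char_fun_def)

lemma counting_ord:
  assumes "h \<in> M" "h \<noteq> 0" "\<rho> < r" "r < R"
  shows "counting \<rho> r (ordr h) = ln (nrm r h) - ln (nrm \<rho> h)"
  using jensen[of h \<rho> r] assms \<rho> by simp

lemma zero_minus_pole:
  assumes "h \<in> M" "h \<noteq> 0" "\<rho> < r" "r < R"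
  shows "Z r h - N r h = ln (nrm r h) - ln (nrm \<rho> h)"
  using jensen_zero_pole[of h \<rho> r] assms \<rho> by simp

text \<open>The larger of the two counts is the pole count plus the positive part of their
  difference, and Jensen's formula identifies that difference with \<open>ln (nrm r h)\<close> up to
  a constant. This is the classical form, pole count plus proximity function.\<close>

lemma char_fun_poles:
  assumes "h \<in> M" "h \<noteq> 0"
  shows "(\<lambda>r. T r h) \<lesssim> (\<lambda>r. N r h + max 0 (ln (nrm r h)))"
    and "(\<lambda>r. N r h + max 0 (ln (nrm r h))) \<lesssim> (\<lambda>r. T r h)"
proof -
  show "(\<lambda>r. T r h) \<lesssim> (\<lambda>r. N r h + max 0 (ln (nrm r h)))"
  proof (rule le_up_to_constI[where C = "\<bar>ln (nrm \<rho> h)\<bar>"])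
    fix r assume "\<rho> < r" "r < R"
    from zero_minus_pole[OF assms this] show "T r h \<le> N r h + max 0 (ln (nrm r h)) + \<bar>ln (nrm \<rho> h)\<bar>"
      unfolding char_fun_def by (auto simp: max_def)
  qed
  show "(\<lambda>r. N r h + max 0 (ln (nrm r h))) \<lesssim> (\<lambda>r. T r h)"
  proof (rule le_up_to_constI[where C = "\<bar>ln (nrm \<rho> h)\<bar>"])
    fix r assume "\<rho> < r" "r < R"
    from zero_minus_pole[OF assms this] show "N r h + max 0 (ln (nrm r h)) \<le> T r h + \<bar>ln (nrm \<rho> h)\<bar>"
      unfolding char_fun_def by (auto simp: max_def)
  qed
qed

lemma char_fun_zeros:
  assumes "h \<in> M" "h \<noteq> 0"
  shows "(\<lambda>r. T r h) \<lesssim> (\<lambda>r. Z r h + max 0 (- ln (nrm r h)))"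
    and "(\<lambda>r. Z r h + max 0 (- ln (nrm r h))) \<lesssim> (\<lambda>r. T r h)"
proof -
  show "(\<lambda>r. T r h) \<lesssim> (\<lambda>r. Z r h + max 0 (- ln (nrm r h)))"
  proof (rule le_up_to_constI[where C = "\<bar>ln (nrm \<rho> h)\<bar>"])
    fix r assume "\<rho> < r" "r < R"
    from zero_minus_pole[OF assms this] show "T r h \<le> Z r h + max 0 (- ln (nrm r h)) + \<bar>ln (nrm \<rho> h)\<bar>"
      unfolding char_fun_def by (auto simp: max_def)
  qed
  show "(\<lambda>r. Z r h + max 0 (- ln (nrm r h))) \<lesssim> (\<lambda>r. T r h)"
  proof (rule le_up_to_constI[where C = "\<bar>ln (nrm \<rho> h)\<bar>"])
    fix r assume "\<rho> < r" "r < R"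
    from zero_minus_pole[OF assms this] show "Z r h + max 0 (- ln (nrm r h)) \<le> T r h + \<bar>ln (nrm \<rho> h)\<bar>"
      unfolding char_fun_def by (auto simp: max_def)
  qed
qed

lemma counting_leI:
  assumes "divisor_locfin R D" "divisor_locfin R E" "\<rho> < r" "r < R"
    and "\<And>\<gamma>. absval \<gamma> < R \<Longrightarrow> D \<gamma> \<le> E \<gamma>"
  shows "counting \<rho> r D \<le> counting \<rho> r E"
  using counting_mono[OF assms(1,2,4) \<rho>(1) _ assms(5)] assms(3) by simp

lemma ord_sub_const:
  assumes "f \<in> M" "absval \<gamma> < R" "f \<noteq> fls_const c"
  shows "ord \<gamma> f < 0 \<Longrightarrow> ord \<gamma> (f - fls_const c) = ord \<gamma> f"
    and "ord \<gamma> f > 0 \<Longrightarrow> c \<noteq> 0 \<Longrightarrow> ord \<gamma> (f - fls_const c) = 0"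
    and "ord \<gamma> f \<ge> 0 \<Longrightarrow> ord \<gamma> (f - fls_const c) \<ge> 0"
proof -
  have eq: "f - fls_const c = f + fls_const (- c)" by (simp add: fls_const_uminus[symmetric] del: fls_const_uminus)
  have o: "ord \<gamma> (fls_const (- c)) = 0" by (rule ord_const[OF assms(2)])
  show "ord \<gamma> f < 0 \<Longrightarrow> ord \<gamma> (f - fls_const c) = ord \<gamma> f"
    unfolding eq using assms o mero_const[of "- c"] by (intro ord_add_eq) auto
  show "ord \<gamma> f > 0 \<Longrightarrow> c \<noteq> 0 \<Longrightarrow> ord \<gamma> (f - fls_const c) = 0"
    unfolding eq add.commute[of f] using assms o ord_add_eq(1)[of "fls_const (- c)" f \<gamma>]
    by (auto simp del: fls_const_uminus)
  show "ord \<gamma> f \<ge> 0 \<Longrightarrow> ord \<gamma> (f - fls_const c) \<ge> 0"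
  proof (cases "f = 0 \<or> c = 0")
    case True
    assume "ord \<gamma> f \<ge> 0"
    then show ?thesis
    proof (cases "f = 0")
      case True
      have "0 - fls_const c = fls_const (- c)" by simp
      then show ?thesis using o True by (simp del: fls_const_uminus)
    qed (use True in simp)
  next
    case False
    assume "ord \<gamma> f \<ge> 0"
    have "f + fls_const (- c) \<noteq> 0" using assms(3) unfolding eq[symmetric] by simp
    then show ?thesis
      unfolding eq using ord_add_ge[of f "fls_const (- c)" \<gamma>] assms False o \<open>ord \<gamma> f \<ge> 0\<close>
      by (auto simp del: fls_const_uminus)
  qed
qed

text \<open>First main theorem for the value \<open>c\<close>: subtracting a constant creates no
  poles and raises the positive part of the logarithmic norm by a bounded amount at most.\<close>

lemma zeros_sub_const:
  assumes "f \<in> M" "f \<noteq> fls_const c"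
  shows "(\<lambda>r. Z r (f - fls_const c)) \<lesssim> (\<lambda>r. T r f)"
proof (cases "f = 0")
  case True
  have h: "f - fls_const c \<in> M" "f - fls_const c \<noteq> 0" using assms by (auto intro: mero_diff)
  have "Z r (f - fls_const c) = 0" if "r < R" for r
  proof -
    have "0 - fls_const c = fls_const (- c)" by simp
    then have "zero_divisor R (f - fls_const c) \<gamma> = 0" if "absval \<gamma> < R" for \<gamma>
      using True that ord_const[OF that, of "- c"] by (simp add: zero_divisor_def del: fls_const_uminus)
    then show ?thesis unfolding counting_def using that by (intro sum.neutral) auto
  qed
  then show ?thesis
    by (intro le_up_to_constI[where C = 0]) (auto intro: char_fun_nonneg[OF \<rho>(1)])
next
  case f0: False
  have h: "f - fls_const c \<in> M" "f - fls_const c \<noteq> 0" using assms by (auto intro: mero_diff)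
  obtain C where C: "\<And>r. \<rho> < r \<Longrightarrow> r < R \<Longrightarrow> N r f + max 0 (ln (nrm r f)) \<le> T r f + C"
    using char_fun_poles(2)[OF assms(1) f0] unfolding le_up_to_const_def by blast
  show ?thesis
  proof (rule le_up_to_constI)
    fix r assume r: "\<rho> < r" "r < R"
    note r0 = r_pos[OF r(1)]
    have "N r (f - fls_const c) \<le> N r f"
      using ord_sub_const[OF assms(1) _ assms(2)]
      by (intro counting_leI pole_divisor_locfin assms h r) (force simp: pole_divisor_def)
    moreover have "ln (nrm r (f - fls_const c)) \<le> max 0 (ln (nrm r f)) + ln (max 1 (absval c))"
    proof -
      have p: "nrm r f > 0" "nrm r (f - fls_const c) > 0"
        using nrm_pos[OF r0 r(2)] h f0 assms(1) by auto
      have "nrm r (f - fls_const c) \<le> max (nrm r f) (absval c)"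
        using nrm_add_le[OF r0 r(2) assms(1) mero_uminus[OF mero_const], of c]
          nrm_uminus[OF r0 r(2) mero_const, of c] r0 r by simp
      also have "\<dots> \<le> max 1 (nrm r f) * max 1 (absval c)"
      proof -
        have "nrm r f * 1 \<le> max 1 (nrm r f) * max 1 (absval c)" using p by (intro mult_mono) auto
        moreover have "1 * absval c \<le> max 1 (nrm r f) * max 1 (absval c)" by (intro mult_mono) auto
        ultimately show ?thesis by simp
      qed
      finally have "ln (nrm r (f - fls_const c)) \<le> ln (max 1 (nrm r f) * max 1 (absval c))"
        using p by (simp add: ln_mono)
      also have "\<dots> = ln (max 1 (nrm r f)) + ln (max 1 (absval c))"
        by (rule ln_mult_pos) (auto simp: less_max_iff_disj)
      also have "ln (max 1 (nrm r f)) \<le> max 0 (ln (nrm r f))" by (simp add: max_def)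
      finally show ?thesis by simp
    qed
    ultimately show "Z r (f - fls_const c) \<le> T r f + (C + ln (max 1 (absval c)) - ln (nrm \<rho> (f - fls_const c)))"
      using C[OF r] zero_minus_pole[OF h r] by linarith
  qed
qed

text \<open>Jensen's formula for \<open>f\<close> and its derivative: a pole of order
  \<open>m\<close> becomes one of order \<open>m + 1 \<le> 2 * m\<close>, and the norm of the
  derivative is at most \<open>1 / \<rho>\<close> times that of \<open>f\<close>.\<close>

lemma zeros_deriv:
  assumes "f \<in> M" "fls_deriv f \<noteq> 0"
  shows "(\<lambda>r. Z r (fls_deriv f)) \<lesssim> (\<lambda>r. Z r f + N r f)"
proof (rule le_up_to_constI)
  have f0: "f \<noteq> 0" using assms by auto
  note d = mero_deriv[OF assms(1)]
  fix r assume r: "\<rho> < r" "r < R"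
  note r0 = r_pos[OF r(1)]
  have "N r (fls_deriv f) \<le> counting \<rho> r (\<lambda>\<gamma>. 2 * pole_divisor R f \<gamma>)"
  proof (intro counting_leI divisor_locfin_cmult pole_divisor_locfin assms d r)
    fix \<gamma> :: 'k assume \<gamma>: "absval \<gamma> < R"
    show "pole_divisor R (fls_deriv f) \<gamma> \<le> 2 * pole_divisor R f \<gamma>"
      using ord_deriv_ge[OF assms(1) \<gamma>] ord_deriv_nonneg[OF assms(1) \<gamma>]
      by (cases "ord \<gamma> f \<ge> 0") (auto simp: pole_divisor_def max_def)
  qed
  then have "N r (fls_deriv f) \<le> 2 * N r f" by (simp add: counting_cmult)
  moreover have "ln (nrm r (fls_deriv f)) \<le> ln (nrm r f) - ln \<rho>"
  proof -
    have "nrm r (fls_deriv f) \<le> nrm r f / r" by (rule nrm_deriv_le[OF r0 r(2) assms(1)])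
    also have "\<dots> \<le> nrm r f / \<rho>"
      using r \<rho> nrm_nonneg[OF r0 r(2) assms(1)] by (intro divide_left_mono) auto
    finally have "ln (nrm r (fls_deriv f)) \<le> ln (nrm r f / \<rho>)"
      using nrm_pos[OF r0 r(2) d assms(2)] by (simp add: ln_mono)
    also have "\<dots> = ln (nrm r f) - ln \<rho>"
      using nrm_pos[OF r0 r(2) assms(1) f0] \<rho> by (simp add: ln_div)
    finally show ?thesis .
  qed
  ultimately show "Z r (fls_deriv f) \<le> (Z r f + N r f) + (ln (nrm \<rho> f) - ln \<rho> - ln (nrm \<rho> (fls_deriv f)))"
    using zero_minus_pole[OF d assms(2) r] zero_minus_pole[OF assms(1) f0 r] by linarith
qed

text \<open>Pole orders are multiplied by \<open>k + 1\<close>. So is the logarithm of the norm as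
  soon as \<open>nrm r f\<close> exceeds 1 and \<open>absval b\<close>, since subtracting
  \<open>b\<close> then leaves the norm unchanged; for smaller norms the proximity term is
  bounded.\<close>

lemma char_fun_power_mult:
  assumes "f \<in> M" "f \<noteq> 0" "f \<noteq> fls_const b"
  shows "(\<lambda>r. real (k + 1) * T r f) \<lesssim> (\<lambda>r. T r (f ^ k * (f - fls_const b)))"
proof -
  let ?P = "f ^ k * (f - fls_const b)"
  have h: "f - fls_const b \<in> M" "f - fls_const b \<noteq> 0" using assms by (auto intro: mero_diff)
  have P: "?P \<in> M" "?P \<noteq> 0" using h assms by (auto intro: mero_mult mero_power)
  obtain C where C: "\<And>r. \<rho> < r \<Longrightarrow> r < R \<Longrightarrow> T r f \<le> N r f + max 0 (ln (nrm r f)) + C"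
    using char_fun_poles(1)[OF assms(1,2)] unfolding le_up_to_const_def by blast
  obtain C' where C': "\<And>r. \<rho> < r \<Longrightarrow> r < R \<Longrightarrow> N r ?P + max 0 (ln (nrm r ?P)) \<le> T r ?P + C'"
    using char_fun_poles(2)[OF P] unfolding le_up_to_const_def by blast
  show ?thesis
  proof (rule le_up_to_constI)
    fix r assume r: "\<rho> < r" "r < R"
    note r0 = r_pos[OF r(1)]
    have "counting \<rho> r (\<lambda>\<gamma>. real (k + 1) * pole_divisor R f \<gamma>) \<le> N r ?P"
    proof (intro counting_leI divisor_locfin_cmult pole_divisor_locfin assms P r)
      fix \<gamma> :: 'k assume \<gamma>: "absval \<gamma> < R"
      have "ord \<gamma> ?P = int k * ord \<gamma> f + ord \<gamma> (f - fls_const b)"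
        using assms h \<gamma> by (simp add: ord_mult ord_power mero_power)
      then have eq: "ord \<gamma> f < 0 \<Longrightarrow> ord \<gamma> ?P = int (k + 1) * ord \<gamma> f"
        using ord_sub_const(1)[OF assms(1) \<gamma> assms(3)] by (simp add: algebra_simps)
      show "real (k + 1) * pole_divisor R f \<gamma> \<le> pole_divisor R ?P \<gamma>"
      proof (cases "ord \<gamma> f < 0")
        case True
        have "real (k + 1) * pole_divisor R f \<gamma> = - ordr ?P \<gamma>"
          using True eq[OF True] by (simp add: pole_divisor_def)
        also have "\<dots> \<le> pole_divisor R ?P \<gamma>" by (simp add: pole_divisor_def)
        finally show ?thesis .
      qed (simp add: pole_divisor_def)
    qed
    then have n: "real (k + 1) * N r f \<le> N r ?P" by (simp add: counting_cmult)
    have m: "real (k + 1) * max 0 (ln (nrm r f)) \<le> max 0 (ln (nrm r ?P)) + real (k + 1) * ln (max 1 (absval b))"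
    proof (cases "nrm r f \<le> max 1 (absval b)")
      case True
      have "max 0 (ln (nrm r f)) \<le> ln (max 1 (absval b))"
        using True nrm_pos[OF r0 r(2) assms(1,2)] by (simp add: ln_mono)
      then have "real (k + 1) * max 0 (ln (nrm r f)) \<le> real (k + 1) * ln (max 1 (absval b))"
        by (intro mult_left_mono) auto
      then show ?thesis by linarith
    next
      case False
      have "nrm r (fls_const (- b)) < nrm r f"
        using False unfolding nrm_const[OF r0 r(2)] by simp
      then have "nrm r (fls_const (- b) + f) = nrm r f" by (rule nrm_add_eq[OF r0 r(2) mero_const assms(1)])
      then have "nrm r (f - fls_const b) = nrm r f" by (simp add: add.commute)
      then have "nrm r ?P = nrm r f ^ (k + 1)"
        using nrm_mult[OF r0 r(2) mero_power[OF assms(1)] h(1), of k] nrm_power[OF r0 r(2) assms(1), of k]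
        by (simp add: mult.commute)
      then have "ln (nrm r ?P) = real (k + 1) * ln (nrm r f)"
        using nrm_pos[OF r0 r(2) assms(1,2)] by (simp add: ln_realpow del: power_Suc of_nat_add)
      moreover have "ln (nrm r f) \<ge> 0" using False by simp
      moreover have "ln (max 1 (absval b)) \<ge> 0" by simp
      ultimately show ?thesis by simp
    qed
    have "real (k + 1) * T r f \<le> real (k + 1) * (N r f + max 0 (ln (nrm r f)) + C)"
      using C[OF r] by (intro mult_left_mono) auto
    also have "\<dots> = real (k + 1) * N r f + real (k + 1) * max 0 (ln (nrm r f)) + real (k + 1) * C"
      by (simp only: distrib_left)
    finally show "real (k + 1) * T r f \<le> T r ?P + (C' + real (k + 1) * ln (max 1 (absval b)) + real (k + 1) * C)"
      using n m C'[OF r] by linarith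
  qed
qed

text \<open>Proximity to 0 may be measured on the derivative, whose norm is smaller up to a
  constant. For \<open>Psi f\<close> the derivative is a multiple of \<open>Phi f\<close>, the
  function that the sharing hypothesis is about.\<close>

lemma char_fun_le_deriv:
  assumes "P \<in> M" "fls_deriv P \<noteq> 0"
  shows "(\<lambda>r. T r P) \<lesssim> (\<lambda>r. Z r P + max 0 (- ln (nrm r (fls_deriv P))))"
proof -
  have P0: "P \<noteq> 0" using assms by auto
  obtain C where C: "\<And>r. \<rho> < r \<Longrightarrow> r < R \<Longrightarrow> T r P \<le> Z r P + max 0 (- ln (nrm r P)) + C"
    using char_fun_zeros(1)[OF assms(1) P0] unfolding le_up_to_const_def by blast
  show ?thesis
  proof (rule le_up_to_constI)
    fix r assume r: "\<rho> < r" "r < R"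
    note r0 = r_pos[OF r(1)]
    have "nrm r (fls_deriv P) \<le> nrm r P / r" by (rule nrm_deriv_le[OF r0 r(2) assms(1)])
    also have "\<dots> \<le> nrm r P / \<rho>"
      using r \<rho> nrm_nonneg[OF r0 r(2) assms(1)] by (intro divide_left_mono) auto
    finally have "ln (nrm r (fls_deriv P)) \<le> ln (nrm r P / \<rho>)"
      using nrm_pos[OF r0 r(2) mero_deriv[OF assms(1)] assms(2)] by (simp add: ln_mono)
    also have "\<dots> = ln (nrm r P) - ln \<rho>"
      using nrm_pos[OF r0 r(2) assms(1) P0] \<rho> by (simp add: ln_div)
    finally show "T r P \<le> (Z r P + max 0 (- ln (nrm r (fls_deriv P)))) + (C + \<bar>ln \<rho>\<bar>)"
      using C[OF r] by linarith
  qed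
qed

text \<open>Turns norm inequalities into divisor estimates: by Jensen's formula
  \<open>ln (nrm r h)\<close> is a signed count of zeros and poles of \<open>h\<close>, which can
  then be bounded point by point.\<close>

lemma log_le_counting:
  assumes "h \<in> M" "h \<noteq> 0" "c > 0"
    and "\<And>r. \<rho> < r \<Longrightarrow> r < R \<Longrightarrow> X r > 0"
    and "\<And>r. \<rho> < r \<Longrightarrow> r < R \<Longrightarrow> 1 \<le> c * nrm r h"
    and "\<And>r. \<rho> < r \<Longrightarrow> r < R \<Longrightarrow> X r \<le> c * nrm r h"
  shows "(\<lambda>r. max 0 (ln (X r))) \<lesssim> (\<lambda>r. counting \<rho> r (ordr h))"
proof (rule le_up_to_constI)
  fix r assume r: "\<rho> < r" "r < R"
  note pos = nrm_pos[OF r_pos[OF r(1)] r(2) assms(1,2)]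
  have "max 0 (ln (X r)) \<le> ln (c * nrm r h)"
    using assms(4-6)[OF r] by (simp add: ln_mono)
  also have "\<dots> = ln c + ln (nrm r h)" using assms(3) pos by (simp add: ln_mult_pos)
  finally show "max 0 (ln (X r)) \<le> counting \<rho> r (ordr h) + (ln c + ln (nrm \<rho> h))"
    using counting_ord[OF assms(1,2) r] by simp
qed

text \<open>The second main theorem for the values \<open>0\<close>, \<open>s\<close> and infinity.\<close>

lemma three_values:
  assumes "F \<in> M" "fls_deriv F \<noteq> 0" "s \<noteq> 0"
  shows "(\<lambda>r. max 0 (- ln (nrm r F))) \<lesssim> (\<lambda>r. counting \<rho> r (ordr ((F - fls_const s) / fls_deriv F)))"
    and "(\<lambda>r. max 0 (ln (nrm r F))) \<lesssim> (\<lambda>r. counting \<rho> r (ordr (F * (F - fls_const s) / fls_deriv F)))"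
proof -
  have F0: "F \<noteq> 0" and Fs: "F - fls_const s \<noteq> 0" using assms by auto
  note d = mero_deriv[OF assms(1)]
  have m: "F - fls_const s \<in> M" using assms by (intro mero_intros)
  \<comment> \<open>The entries belong to the first two bounds below. For the second one either
    \<open>nrm r F < absval s\<close>, and then \<open>nrm r (F - fls_const s) = absval s\<close>,
    or \<open>nrm r F / absval s \<ge> 1\<close>.\<close>
  define c where "c = max (1 / \<rho>) (1 / (\<rho> * absval s))"
  have c: "c > 0" unfolding c_def using \<rho> by (simp add: less_max_iff_disj)
  have s: "absval s > 0" using assms(3) by simp
  have *: "nrm r (fls_deriv F) \<le> c * nrm r (F - fls_const s)"
    "nrm r (fls_deriv F) \<le> c * (nrm r F * nrm r (F - fls_const s))"
    "0 < nrm r F" "0 < nrm r (F - fls_const s)" "0 < nrm r (fls_deriv F)"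
    if r: "\<rho> < r" "r < R" for r
  proof -
    note r0 = r_pos[OF r(1)]
    show pos: "0 < nrm r F" "0 < nrm r (F - fls_const s)" "0 < nrm r (fls_deriv F)"
      using nrm_pos[OF r0 r(2)] assms F0 Fs d m by auto
    have "nrm r (fls_deriv (F - fls_const s)) \<le> nrm r (F - fls_const s) / r"
      by (rule nrm_deriv_le[OF r0 r(2) m])
    also have "\<dots> \<le> nrm r (F - fls_const s) / \<rho>"
      using pos r \<rho> by (intro divide_left_mono) auto
    finally have 1: "nrm r (fls_deriv F) \<le> 1 / \<rho> * nrm r (F - fls_const s)" by simp
    also have "\<dots> \<le> c * nrm r (F - fls_const s)" using pos by (intro mult_right_mono) (auto simp: c_def)
    finally show "nrm r (fls_deriv F) \<le> c * nrm r (F - fls_const s)" .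
    have "nrm r (fls_deriv F) \<le> 1 / (\<rho> * absval s) * (nrm r F * nrm r (F - fls_const s))"
    proof (cases "nrm r F < absval s")
      case True
      have "nrm r (F + fls_const (- s)) = nrm r (fls_const (- s))"
        using True assms(1) by (intro nrm_add_eq[OF r0 r(2)]) (simp_all only: nrm_const[OF r0 r(2)] mero_const absval_uminus)
      then have eq: "nrm r (F - fls_const s) = absval s"
        by (simp only: nrm_const[OF r0 r(2)] absval_uminus) simp
      have "nrm r (fls_deriv F) \<le> nrm r F / r" by (rule nrm_deriv_le[OF r0 r(2) assms(1)])
      also have "\<dots> \<le> nrm r F / \<rho>" using pos r \<rho> by (intro divide_left_mono) auto
      also have "\<dots> = 1 / (\<rho> * absval s) * (nrm r F * nrm r (F - fls_const s))"
        unfolding eq using s by simp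
      finally show ?thesis .
    next
      case False
      then have "1 \<le> nrm r F / absval s" using s by (simp add: pos_le_divide_eq)
      then have "1 / \<rho> * nrm r (F - fls_const s) * 1 \<le> 1 / \<rho> * nrm r (F - fls_const s) * (nrm r F / absval s)"
        using pos \<rho> by (intro mult_left_mono) auto
      then show ?thesis using 1 by (simp add: mult_ac)
    qed
    also have "\<dots> \<le> c * (nrm r F * nrm r (F - fls_const s))"
      using pos by (intro mult_right_mono) (auto simp: c_def)
    finally show "nrm r (fls_deriv F) \<le> c * (nrm r F * nrm r (F - fls_const s))" .
  qed
  have q1: "(F - fls_const s) / fls_deriv F \<in> M" "(F - fls_const s) / fls_deriv F \<noteq> 0"
    using m d Fs assms(2) by (auto intro: mero_divide)
  have q2: "F * (F - fls_const s) / fls_deriv F \<in> M" "F * (F - fls_const s) / fls_deriv F \<noteq> 0"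
    using m d Fs assms F0 by (auto intro: mero_divide mero_mult)
  have n1: "nrm r ((F - fls_const s) / fls_deriv F) = nrm r (F - fls_const s) / nrm r (fls_deriv F)"
    if r: "\<rho> < r" "r < R" for r by (rule nrm_divide[OF r_pos[OF r(1)] r(2) m d])
  have n2: "nrm r (F * (F - fls_const s) / fls_deriv F) = nrm r F * nrm r (F - fls_const s) / nrm r (fls_deriv F)"
    if r: "\<rho> < r" "r < R" for r
    using nrm_divide[OF r_pos[OF r(1)] r(2) mero_mult[OF assms(1) m] d] nrm_mult[OF r_pos[OF r(1)] r(2) assms(1) m]
    by simp
  have "(\<lambda>r. max 0 (ln (1 / nrm r F))) \<lesssim> (\<lambda>r. counting \<rho> r (ordr ((F - fls_const s) / fls_deriv F)))"
  proof (rule log_le_counting[OF q1 c])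
    fix r assume r: "\<rho> < r" "r < R"
    show "1 / nrm r F > 0" using *(3)[OF r] by simp
    show "1 \<le> c * nrm r ((F - fls_const s) / fls_deriv F)"
      unfolding n1[OF r] using *[OF r] by (simp add: pos_le_divide_eq)
    show "1 / nrm r F \<le> c * nrm r ((F - fls_const s) / fls_deriv F)"
      unfolding n1[OF r] using *[OF r] by (simp add: field_simps)
  qed
  moreover have "(\<lambda>r. max 0 (- ln (nrm r F))) \<lesssim> (\<lambda>r. max 0 (ln (1 / nrm r F)))"
  proof (rule le_up_to_constI[where C = 0])
    fix r assume r: "\<rho> < r" "r < R"
    show "max 0 (- ln (nrm r F)) \<le> max 0 (ln (1 / nrm r F)) + 0" using *(3)[OF r] by (simp add: ln_div)
  qed
  ultimately show "(\<lambda>r. max 0 (- ln (nrm r F))) \<lesssim> (\<lambda>r. counting \<rho> r (ordr ((F - fls_const s) / fls_deriv F)))"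
    using le_up_to_const_trans by blast
  show "(\<lambda>r. max 0 (ln (nrm r F))) \<lesssim> (\<lambda>r. counting \<rho> r (ordr (F * (F - fls_const s) / fls_deriv F)))"
  proof (rule log_le_counting[OF q2 c])
    fix r assume r: "\<rho> < r" "r < R"
    show "nrm r F > 0" using *(3)[OF r] by simp
    show "1 \<le> c * nrm r (F * (F - fls_const s) / fls_deriv F)"
      unfolding n2[OF r] using *[OF r] by (simp add: pos_le_divide_eq)
    show "nrm r F \<le> c * nrm r (F * (F - fls_const s) / fls_deriv F)"
      unfolding n2[OF r] using *[OF r] by (simp add: field_simps)
  qed
qed

subsection \<open>The Wronskian\<close>

text \<open>The Wronskian of 1, \<open>x\<close> and \<open>y\<close>. Constants may be added to
  \<open>x\<close> and \<open>y\<close> without changing it, a freedom that the estimates below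
  exploit.\<close>

definition wr :: "'k fls \<Rightarrow> 'k fls \<Rightarrow> 'k fls" where
  "wr x y = fls_deriv x * fls_deriv (fls_deriv y) - fls_deriv (fls_deriv x) * fls_deriv y"

lemma wr_mero: "x \<in> M \<Longrightarrow> y \<in> M \<Longrightarrow> wr x y \<in> M"
  unfolding wr_def by (intro mero_intros)

text \<open>Up to sign, \<open>wr x y\<close> is the Wronskian of \<open>x\<close>, \<open>y\<close> and \<open>1 + y\<close>, which allows a bound by the product
  of all three norms.\<close>

lemma wr_nrm_le:
  assumes "x \<in> M" "y \<in> M" "\<rho> < r" "r < R"
  shows "nrm r (wr x y) \<le> nrm r x * nrm r y * nrm r (1 + y) / r ^ 3"
proof -
  note r0 = r_pos[OF assms(3)]
  note I = r0 assms(4)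
  let ?d = fls_deriv
  define z where "z = 1 + y"
  have z: "z \<in> M" unfolding z_def using assms by (intro mero_intros)
  have d: "nrm r (?d h) \<le> nrm r h / r" "nrm r (?d (?d h)) \<le> nrm r h / r ^ 2" if h: "h \<in> M" for h
  proof -
    show 1: "nrm r (?d h) \<le> nrm r h / r" by (rule nrm_deriv_le[OF I h])
    have "nrm r (?d (?d h)) \<le> nrm r (?d h) / r" by (rule nrm_deriv_le[OF I mero_deriv[OF h]])
    also have "\<dots> \<le> nrm r h / r / r" using 1 r0 by (intro divide_right_mono) auto
    finally show "nrm r (?d (?d h)) \<le> nrm r h / r ^ 2" by (simp add: power2_eq_square)
  qed
  define B where "B = nrm r x * nrm r y * nrm r z / r ^ 3"
  have prod: "nrm r (h1 * h2 * h3) \<le> B"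
    if "h1 \<in> M" "h2 \<in> M" "h3 \<in> M" "nrm r h1 \<le> b1" "nrm r h2 \<le> b2" "nrm r h3 \<le> b3" "b1 * b2 * b3 = B"
    for h1 h2 h3 b1 b2 b3
  proof -
    have "nrm r (h1 * h2 * h3) = nrm r h1 * nrm r h2 * nrm r h3"
      using that by (simp add: nrm_mult[OF I] mero_mult)
    also have "\<dots> \<le> b1 * b2 * b3"
      using that nrm_nonneg[OF I] order_trans[OF nrm_nonneg[OF I]] by (intro mult_mono mult_nonneg_nonneg) blast+
    finally show ?thesis using that by simp
  qed
  have sub: "nrm r (h1 - h2) \<le> B" if "h1 \<in> M" "h2 \<in> M" "nrm r h1 \<le> B" "nrm r h2 \<le> B" for h1 h2
    using nrm_add_le[OF I that(1) mero_uminus[OF that(2)]] nrm_uminus[OF I that(2)] that by simp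
  have add: "nrm r (h1 + h2) \<le> B" if "h1 \<in> M" "h2 \<in> M" "nrm r h1 \<le> B" "nrm r h2 \<le> B" for h1 h2
    using nrm_add_le[OF I that(1,2)] that by simp
  \<comment> \<open>The summands of the determinant that do not cancel. Each contains
    \<open>x\<close>, \<open>y\<close> and \<open>z\<close> once and three derivations in total,
    hence the factor \<open>1 / r ^ 3\<close>.\<close>
  have eq: "wr x y = (?d x * ?d (?d y) * z - ?d x * y * ?d (?d z)) + (?d (?d x) * y * ?d z - ?d (?d x) * ?d y * z)"
    unfolding wr_def z_def by (simp add: algebra_simps)
  have "nrm r (wr x y) \<le> B" unfolding eq
  proof (intro add sub)
    show "nrm r (?d x * ?d (?d y) * z) \<le> B"
      by (rule prod[OF _ _ _ d(1)[OF assms(1)] d(2)[OF assms(2)] order_refl])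
        (use assms z r0 in \<open>auto simp: B_def power2_eq_square power3_eq_cube intro: mero_intros\<close>)
    show "nrm r (?d x * y * ?d (?d z)) \<le> B"
      by (rule prod[OF _ _ _ d(1)[OF assms(1)] order_refl d(2)[OF z]])
        (use assms z r0 in \<open>auto simp: B_def power2_eq_square power3_eq_cube intro: mero_intros\<close>)
    show "nrm r (?d (?d x) * y * ?d z) \<le> B"
      by (rule prod[OF _ _ _ d(2)[OF assms(1)] order_refl d(1)[OF z]])
        (use assms z r0 in \<open>auto simp: B_def power2_eq_square power3_eq_cube intro: mero_intros\<close>)
    show "nrm r (?d (?d x) * ?d y * z) \<le> B"
      by (rule prod[OF _ _ _ d(2)[OF assms(1)] d(1)[OF assms(2)] order_refl])
        (use assms z r0 in \<open>auto simp: B_def power2_eq_square power3_eq_cube intro: mero_intros\<close>)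
  qed (use assms z in \<open>simp_all add: mero_intros\<close>)
  then show ?thesis by (simp add: B_def z_def)
qed

text \<open>Here the zero function has infinite order, unlike in \<open>omega\<close>; so
  differences, products and derivatives obey uniform rules.\<close>

definition vge :: "'k \<Rightarrow> int \<Rightarrow> 'k fls \<Rightarrow> bool" where
  "vge \<gamma> m h \<longleftrightarrow> h \<in> M \<and> (h = 0 \<or> m \<le> ord \<gamma> h)"

context
  fixes \<gamma> :: 'k
  assumes \<gamma>: "absval \<gamma> < R"
begin

lemma vge_mult: "vge \<gamma> i x \<Longrightarrow> vge \<gamma> j y \<Longrightarrow> vge \<gamma> (i + j) (x * y)"
  unfolding vge_def using \<gamma> by (cases "x = 0 \<or> y = 0") (auto simp: ord_mult mero_mult)

lemma vge_diff:
  assumes "vge \<gamma> m x" "vge \<gamma> m y"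
  shows "vge \<gamma> m (x - y)"
proof -
  have M: "x \<in> M" "y \<in> M" "- y \<in> M" using assms by (auto simp: vge_def intro: mero_uminus)
  have "x - y = 0 \<or> m \<le> ord \<gamma> (x + - y)"
  proof (cases "x = 0 \<or> y = 0 \<or> x - y = 0")
    case False
    then show ?thesis using ord_add_ge[OF M(1,3) _ _ _ \<gamma>] assms ord_uminus[OF M(2) \<gamma>] by (auto simp: vge_def)
  qed (use assms ord_uminus[OF M(2) \<gamma>] in \<open>auto simp: vge_def\<close>)
  then show ?thesis using M by (simp add: vge_def mero_diff)
qed

lemma vge_mono: "vge \<gamma> i x \<Longrightarrow> j \<le> i \<Longrightarrow> vge \<gamma> j x"
  by (auto simp: vge_def)

lemma vge_deriv: "vge \<gamma> i x \<Longrightarrow> vge \<gamma> (i - 1) (fls_deriv x)"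
  unfolding vge_def using ord_deriv_ge[OF _ \<gamma>, of x] by (auto simp: mero_deriv)

lemma vge_deriv_nonneg: "vge \<gamma> 0 x \<Longrightarrow> vge \<gamma> 0 (fls_deriv x)"
  unfolding vge_def using ord_deriv_nonneg[OF _ \<gamma>, of x] by (auto simp: mero_deriv)

text \<open>Two derivations lower the order by at most 2, and they never produce a pole from a
  regular function.\<close>

lemma vge_derivs:
  assumes "vge \<gamma> i x" "i \<ge> 0"
  shows "vge \<gamma> (max (i - 2) 0) (fls_deriv x)" "vge \<gamma> (max (i - 2) 0) (fls_deriv (fls_deriv x))"
proof -
  have n: "vge \<gamma> 0 (fls_deriv x)" "vge \<gamma> 0 (fls_deriv (fls_deriv x))"
    using assms vge_deriv_nonneg vge_mono by blast+
  have d: "vge \<gamma> (i - 1) (fls_deriv x)" "vge \<gamma> (i - 1 - 1) (fls_deriv (fls_deriv x))"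
    using assms(1) vge_deriv by blast+
  show "vge \<gamma> (max (i - 2) 0) (fls_deriv x)" "vge \<gamma> (max (i - 2) 0) (fls_deriv (fls_deriv x))"
    using n d vge_mono[OF d(1), of "i - 2"] by (auto simp: max_def)
qed

text \<open>Each summand contains three derivations, hence the loss of 3. For regular
  \<open>x\<close> and \<open>y\<close> the two factors are treated separately by
  \<open>vge_derivs\<close>; this is the source of the truncation at 2 in the main estimate.\<close>

lemma wr_vge:
  assumes "vge \<gamma> i x" "vge \<gamma> j y"
  shows "vge \<gamma> (i + j - 3) (wr x y)"
    and "i \<ge> 0 \<Longrightarrow> j \<ge> 0 \<Longrightarrow> vge \<gamma> (max (i - 2) 0 + max (j - 2) 0) (wr x y)"
proof -
  have "vge \<gamma> ((i - 1) + (j - 1 - 1)) (fls_deriv x * fls_deriv (fls_deriv y))"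
    "vge \<gamma> ((i - 1 - 1) + (j - 1)) (fls_deriv (fls_deriv x) * fls_deriv y)"
    using assms vge_deriv vge_mult by blast+
  then show "vge \<gamma> (i + j - 3) (wr x y)"
    unfolding wr_def by (intro vge_diff) (auto elim: vge_mono)
  show "vge \<gamma> (max (i - 2) 0 + max (j - 2) 0) (wr x y)" if "i \<ge> 0" "j \<ge> 0"
    unfolding wr_def using vge_derivs[OF assms(1) that(1)] vge_derivs[OF assms(2) that(2)]
    by (intro vge_diff vge_mult)
qed

end

end

section \<open>Sharing a small function\<close>

locale sharing = nevanlinna_disk R K \<rho>
  for R :: real and K :: "'k::{ultrametric_field, complete_space, alg_closed_field, field_char_0} itself"
    and \<rho> :: real +
  fixes \<alpha> :: "'k fls" and a :: 'k and n :: nat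
  assumes \<alpha>: "\<alpha> \<in> M" "\<alpha> \<noteq> 0" and a: "a \<noteq> 0" and n: "n \<ge> 12"
begin

text \<open>Chosen so that the two terms in the derivative of \<open>Psi f\<close> combine to a
  multiple of \<open>Phi f\<close> (\<open>deriv_Psi\<close>).\<close>

definition b :: 'k where "b = a * of_nat (n + 2) / of_nat (n + 1)"

definition Phi :: "'k fls \<Rightarrow> 'k fls" where
  "Phi f = fls_deriv f * f ^ n * (f - fls_const a)"

definition Psi :: "'k fls \<Rightarrow> 'k fls" where
  "Psi f = f ^ (n + 1) * (f - fls_const b)"

definition nonconst :: "'k fls \<Rightarrow> bool" where
  "nonconst f \<longleftrightarrow> f \<in> M \<and> fls_deriv f \<noteq> 0"

lemma b_nonzero: "b \<noteq> 0"
  using a by (simp add: b_def del: of_nat_Suc of_nat_add)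

lemma nonconstD:
  assumes "nonconst f"
  shows "f \<in> M" "fls_deriv f \<noteq> 0" "f \<noteq> 0" "f \<noteq> fls_const c" "f - fls_const c \<noteq> 0"
  using assms by (auto simp: nonconst_def)

lemma deriv_Psi: "fls_deriv (Psi f) = of_nat (n + 2) * Phi f"
proof -
  have "of_nat (n + 1) * fls_const b = (of_nat (n + 2) * fls_const a :: 'k fls)"
    unfolding b_def fls_of_nat fls_const_mult_const by (simp add: mult.commute del: of_nat_Suc of_nat_add)
  then have *: "of_nat (n + 1) * fls_const b * c = (of_nat (n + 2) * fls_const a * c :: 'k fls)" for c
    by simp
  have "fls_deriv (Psi f) = f ^ n * fls_deriv f * (of_nat (n + 2) * f) - of_nat (n + 1) * fls_const b * (f ^ n * fls_deriv f)"
  proof -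
    have "fls_deriv (f ^ (n + 1)) = of_nat (n + 1) * f ^ n * fls_deriv f"
      by (simp only: fls_deriv_power add_diff_cancel_right')
    then show ?thesis
      unfolding Psi_def fls_deriv_mult fls_deriv_sub fls_deriv_const by (simp add: algebra_simps)
  qed
  also have "\<dots> = of_nat (n + 2) * Phi f" unfolding * Phi_def by (simp add: algebra_simps)
  finally show ?thesis .
qed

lemma Phi_mero: "f \<in> M \<Longrightarrow> Phi f \<in> M"
  unfolding Phi_def by (intro mero_intros)

lemma Psi_mero: "f \<in> M \<Longrightarrow> Psi f \<in> M"
  unfolding Psi_def by (intro mero_intros)

lemma Phi_nonzero: "nonconst f \<Longrightarrow> Phi f \<noteq> 0"
  using nonconstD[of f] by (simp add: Phi_def)

lemma Psi_deriv_nonzero: "nonconst f \<Longrightarrow> fls_deriv (Psi f) \<noteq> 0"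
  unfolding deriv_Psi using Phi_nonzero[of f] by (simp del: of_nat_Suc of_nat_add)

text \<open>The product \<open>int n * ord \<gamma> f\<close> is compared with
  \<open>12 * ord \<gamma> f\<close> here, so that later case distinctions can treat it as a single
  unknown and remain linear.\<close>

lemma local_orders:
  assumes "nonconst f" "absval \<gamma> < R"
  shows "ord \<gamma> (Phi f) = ord \<gamma> (fls_deriv f) + int n * ord \<gamma> f + ord \<gamma> (f - fls_const a)"
    and "ord \<gamma> (Psi f) = int n * ord \<gamma> f + ord \<gamma> f + ord \<gamma> (f - fls_const b)"
    and "ord \<gamma> f < 0 \<Longrightarrow> ord \<gamma> (f - fls_const a) = ord \<gamma> f \<and> ord \<gamma> (f - fls_const b) = ord \<gamma> f \<and>
      ord \<gamma> (fls_deriv f) = ord \<gamma> f - 1 \<and> int n * ord \<gamma> f \<le> 12 * ord \<gamma> f"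
    and "ord \<gamma> f > 0 \<Longrightarrow> ord \<gamma> (f - fls_const a) = 0 \<and> ord \<gamma> (f - fls_const b) = 0 \<and>
      ord \<gamma> (fls_deriv f) = ord \<gamma> f - 1 \<and> 12 * ord \<gamma> f \<le> int n * ord \<gamma> f"
    and "ord \<gamma> f = 0 \<Longrightarrow> ord \<gamma> (f - fls_const a) \<ge> 0 \<and> ord \<gamma> (f - fls_const b) \<ge> 0 \<and>
      ord \<gamma> (fls_deriv f) \<ge> 0 \<and> int n * ord \<gamma> f = 0 \<and>
      (ord \<gamma> (f - fls_const a) > 0 \<longrightarrow> ord \<gamma> (fls_deriv f) = ord \<gamma> (f - fls_const a) - 1)"
proof -
  note f = nonconstD[OF assms(1)]
  note s = ord_sub_const[OF f(1) assms(2) f(4)]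
  have m: "f - fls_const c \<in> M" for c using f by (intro mero_intros)
  show "ord \<gamma> (Phi f) = ord \<gamma> (fls_deriv f) + int n * ord \<gamma> f + ord \<gamma> (f - fls_const a)"
    unfolding Phi_def using f m assms(2)
    by (simp add: ord_mult ord_power mero_mult mero_power mero_deriv)
  show "ord \<gamma> (Psi f) = int n * ord \<gamma> f + ord \<gamma> f + ord \<gamma> (f - fls_const b)"
    unfolding Psi_def using f m assms(2)
    by (simp add: ord_mult ord_power mero_mult mero_power)
  show "ord \<gamma> f < 0 \<Longrightarrow> ord \<gamma> (f - fls_const a) = ord \<gamma> f \<and> ord \<gamma> (f - fls_const b) = ord \<gamma> f \<and>
      ord \<gamma> (fls_deriv f) = ord \<gamma> f - 1 \<and> int n * ord \<gamma> f \<le> 12 * ord \<gamma> f"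
    using s(1) ord_deriv[OF f(1) assms(2)] n by (auto intro: mult_right_mono_neg)
  show "ord \<gamma> f > 0 \<Longrightarrow> ord \<gamma> (f - fls_const a) = 0 \<and> ord \<gamma> (f - fls_const b) = 0 \<and>
      ord \<gamma> (fls_deriv f) = ord \<gamma> f - 1 \<and> 12 * ord \<gamma> f \<le> int n * ord \<gamma> f"
    using s(2) a b_nonzero ord_deriv[OF f(1) assms(2)] n by (auto intro: mult_right_mono)
  show "ord \<gamma> f = 0 \<Longrightarrow> ord \<gamma> (f - fls_const a) \<ge> 0 \<and> ord \<gamma> (f - fls_const b) \<ge> 0 \<and>
      ord \<gamma> (fls_deriv f) \<ge> 0 \<and> int n * ord \<gamma> f = 0 \<and>
      (ord \<gamma> (f - fls_const a) > 0 \<longrightarrow> ord \<gamma> (fls_deriv f) = ord \<gamma> (f - fls_const a) - 1)"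
    using s(3) ord_deriv_nonneg[OF f(1) assms(2)] ord_deriv(1)[OF m assms(2), of a] by auto
qed

text \<open>The budget of the local estimate. Passing from \<open>Phi f\<close> to
  \<open>Psi f\<close> costs a zero of \<open>f\<close> once and the zeros of \<open>f - b\<close>.
  The truncation at 2 costs 2 at zeros and poles of \<open>f\<close> and of \<open>g\<close>, and
  for \<open>g\<close> also the zeros of \<open>g - a\<close> and of the derivative; for
  \<open>f\<close> the latter are absorbed by the zeros of \<open>Phi f\<close>. The terms with
  \<open>\<alpha>\<close> pay for the points where only a crude bound holds.\<close>

definition main_divisor :: "'k fls \<Rightarrow> 'k fls \<Rightarrow> 'k \<Rightarrow> real" where
  "main_divisor f g \<gamma> = 2 * pole_divisor R f \<gamma> + 3 * zero_divisor R f \<gamma> + zero_divisor R (f - fls_const b) \<gamma>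
    + 2 * pole_divisor R g \<gamma> + 2 * zero_divisor R g \<gamma> + zero_divisor R (g - fls_const a) \<gamma>
    + zero_divisor R (fls_deriv g) \<gamma> + 4 * zero_divisor R \<alpha> \<gamma> + 4 * pole_divisor R \<alpha> \<gamma>"

lemma main_divisor_locfin:
  assumes "f \<in> M" "g \<in> M"
  shows "divisor_locfin R (main_divisor f g)"
  unfolding main_divisor_def using assms \<alpha>
  by (intro divisor_locfin_add divisor_locfin_cmult zero_divisor_locfin pole_divisor_locfin mero_intros)

text \<open>For \<open>f\<close> the coefficients add up to \<open>2 + 3 + 1\<close>. For
  \<open>g\<close> they add up to \<open>2 + 2 + 1 + 2\<close>, since \<open>zeros_deriv\<close>
  bounds the zeros of the derivative by the zeros and poles of \<open>g\<close>.\<close>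

lemma counting_main_divisor:
  assumes "nonconst f" "nonconst g"
  shows "(\<lambda>r. counting \<rho> r (main_divisor f g)) \<lesssim> (\<lambda>r. 6 * T r f + 7 * T r g + 8 * T r \<alpha>)"
proof -
  note f = nonconstD[OF assms(1)] and g = nonconstD[OF assms(2)]
  obtain C1 where C1: "\<And>r. \<rho> < r \<Longrightarrow> r < R \<Longrightarrow> Z r (f - fls_const b) \<le> T r f + C1"
    using zeros_sub_const[OF f(1,4)] unfolding le_up_to_const_def by blast
  obtain C2 where C2: "\<And>r. \<rho> < r \<Longrightarrow> r < R \<Longrightarrow> Z r (g - fls_const a) \<le> T r g + C2"
    using zeros_sub_const[OF g(1,4)] unfolding le_up_to_const_def by blast
  obtain C3 where C3: "\<And>r. \<rho> < r \<Longrightarrow> r < R \<Longrightarrow> Z r (fls_deriv g) \<le> Z r g + N r g + C3"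
    using zeros_deriv[OF g(1,2)] unfolding le_up_to_const_def by blast
  show ?thesis
  proof (rule le_up_to_constI)
    fix r assume r: "\<rho> < r" "r < R"
    have lf: "divisor_locfin R (zero_divisor R h)" "divisor_locfin R (pole_divisor R h)" if "h \<in> M" for h
      using zero_divisor_locfin[OF that] pole_divisor_locfin[OF that] by auto
    have M: "f - fls_const b \<in> M" "g - fls_const a \<in> M" "fls_deriv g \<in> M"
      using f g by (auto intro: mero_intros)
    have "counting \<rho> r (main_divisor f g) = 2 * N r f + 3 * Z r f + Z r (f - fls_const b) + 2 * N r g
      + 2 * Z r g + Z r (g - fls_const a) + Z r (fls_deriv g) + 4 * Z r \<alpha> + 4 * N r \<alpha>"
      unfolding main_divisor_def
      by (subst counting_add[OF _ _ r(2)];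
          (intro divisor_locfin_add divisor_locfin_cmult lf f g M \<alpha>)?)+ (simp add: counting_cmult)
    then show "counting \<rho> r (main_divisor f g) \<le> (6 * T r f + 7 * T r g + 8 * T r \<alpha>) + (C1 + C2 + C3)"
      using C1[OF r] C2[OF r] C3[OF r] T_ge[of r f] T_ge[of r g] T_ge[of r \<alpha>] by linarith
  qed
qed

text \<open>The growth of \<open>Psi f\<close> is compared with its zeros and with proximity
  measured on \<open>Phi f\<close>; the factor \<open>\<alpha>\<close> between \<open>Phi f\<close>
  and \<open>Phi f / \<alpha>\<close> costs one \<open>T r \<alpha>\<close>.\<close>

lemma char_fun_le_Psi:
  assumes "nonconst f"
  shows "(\<lambda>r. real (n + 2) * T r f) \<lesssim> (\<lambda>r. Z r (Psi f) + max 0 (- ln (nrm r (Phi f / \<alpha>))) + T r \<alpha>)"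
proof -
  note f = nonconstD[OF assms]
  have "(\<lambda>r. real (n + 2) * T r f) \<lesssim> (\<lambda>r. T r (Psi f))"
    using char_fun_power_mult[OF f(1,3,4), where b = b and k = "n + 1"]
    by (simp only: Psi_def Suc_eq_plus1 add.assoc one_add_one)
  also have "(\<lambda>r. T r (Psi f)) \<lesssim> (\<lambda>r. Z r (Psi f) + max 0 (- ln (nrm r (fls_deriv (Psi f)))))"
    by (rule char_fun_le_deriv[OF Psi_mero[OF f(1)] Psi_deriv_nonzero[OF assms]])
  also have "\<dots> \<lesssim> (\<lambda>r. Z r (Psi f) + max 0 (- ln (nrm r (Phi f / \<alpha>))) + T r \<alpha>)"
  proof -
    obtain C where C: "\<And>r. \<rho> < r \<Longrightarrow> r < R \<Longrightarrow> Z r \<alpha> + max 0 (- ln (nrm r \<alpha>)) \<le> T r \<alpha> + C"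
      using char_fun_zeros(2)[OF \<alpha>] unfolding le_up_to_const_def by blast
    show ?thesis
    proof (rule le_up_to_constI)
      fix r assume r: "\<rho> < r" "r < R"
      note I = r_pos[OF r(1)] r(2)
      have m: "Phi f / \<alpha> \<in> M" "Phi f / \<alpha> \<noteq> 0"
        using Phi_mero[OF f(1)] Phi_nonzero[OF assms] \<alpha> by (auto intro: mero_divide)
      have "fls_deriv (Psi f) = fls_const (of_nat (n + 2)) * (\<alpha> * (Phi f / \<alpha>))"
        unfolding deriv_Psi fls_of_nat using \<alpha> by simp
      then have "nrm r (fls_deriv (Psi f)) = absval (of_nat (n + 2) :: 'k) * (nrm r \<alpha> * nrm r (Phi f / \<alpha>))"
        using nrm_mult[OF I mero_const mero_mult[OF \<alpha>(1) m(1)], of "of_nat (n + 2)"]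
          nrm_mult[OF I \<alpha>(1) m(1)] nrm_const[OF I, of "of_nat (n + 2)"] by metis
      moreover have "absval (of_nat (n + 2) :: 'k) > 0"
        unfolding absval_pos_iff of_nat_eq_0_iff by simp
      ultimately have "ln (nrm r (fls_deriv (Psi f)))
          = ln (absval (of_nat (n + 2) :: 'k)) + (ln (nrm r \<alpha>) + ln (nrm r (Phi f / \<alpha>)))"
        using nrm_pos[OF I \<alpha>] nrm_pos[OF I m] by (simp add: ln_mult_pos)
      moreover have "Z r \<alpha> \<ge> 0" by (rule counting_nonneg[OF \<rho>(1) less_imp_le[OF r(1)] zero_divisor_nonneg])
      ultimately show "Z r (Psi f) + max 0 (- ln (nrm r (fls_deriv (Psi f))))
          \<le> (Z r (Psi f) + max 0 (- ln (nrm r (Phi f / \<alpha>))) + T r \<alpha>) + (C + \<bar>ln (absval (of_nat (n + 2) :: 'k))\<bar>)"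
        using C[OF r] by linarith
    qed
  qed
  finally show ?thesis .
qed

text \<open>The common frame for two choices of \<open>h\<close>, one built from the Wronskian and
  one from a value \<open>s\<close>. The coefficient 9 is 8 from the budget plus 1 from
  \<open>char_fun_le_Psi\<close>.\<close>

lemma main_inequalityI:
  assumes "nonconst f" "nonconst g" "h \<in> M" "h \<noteq> 0"
    and "(\<lambda>r. max 0 (- ln (nrm r (Phi f / \<alpha>)))) \<lesssim> (\<lambda>r. counting \<rho> r (ordr h))"
    and "\<And>\<gamma>. absval \<gamma> < R \<Longrightarrow> zero_divisor R (Psi f) \<gamma> + ordr h \<gamma> \<le> main_divisor f g \<gamma>"
  shows "(\<lambda>r. real (n + 2) * T r f) \<lesssim> (\<lambda>r. 6 * T r f + 7 * T r g + 9 * T r \<alpha>)"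
proof -
  note f = nonconstD[OF assms(1)] and g = nonconstD[OF assms(2)]
  obtain C1 where C1: "\<And>r. \<rho> < r \<Longrightarrow> r < R \<Longrightarrow>
      real (n + 2) * T r f \<le> Z r (Psi f) + max 0 (- ln (nrm r (Phi f / \<alpha>))) + T r \<alpha> + C1"
    using char_fun_le_Psi[OF assms(1)] unfolding le_up_to_const_def by blast
  obtain C2 where C2: "\<And>r. \<rho> < r \<Longrightarrow> r < R \<Longrightarrow> max 0 (- ln (nrm r (Phi f / \<alpha>))) \<le> counting \<rho> r (ordr h) + C2"
    using assms(5) unfolding le_up_to_const_def by blast
  obtain C3 where C3: "\<And>r. \<rho> < r \<Longrightarrow> r < R \<Longrightarrow> counting \<rho> r (main_divisor f g) \<le> 6 * T r f + 7 * T r g + 8 * T r \<alpha> + C3"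
    using counting_main_divisor[OF assms(1,2)] unfolding le_up_to_const_def by blast
  show ?thesis
  proof (rule le_up_to_constI)
    fix r assume r: "\<rho> < r" "r < R"
    note lf = zero_divisor_locfin[OF Psi_mero[OF f(1)]] ord_locfin[OF assms(3)]
    have "Z r (Psi f) + counting \<rho> r (ordr h) = counting \<rho> r (\<lambda>\<gamma>. zero_divisor R (Psi f) \<gamma> + ordr h \<gamma>)"
      by (rule counting_add[OF lf r(2), symmetric])
    also have "\<dots> \<le> counting \<rho> r (main_divisor f g)"
      using f g by (intro counting_leI divisor_locfin_add lf main_divisor_locfin r assms(6))
    finally show "real (n + 2) * T r f \<le> (6 * T r f + 7 * T r g + 9 * T r \<alpha>) + (C1 + C2 + C3)"
      using C1[OF r] C2[OF r] C3[OF r] by linarith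
  qed
qed

text \<open>\<open>K1\<close> is a crude bound for every point, \<open>K2\<close> the truncated one
  for points where \<open>\<alpha>\<close> has order 0. At the other points the excess 3, and a zero
  of \<open>\<alpha>\<close> that lowers the order of \<open>Phi f / \<alpha>\<close>, are paid by
  \<open>4 * \<bar>ord \<gamma> \<alpha>\<bar>\<close>.\<close>

lemma main_divisor_local:
  assumes "nonconst f" "nonconst g" "absval \<gamma> < R"
    and K1: "\<kappa> \<le> - max (ord \<gamma> (Phi f) - ord \<gamma> \<alpha>) 0 + 3"
    and K2: "ord \<gamma> \<alpha> = 0 \<Longrightarrow> \<kappa> \<le> - max (ord \<gamma> (Phi f)) 0 + min 2 \<bar>ord \<gamma> (Phi f)\<bar> + min 2 \<bar>ord \<gamma> (Phi g)\<bar>"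
  shows "zero_divisor R (Psi f) \<gamma> + of_int \<kappa> \<le> main_divisor f g \<gamma>"
proof -
  note F = local_orders[OF assms(1,3)] and G = local_orders[OF assms(2,3)]
  define x y where "x = ord \<gamma> f" and "y = ord \<gamma> g"
  define X Y where "X = int n * x" and "Y = int n * y"
  define xa xb xd where "xa = ord \<gamma> (f - fls_const a)" and "xb = ord \<gamma> (f - fls_const b)" and "xd = ord \<gamma> (fls_deriv f)"
  define ya yd where "ya = ord \<gamma> (g - fls_const a)" and "yd = ord \<gamma> (fls_deriv g)"
  define e where "e = ord \<gamma> \<alpha>"
  note defs = x_def[symmetric] y_def[symmetric] X_def[symmetric] Y_def[symmetric] xa_def[symmetric]
    xb_def[symmetric] xd_def[symmetric] ya_def[symmetric] yd_def[symmetric] e_def[symmetric]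
  note F = F[unfolded defs] and G = G[unfolded defs]
  have f_part: "max (X + x + xb) 0 - max (xd + X + xa) 0 \<le> max x 0 + max xb 0"
    using F(3-5) by (cases "x < 0"; cases "x = 0") auto
  have f_part2: "max (X + x + xb) 0 - max (xd + X + xa) 0 + min 2 \<bar>xd + X + xa\<bar>
      \<le> 2 * max (- x) 0 + 3 * max x 0 + max xb 0"
    using F(3-5) by (cases "x < 0"; cases "x = 0") auto
  have g_part: "min 2 \<bar>yd + Y + ya\<bar> \<le> 2 * max (- y) 0 + 2 * max y 0 + max ya 0 + max yd 0"
    using G(3-5) by (cases "y < 0"; cases "y = 0") auto
  have e_part: "max (xd + X + xa) 0 \<le> max (xd + X + xa - e) 0 + max e 0"
    "e \<noteq> 0 \<Longrightarrow> 3 + max e 0 \<le> 4 * max e 0 + 4 * max (- e) 0" by auto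
  have k1: "\<kappa> \<le> - max (xd + X + xa - e) 0 + 3" using K1 unfolding F(1) defs .
  have k2: "e = 0 \<Longrightarrow> \<kappa> \<le> - max (xd + X + xa) 0 + min 2 \<bar>xd + X + xa\<bar> + min 2 \<bar>yd + Y + ya\<bar>"
    using K2 unfolding F(1) G(1) defs by simp
  \<comment> \<open>The maxima become opaque unknowns, so that the conclusion is linear arithmetic
    without further case splits.\<close>
  define x1 x2 xb1 y1 y2 ya1 yd1 e1 e2 where "x1 = max x 0" and "x2 = max (- x) 0" and "xb1 = max xb 0"
    and "y1 = max y 0" and "y2 = max (- y) 0" and "ya1 = max ya 0" and "yd1 = max yd 0"
    and "e1 = max e 0" and "e2 = max (- e) 0"
  define P Q Q' p q where "P = max (X + x + xb) 0" and "Q = max (xd + X + xa) 0"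
    and "Q' = max (xd + X + xa - e) 0" and "p = min 2 \<bar>xd + X + xa\<bar>" and "q = min 2 \<bar>yd + Y + ya\<bar>"
  note D = x1_def[symmetric] x2_def[symmetric] xb1_def[symmetric] y1_def[symmetric] y2_def[symmetric]
    ya1_def[symmetric] yd1_def[symmetric] e1_def[symmetric] e2_def[symmetric]
    P_def[symmetric] Q_def[symmetric] Q'_def[symmetric] p_def[symmetric] q_def[symmetric]
  have nonneg: "0 \<le> x1" "0 \<le> x2" "0 \<le> y1" "0 \<le> y2" "0 \<le> ya1" "0 \<le> yd1" "0 \<le> e1" "0 \<le> e2"
    by (simp_all add: x1_def x2_def y1_def y2_def ya1_def yd1_def e1_def e2_def)
  have "max (X + x + xb) 0 + \<kappa> \<le> 2 * max (- x) 0 + 3 * max x 0 + max xb 0 + 2 * max (- y) 0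
      + 2 * max y 0 + max ya 0 + max yd 0 + 4 * max e 0 + 4 * max (- e) 0"
    unfolding D
  proof (cases "e = 0")
    case True
    show "P + \<kappa> \<le> 2 * x2 + 3 * x1 + xb1 + 2 * y2 + 2 * y1 + ya1 + yd1 + 4 * e1 + 4 * e2"
      using k2[OF True, unfolded D] f_part2[unfolded D] g_part[unfolded D] nonneg by linarith
  next
    case False
    show "P + \<kappa> \<le> 2 * x2 + 3 * x1 + xb1 + 2 * y2 + 2 * y1 + ya1 + yd1 + 4 * e1 + 4 * e2"
      using k1[unfolded D] f_part[unfolded D] e_part(1)[unfolded D] e_part(2)[OF False, unfolded D] nonneg
      by linarith
  qed
  then have "real_of_int (max (X + x + xb) 0 + \<kappa>) \<le> real_of_int (2 * max (- x) 0 + 3 * max x 0 + max xb 0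
      + 2 * max (- y) 0 + 2 * max y 0 + max ya 0 + max yd 0 + 4 * max e 0 + 4 * max (- e) 0)"
    by (simp only: of_int_le_iff)
  then show ?thesis
    unfolding main_divisor_def zero_divisor_def pole_divisor_def F(2) defs
    by (simp only: of_int_add of_int_mult of_int_numeral)
qed

section \<open>The case of linear independence\<close>

lemma wr_cong: "fls_deriv x = fls_deriv x' \<Longrightarrow> fls_deriv y = fls_deriv y' \<Longrightarrow> wr x y = wr x' y'"
  by (simp add: wr_def)

text \<open>A common factor of three functions leaves their Wronskian with exponent 3: here 1,
  \<open>inverse y\<close>, \<open>t * inverse y\<close> are \<open>inverse y\<close> times
  \<open>y\<close>, 1, \<open>t\<close>.\<close>

lemma wr_inverse_mult:
  assumes "y \<noteq> 0"
  shows "wr (inverse y) (t * inverse y)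
    = (inverse y) ^ 3 * (fls_deriv (fls_deriv y) * fls_deriv t - fls_deriv y * fls_deriv (fls_deriv t))"
proof -
  define U where "U = inverse y"
  have d: "fls_deriv U = - fls_deriv y * U\<^sup>2" unfolding U_def by (rule fls_inverse_deriv)
  show ?thesis
    unfolding wr_def U_def[symmetric]
    by (simp add: d fls_deriv_power power2_eq_square power3_eq_cube algebra_simps)
qed

text \<open>\<open>\<kappa>\<close> is \<open>q - k - 2 * l\<close> minus the order of the
  Wronskian, so the latter is bounded below. Adding 1 to an argument replaces the order
  \<open>- k\<close> by \<open>p - k\<close>, or \<open>- l\<close> by \<open>q - l\<close>, and the
  better choice is taken. At a shared zero both arguments have a pole of the same order
  \<open>k\<close>; \<open>wr_inverse_mult\<close> then limits the pole of the Wronskian to order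
  \<open>3 * k\<close>, which is the pole order of the numerator.\<close>

lemma wronskian_local:
  assumes \<gamma>: "absval \<gamma> < R" and M: "F \<in> M" "G \<in> M" and nz: "F \<noteq> 0" "G \<noteq> 0" "F \<noteq> 1" "G \<noteq> 1"
    and W: "wr (inverse (F - 1)) (inverse (G - 1)) \<noteq> 0"
    and p: "p = ord \<gamma> F" and q: "q = ord \<gamma> G" and k: "k = ord \<gamma> (F - 1)" and l: "l = ord \<gamma> (G - 1)"
    and \<kappa>: "\<kappa> = ord \<gamma> (G * inverse (F - 1) * (inverse (G - 1))\<^sup>2 / wr (inverse (F - 1)) (inverse (G - 1)))"
  shows "\<kappa> \<le> - max p 0 + 3"
    and "(k = l \<and> k > 0) \<or> (k \<le> 0 \<and> l \<le> 0) \<Longrightarrow> \<kappa> \<le> - max p 0 + min 2 \<bar>p\<bar> + min 2 \<bar>q\<bar>"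
proof -
  define U V where "U = inverse (F - 1)" and "V = inverse (G - 1)"
  have F1: "F - 1 \<noteq> 0" "F - 1 \<in> M" and G1: "G - 1 \<noteq> 0" "G - 1 \<in> M"
    using nz M by (auto intro: mero_diff)
  have UM: "U \<in> M" "U \<noteq> 0" "V \<in> M" "V \<noteq> 0"
    using F1 G1 by (auto simp: U_def V_def intro: mero_inverse)
  have oU: "ord \<gamma> U = - k" "ord \<gamma> V = - l"
    using F1 G1 \<gamma> by (simp_all add: U_def V_def k l ord_inverse)
  have U1: "1 + U = F * U" "1 + V = G * V" using F1 G1 by (simp_all add: U_def V_def field_simps)
  have o1: "ord \<gamma> (1 + U) = p - k" "ord \<gamma> (1 + V) = q - l"
    unfolding U1 using UM M nz \<gamma> by (simp_all add: ord_mult oU p q)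
  define Om where "Om = ord \<gamma> (wr U V)"
  have W': "wr U V \<noteq> 0" using W by (simp add: U_def V_def)
  have \<kappa>': "\<kappa> = q - k - 2 * l - Om"
    unfolding \<kappa> Om_def U_def[symmetric] V_def[symmetric] using UM M nz W' \<gamma> wr_mero[OF UM(1,3)]
    by (simp add: ord_divide ord_mult ord_power mero_mult mero_power oU q)
  have shift: "p < 0 \<Longrightarrow> k = p" "p > 0 \<Longrightarrow> k = 0" "p \<ge> 0 \<Longrightarrow> k \<ge> 0"
    using ord_sub_const[OF M(1) \<gamma>, of 1] nz by (auto simp: p k)
  have shift': "q < 0 \<Longrightarrow> l = q" "q > 0 \<Longrightarrow> l = 0" "q \<ge> 0 \<Longrightarrow> l \<ge> 0"
    using ord_sub_const[OF M(2) \<gamma>, of 1] nz by (auto simp: q l)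
  have vU: "vge \<gamma> (- k) U" "vge \<gamma> (p - k) (1 + U)" "vge \<gamma> (- l) V" "vge \<gamma> (q - l) (1 + V)"
    using UM oU o1 by (auto simp: vge_def intro: mero_add)
  have wr_eq: "wr (1 + U) V = wr U V" "wr U (1 + V) = wr U V" "wr (1 + U) (1 + V) = wr U V"
    by (rule wr_cong; simp)+
  have Om_ge: "m \<le> Om" if "vge \<gamma> m (wr U V)" for m using that W' by (simp add: vge_def Om_def)
  have B3: "- k - l - 3 \<le> Om" "- k + (q - l) - 3 \<le> Om" "(p - k) - l - 3 \<le> Om" "(p - k) + (q - l) - 3 \<le> Om"
    using wr_vge(1)[OF \<gamma> vU(1,3)] wr_vge(1)[OF \<gamma> vU(1,4)] wr_vge(1)[OF \<gamma> vU(2,3)] wr_vge(1)[OF \<gamma> vU(2,4)]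
    unfolding wr_eq by (auto dest: Om_ge)
  show "\<kappa> \<le> - max p 0 + 3"
    unfolding \<kappa>' using B3 shift' by (cases "q < 0"; cases "q > 0"; cases "p \<ge> 0") auto
  assume "(k = l \<and> k > 0) \<or> (k \<le> 0 \<and> l \<le> 0)"
  then show "\<kappa> \<le> - max p 0 + min 2 \<bar>p\<bar> + min 2 \<bar>q\<bar>"
  proof
    assume kl: "k = l \<and> k > 0"
    then have pq: "p = 0" "q = 0" using shift shift' by (auto simp: not_less[symmetric]) (metis linorder_neqE not_less_iff_gr_or_eq)+
    define t where "t = V / U"
    have t: "vge \<gamma> 0 t" unfolding vge_def t_def using UM \<gamma> oU kl by (simp add: ord_divide mero_divide)
    have y: "vge \<gamma> 0 (F - 1)" using F1 kl k by (simp add: vge_def)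
    have "wr U V = wr (inverse (F - 1)) (t * inverse (F - 1))"
      using UM by (simp add: t_def U_def[symmetric])
    also have "\<dots> = U ^ 3 * (fls_deriv (fls_deriv (F - 1)) * fls_deriv t - fls_deriv (F - 1) * fls_deriv (fls_deriv t))"
      unfolding wr_inverse_mult[OF F1(1)] by (simp only: U_def)
    finally have eq: "wr U V = U ^ 3 * (fls_deriv (fls_deriv (F - 1)) * fls_deriv t - fls_deriv (F - 1) * fls_deriv (fls_deriv t))" .
    have "vge \<gamma> (- 3 * k) (U ^ 3)"
      unfolding vge_def using UM \<gamma> oU by (simp add: ord_power mero_power)
    moreover have "vge \<gamma> (0 + 0) (fls_deriv (fls_deriv (F - 1)) * fls_deriv t - fls_deriv (F - 1) * fls_deriv (fls_deriv t))"
      using y t vge_deriv_nonneg[OF \<gamma>] by (intro vge_diff[OF \<gamma>] vge_mult[OF \<gamma>]) blast+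
    ultimately have "vge \<gamma> (- 3 * k + (0 + 0)) (wr U V)" unfolding eq by (rule vge_mult[OF \<gamma>])
    then have "- 3 * k \<le> Om" by (auto dest: Om_ge)
    then show ?thesis unfolding \<kappa>' using kl pq by simp
  next
    assume kl: "k \<le> 0 \<and> l \<le> 0"
    \<comment> \<open>At a pole of \<open>F\<close> the function \<open>U\<close> itself vanishes to
      order \<open>\<bar>p\<bar>\<close>; otherwise \<open>k = 0\<close> and
      \<open>1 + U = F * U\<close> vanishes to order \<open>p\<close>.\<close>
    define x where "x = (if p < 0 then U else 1 + U)"
    define y where "y = (if q < 0 then V else 1 + V)"
    have "p \<ge> 0 \<Longrightarrow> k = 0" "q \<ge> 0 \<Longrightarrow> l = 0" using shift(3) shift'(3) kl by auto
    then have x: "vge \<gamma> \<bar>p\<bar> x" and y: "vge \<gamma> \<bar>q\<bar> y"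
      using vU shift(1) shift'(1) by (auto simp: x_def y_def)
    have "wr x y = wr U V" using wr_eq by (simp add: x_def y_def)
    then have "max (\<bar>p\<bar> - 2) 0 + max (\<bar>q\<bar> - 2) 0 \<le> Om"
      using wr_vge(2)[OF \<gamma> x y] by (auto dest: Om_ge)
    then show ?thesis
      unfolding \<kappa>' using shift(1) shift'(1) \<open>p \<ge> 0 \<Longrightarrow> k = 0\<close> \<open>q \<ge> 0 \<Longrightarrow> l = 0\<close>
      by (cases "p < 0"; cases "q < 0") auto
  qed
qed

text \<open>With \<open>U\<close> and \<open>V\<close> as below, \<open>h\<close> is
  \<open>U * ((1 + V) * V)\<close> over the Wronskian, so \<open>wr_nrm_le\<close> bounds its norm
  below by a constant. Replacing \<open>U\<close> by \<open>1 + U = F * U\<close>, which leaves the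
  Wronskian unchanged, gives the second lower bound, a multiple of
  \<open>1 / nrm r F\<close>.\<close>

lemma wronskian_log_le:
  assumes M: "F \<in> M" "G \<in> M" and nz: "F \<noteq> 0" "G \<noteq> 0" "F \<noteq> 1" "G \<noteq> 1"
    and W: "wr (inverse (F - 1)) (inverse (G - 1)) \<noteq> 0"
    and h: "h = G * inverse (F - 1) * (inverse (G - 1))\<^sup>2 / wr (inverse (F - 1)) (inverse (G - 1))"
  shows "h \<in> M" "h \<noteq> 0" "(\<lambda>r. max 0 (- ln (nrm r F))) \<lesssim> (\<lambda>r. counting \<rho> r (ordr h))"
proof -
  define U V where "U = inverse (F - 1)" and "V = inverse (G - 1)"
  have F1: "F - 1 \<noteq> 0" "F - 1 \<in> M" and G1: "G - 1 \<noteq> 0" "G - 1 \<in> M"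
    using nz M by (auto intro: mero_diff)
  have UM: "U \<in> M" "U \<noteq> 0" "V \<in> M" "V \<noteq> 0"
    using F1 G1 by (auto simp: U_def V_def intro: mero_inverse)
  have U1: "1 + U = F * U" "1 + V = G * V" using F1 G1 by (simp_all add: U_def V_def field_simps)
  have W': "wr U V \<noteq> 0" using W by (simp add: U_def V_def)
  have WM: "wr U V \<in> M" by (rule wr_mero[OF UM(1,3)])
  have h': "h = U * ((1 + V) * V) / wr U V" unfolding h U1 U_def[symmetric] V_def[symmetric]
    by (simp add: power2_eq_square mult_ac)
  have VM: "1 + V \<in> M" "(1 + V) * V \<in> M" "U * ((1 + V) * V) \<in> M" using UM by (auto intro: mero_intros)
  show hM: "h \<in> M" "h \<noteq> 0" unfolding h' using VM WM W' UM M nz by (auto simp: U1 intro: mero_divide)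
  define c where "c = 1 / \<rho> ^ 3"
  have "(\<lambda>r. max 0 (ln (1 / nrm r F))) \<lesssim> (\<lambda>r. counting \<rho> r (ordr h))"
  proof (rule log_le_counting[OF hM])
    show "c > 0" using \<rho> by (simp add: c_def)
    fix r assume r: "\<rho> < r" "r < R"
    note I = r_pos[OF r(1)] r(2)
    have pos: "nrm r F > 0" "nrm r U > 0" "nrm r V > 0" "nrm r (wr U V) > 0" "nrm r G > 0"
      using nrm_pos[OF I] M nz UM W' WM by auto
    show "1 / nrm r F > 0" using pos by simp
    have nh: "nrm r h = nrm r U * (nrm r (1 + V) * nrm r V) / nrm r (wr U V)"
      unfolding h' using VM WM UM by (simp add: nrm_divide[OF I] nrm_mult[OF I])
    have V1: "nrm r (1 + V) > 0" unfolding U1 using pos UM M by (simp add: nrm_mult[OF I])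
    have r3: "1 / r ^ 3 \<le> c" unfolding c_def using r \<rho> by (intro divide_left_mono power_mono) auto
    have A: "nrm r (wr U V) \<le> c * (nrm r x * nrm r V * nrm r (1 + V))"
      if x: "x \<in> M" "wr x V = wr U V" for x
    proof -
      have "nrm r (wr U V) \<le> nrm r x * nrm r V * nrm r (1 + V) / r ^ 3"
        using wr_nrm_le[OF x(1) UM(3) r] x(2) by simp
      also have "\<dots> = 1 / r ^ 3 * (nrm r x * nrm r V * nrm r (1 + V))" by simp
      also have "\<dots> \<le> c * (nrm r x * nrm r V * nrm r (1 + V))"
        using r3 pos V1 nrm_nonneg[OF I x(1)] by (intro mult_right_mono mult_nonneg_nonneg) auto
      finally show ?thesis .
    qed
    show "1 \<le> c * nrm r h" unfolding nh using A[OF UM(1) refl] pos by (simp add: pos_le_divide_eq mult_ac)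
    have "wr (1 + U) V = wr U V" by (rule wr_cong) simp_all
    then have "nrm r (wr U V) \<le> c * (nrm r F * nrm r U * nrm r V * nrm r (1 + V))"
      using A[of "1 + U"] UM M by (simp add: U1(1) nrm_mult[OF I] mero_mult)
    then show "1 / nrm r F \<le> c * nrm r h"
      unfolding nh using pos by (simp add: pos_le_divide_eq pos_divide_le_eq mult_ac)
  qed
  moreover have "(\<lambda>r. max 0 (- ln (nrm r F))) \<lesssim> (\<lambda>r. max 0 (ln (1 / nrm r F)))"
  proof (rule le_up_to_constI[where C = 0])
    fix r assume r: "\<rho> < r" "r < R"
    show "max 0 (- ln (nrm r F)) \<le> max 0 (ln (1 / nrm r F)) + 0"
      using nrm_pos[OF r_pos[OF r(1)] r(2) M(1) nz(1)] by (simp add: ln_div)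
  qed
  ultimately show "(\<lambda>r. max 0 (- ln (nrm r F))) \<lesssim> (\<lambda>r. counting \<rho> r (ordr h))"
    using le_up_to_const_trans by blast
qed

text \<open>\<open>nat\<close> discards poles. A vanishing difference has order 0 here but infinite
  multiplicity in \<open>zero_mult\<close>, so this condition follows from \<open>share_CM\<close>
  once neither difference is zero.\<close>

definition shares :: "'k fls \<Rightarrow> 'k fls \<Rightarrow> bool" where
  "shares f g \<longleftrightarrow> (\<forall>\<gamma>. absval \<gamma> < R \<longrightarrow> nat (ord \<gamma> (Phi f - \<alpha>)) = nat (ord \<gamma> (Phi g - \<alpha>)))"

lemma quotient_facts:
  assumes "nonconst f"
  shows "Phi f / \<alpha> \<in> M" "Phi f / \<alpha> \<noteq> 0"
    and "absval \<gamma> < R \<Longrightarrow> ord \<gamma> (Phi f / \<alpha>) = ord \<gamma> (Phi f) - ord \<gamma> \<alpha>"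
    and "absval \<gamma> < R \<Longrightarrow> Phi f / \<alpha> \<noteq> 1 \<Longrightarrow> ord \<gamma> (Phi f / \<alpha> - 1) = ord \<gamma> (Phi f - \<alpha>) - ord \<gamma> \<alpha>"
proof -
  note P = Phi_mero[OF nonconstD(1)[OF assms]] Phi_nonzero[OF assms]
  show "Phi f / \<alpha> \<in> M" "Phi f / \<alpha> \<noteq> 0" using P \<alpha> by (auto intro: mero_divide)
  show "absval \<gamma> < R \<Longrightarrow> ord \<gamma> (Phi f / \<alpha>) = ord \<gamma> (Phi f) - ord \<gamma> \<alpha>"
    using P \<alpha> by (simp add: ord_divide)
  assume "absval \<gamma> < R" "Phi f / \<alpha> \<noteq> 1"
  moreover have "Phi f / \<alpha> - 1 = (Phi f - \<alpha>) / \<alpha>" using \<alpha> by (simp add: diff_divide_distrib)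
  ultimately show "ord \<gamma> (Phi f / \<alpha> - 1) = ord \<gamma> (Phi f - \<alpha>) - ord \<gamma> \<alpha>"
    using P \<alpha> by (simp add: ord_divide mero_diff)
qed

lemma main_inequality_wronskian:
  assumes f: "nonconst f" and g: "nonconst g" and ne: "Phi f / \<alpha> \<noteq> 1" "Phi g / \<alpha> \<noteq> 1"
    and sh: "shares f g"
    and W: "wr (inverse (Phi f / \<alpha> - 1)) (inverse (Phi g / \<alpha> - 1)) \<noteq> 0"
  shows "(\<lambda>r. real (n + 2) * T r f) \<lesssim> (\<lambda>r. 6 * T r f + 7 * T r g + 9 * T r \<alpha>)"
proof -
  note F = quotient_facts[OF f] and G = quotient_facts[OF g]
  note w = wronskian_log_le[OF F(1) G(1) F(2) G(2) ne W refl]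
  show ?thesis
  proof (rule main_inequalityI[OF f g w])
    fix \<gamma> :: 'k assume \<gamma>: "absval \<gamma> < R"
    note l = wronskian_local[OF \<gamma> F(1) G(1) F(2) G(2) ne W refl refl refl refl refl]
    have "nat (ord \<gamma> (Phi f - \<alpha>)) = nat (ord \<gamma> (Phi g - \<alpha>))" using sh \<gamma> by (simp add: shares_def)
    then have cm: "ord \<gamma> \<alpha> = 0 \<Longrightarrow> (ord \<gamma> (Phi f / \<alpha> - 1) = ord \<gamma> (Phi g / \<alpha> - 1) \<and> ord \<gamma> (Phi f / \<alpha> - 1) > 0)
        \<or> (ord \<gamma> (Phi f / \<alpha> - 1) \<le> 0 \<and> ord \<gamma> (Phi g / \<alpha> - 1) \<le> 0)"
      using F(4)[OF \<gamma> ne(1)] G(4)[OF \<gamma> ne(2)] by linarith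
    show "zero_divisor R (Psi f) \<gamma> + ordr (Phi g / \<alpha> * inverse (Phi f / \<alpha> - 1) * (inverse (Phi g / \<alpha> - 1))\<^sup>2
        / wr (inverse (Phi f / \<alpha> - 1)) (inverse (Phi g / \<alpha> - 1))) \<gamma> \<le> main_divisor f g \<gamma>"
    proof (rule main_divisor_local[OF f g \<gamma>])
      show "ord \<gamma> (Phi g / \<alpha> * inverse (Phi f / \<alpha> - 1) * (inverse (Phi g / \<alpha> - 1))\<^sup>2
        / wr (inverse (Phi f / \<alpha> - 1)) (inverse (Phi g / \<alpha> - 1))) \<le> - max (ord \<gamma> (Phi f) - ord \<gamma> \<alpha>) 0 + 3"
        using l(1) unfolding F(3)[OF \<gamma>] .
      assume e: "ord \<gamma> \<alpha> = 0"
      show "ord \<gamma> (Phi g / \<alpha> * inverse (Phi f / \<alpha> - 1) * (inverse (Phi g / \<alpha> - 1))\<^sup>2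
        / wr (inverse (Phi f / \<alpha> - 1)) (inverse (Phi g / \<alpha> - 1)))
        \<le> - max (ord \<gamma> (Phi f)) 0 + min 2 \<bar>ord \<gamma> (Phi f)\<bar> + min 2 \<bar>ord \<gamma> (Phi g)\<bar>"
        using l(2)[OF cm[OF e]] unfolding F(3)[OF \<gamma>] G(3)[OF \<gamma>] e by simp
    qed
  qed
qed

section \<open>The case of a value of \<open>F\<close> taken only at zeros and poles of
  \<open>G\<close>\<close>

lemma three_values_local:
  assumes M: "F \<in> M" "fls_deriv F \<noteq> 0" and \<gamma>: "absval \<gamma> < R" and s: "s \<noteq> 0"
  shows "ord \<gamma> F < 0 \<Longrightarrow> ord \<gamma> ((F - fls_const s) / fls_deriv F) = 1"
    and "ord \<gamma> F > 0 \<Longrightarrow> ord \<gamma> ((F - fls_const s) / fls_deriv F) = 1 - ord \<gamma> F"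
    and "ord \<gamma> F = 0 \<Longrightarrow> ord \<gamma> (F - fls_const s) > 0 \<Longrightarrow> ord \<gamma> ((F - fls_const s) / fls_deriv F) = 1"
    and "ord \<gamma> F = 0 \<Longrightarrow> ord \<gamma> (F - fls_const s) \<le> 0 \<Longrightarrow> ord \<gamma> ((F - fls_const s) / fls_deriv F) \<le> 0"
proof -
  have F: "F \<noteq> 0" "F \<noteq> fls_const s" "F - fls_const s \<noteq> 0" "F - fls_const s \<in> M"
    using M by (auto intro: mero_diff)
  have o: "ord \<gamma> ((F - fls_const s) / fls_deriv F) = ord \<gamma> (F - fls_const s) - ord \<gamma> (fls_deriv F)"
    using F M \<gamma> by (simp add: ord_divide mero_deriv)
  note sc = ord_sub_const[OF M(1) \<gamma> F(2)]
  show "ord \<gamma> F < 0 \<Longrightarrow> ord \<gamma> ((F - fls_const s) / fls_deriv F) = 1"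
    unfolding o using sc(1) ord_deriv(1)[OF M(1) \<gamma>] by simp
  show "ord \<gamma> F > 0 \<Longrightarrow> ord \<gamma> ((F - fls_const s) / fls_deriv F) = 1 - ord \<gamma> F"
    unfolding o using sc(2)[OF _ s] ord_deriv(1)[OF M(1) \<gamma>] by simp
  show "ord \<gamma> F = 0 \<Longrightarrow> ord \<gamma> (F - fls_const s) > 0 \<Longrightarrow> ord \<gamma> ((F - fls_const s) / fls_deriv F) = 1"
    unfolding o using ord_deriv(1)[OF F(4) \<gamma>] by simp
  show "ord \<gamma> F = 0 \<Longrightarrow> ord \<gamma> (F - fls_const s) \<le> 0 \<Longrightarrow> ord \<gamma> ((F - fls_const s) / fls_deriv F) \<le> 0"
    unfolding o using ord_deriv_nonneg[OF M(1) \<gamma>] by simp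
qed

text \<open>Where \<open>\<alpha>\<close> has order 0, the excess 1 at a point with value
  \<open>s\<close> is covered by the truncated order of \<open>Phi g\<close>, because
  \<open>Phi g / \<alpha>\<close> has a zero or pole there; the excess 1 at zeros and poles of
  \<open>Phi f\<close> is covered by its own truncated order.\<close>

lemma main_inequality_omitted:
  assumes f: "nonconst f" and g: "nonconst g" and d: "fls_deriv (Phi f / \<alpha>) \<noteq> 0" and s: "s \<noteq> 0"
    and om: "\<And>\<gamma>. absval \<gamma> < R \<Longrightarrow> ord \<gamma> (Phi f / \<alpha> - fls_const s) > 0 \<Longrightarrow> ord \<gamma> (Phi g / \<alpha>) \<noteq> 0"
  shows "(\<lambda>r. real (n + 2) * T r f) \<lesssim> (\<lambda>r. 6 * T r f + 7 * T r g + 9 * T r \<alpha>)"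
proof -
  note F = quotient_facts[OF f] and G = quotient_facts[OF g]
  define h where "h = (Phi f / \<alpha> - fls_const s) / fls_deriv (Phi f / \<alpha>)"
  have h: "h \<in> M" "h \<noteq> 0" unfolding h_def using F(1) d by (auto intro: mero_intros)
  show ?thesis
  proof (rule main_inequalityI[OF f g h])
    show "(\<lambda>r. max 0 (- ln (nrm r (Phi f / \<alpha>)))) \<lesssim> (\<lambda>r. counting \<rho> r (ordr h))"
      unfolding h_def by (rule three_values(1)[OF F(1) d s])
    fix \<gamma> :: 'k assume \<gamma>: "absval \<gamma> < R"
    note l = three_values_local[OF F(1) d \<gamma> s, folded h_def]
    show "zero_divisor R (Psi f) \<gamma> + ordr h \<gamma> \<le> main_divisor f g \<gamma>"
    proof (rule main_divisor_local[OF f g \<gamma>])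
      consider "ord \<gamma> (Phi f / \<alpha>) < 0" | "ord \<gamma> (Phi f / \<alpha>) > 0"
        | "ord \<gamma> (Phi f / \<alpha>) = 0" "ord \<gamma> (Phi f / \<alpha> - fls_const s) > 0"
        | "ord \<gamma> (Phi f / \<alpha>) = 0" "ord \<gamma> (Phi f / \<alpha> - fls_const s) \<le> 0" by linarith
      note cs = this
      show "ord \<gamma> h \<le> - max (ord \<gamma> (Phi f) - ord \<gamma> \<alpha>) 0 + 3"
        unfolding F(3)[OF \<gamma>, symmetric] by (cases rule: cs) (use l in auto)
      assume e: "ord \<gamma> \<alpha> = 0"
      have eq: "ord \<gamma> (Phi f) = ord \<gamma> (Phi f / \<alpha>)" "ord \<gamma> (Phi g) = ord \<gamma> (Phi g / \<alpha>)"
        using F(3)[OF \<gamma>] G(3)[OF \<gamma>] e by auto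
      show "ord \<gamma> h \<le> - max (ord \<gamma> (Phi f)) 0 + min 2 \<bar>ord \<gamma> (Phi f)\<bar> + min 2 \<bar>ord \<gamma> (Phi g)\<bar>"
        unfolding eq by (cases rule: cs) (use l om[OF \<gamma>] in auto)
    qed
  qed
qed

section \<open>The case of linear dependence\<close>

lemma wr_zero_imp_affine:
  assumes "wr x y = 0" "fls_deriv x \<noteq> 0"
  obtains c d where "y = fls_const c * x + fls_const d"
proof -
  have "fls_deriv (fls_deriv y / fls_deriv x) = 0"
    using assms by (simp add: fls_deriv_quotient wr_def mult.commute)
  then obtain c where "fls_deriv y / fls_deriv x = fls_const c" unfolding fls_deriv_eq_0_iff by blast
  then have "fls_deriv y = fls_const c * fls_deriv x" using assms(2) by (simp add: field_simps)
  then have "fls_deriv (y - fls_const c * x) = 0" by simp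
  then obtain d where "y - fls_const c * x = fls_const d" unfolding fls_deriv_eq_0_iff by blast
  then have "y = fls_const c * x + fls_const d" by (simp add: algebra_simps)
  then show ?thesis using that by blast
qed

text \<open>A vanishing Wronskian gives
  \<open>G * (e * F + c - e) = (e + 1) * F + (c - e - 1)\<close> with constants
  \<open>c \<noteq> 0\<close> and \<open>e\<close>. A nonzero root of the denominator or of the
  numerator of this transformation serves as \<open>s\<close>; if neither has such a root, the
  transformation is the identity or the inversion.\<close>

lemma moebius_cases:
  assumes M: "F \<in> M" "G \<in> M" and d: "fls_deriv F \<noteq> 0" "fls_deriv G \<noteq> 0"
    and W: "wr (inverse (F - 1)) (inverse (G - 1)) = 0"
  obtains "F = G" | "F * G = 1"
    | s where "s \<noteq> 0" "\<And>\<gamma>. absval \<gamma> < R \<Longrightarrow> ord \<gamma> (F - fls_const s) > 0 \<Longrightarrow> ord \<gamma> G \<noteq> 0"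
proof -
  have nz: "F \<noteq> 0" "G \<noteq> 0" "F - 1 \<noteq> 0" "G - 1 \<noteq> 0" using d by auto
  have dU: "fls_deriv (inverse (F - 1)) \<noteq> 0" "fls_deriv (inverse (G - 1)) \<noteq> 0"
    using d nz by (simp_all add: fls_inverse_deriv)
  obtain c e where "inverse (G - 1) = fls_const c * inverse (F - 1) + fls_const e"
    using wr_zero_imp_affine[OF W dU(1)] by blast
  note V = this
  have c: "c \<noteq> 0"
  proof
    assume "c = 0"
    then show False using dU(2) unfolding V by simp
  qed
  have clear: "p = C * q + E * p * q" if "inverse q = C * inverse p + E" "p \<noteq> 0" "q \<noteq> 0" for p q C E :: "'k fls"
  proof -
    have "p = p * q * inverse q" using that(3) by simp
    also have "\<dots> = C * q * (p * inverse p) + E * p * q" unfolding that(1) by (simp only: distrib_left mult_ac)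
    finally show ?thesis using that(2) by simp
  qed
  have "F - 1 = fls_const c * (G - 1) + fls_const e * (F - 1) * (G - 1)"
    by (rule clear[OF V nz(3,4)])
  then have eq: "G * (fls_const e * F + (fls_const c - fls_const e)) = (fls_const e + 1) * F + (fls_const c - fls_const e - 1)"
    by (simp add: algebra_simps)
  have ordc: "ord \<gamma> (fls_const x * E + fls_const y) = 0 \<and> fls_const x * E + fls_const y \<noteq> 0"
    if "E \<in> M" "ord \<gamma> E > 0" "y \<noteq> 0" "absval \<gamma> < R" for x y E \<gamma>
  proof -
    have E0: "E \<noteq> 0" using that by auto
    have "fls_const x * E \<noteq> 0 \<Longrightarrow> ord \<gamma> (fls_const y) < ord \<gamma> (fls_const x * E)"
      using that E0 by (simp add: ord_mult)
    moreover have "fls_const x * E \<in> M" using that by (intro mero_mult mero_const)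
    ultimately have "ord \<gamma> (fls_const y + fls_const x * E) = ord \<gamma> (fls_const y)" "fls_const y + fls_const x * E \<noteq> 0"
      using ord_add_eq[of "fls_const y" "fls_const x * E" \<gamma>] that by auto
    then show ?thesis using that by (simp add: add.commute)
  qed
  have EM: "F - fls_const s \<in> M" for s using M by (intro mero_intros)
  consider "e \<noteq> 0" "c \<noteq> e" | "e \<noteq> -1" "c \<noteq> e + 1" | "e = 0" "c = 1" | "c = e" "e = -1" by fastforce
  then show ?thesis
  proof cases
    case 1
    define s where "s = (e - c) / e"
    show ?thesis
    proof (rule that(3))
      show "s \<noteq> 0" using 1 by (simp add: s_def)
      fix \<gamma> :: 'k assume \<gamma>: "absval \<gamma> < R" and o: "ord \<gamma> (F - fls_const s) > 0"
      define E where "E = F - fls_const s"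
      have E: "E \<in> M" "E \<noteq> 0" "ord \<gamma> E > 0" using EM o by (auto simp: E_def)
      have es: "fls_const e * fls_const s = fls_const e - fls_const c"
        unfolding fls_const_mult_const fls_minus_const using 1 by (simp add: s_def)
      \<comment> \<open>The constant \<open>- c / e\<close> is the value of the numerator at the
        root \<open>s\<close> of the denominator; as it is nonzero, the pole of \<open>G\<close>
        does not cancel.\<close>
      have y: "fls_const (- c / e) = (fls_const e + 1) * fls_const s + (fls_const c - fls_const e - 1)"
      proof -
        have "- c / e = (e + 1) * s + (c - e - 1)" using 1 by (simp add: s_def field_simps)
        then have "fls_const (- c / e) = fls_const ((e + 1) * s + (c - e - 1))" by (rule arg_cong)
        also have "\<dots> = (fls_const e + 1) * fls_const s + (fls_const c - fls_const e - 1)"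
          by (simp flip: fls_plus_const fls_minus_const fls_const_mult_const)
        finally show ?thesis .
      qed
      have FE: "F = E + fls_const s" by (simp add: E_def)
      have "G * (fls_const e * E) = fls_const (e + 1) * E + fls_const (- c / e)"
      proof -
        have "fls_const e * F + (fls_const c - fls_const e) = fls_const e * E"
          unfolding FE distrib_left es by simp
        moreover have "(fls_const e + 1) * F + (fls_const c - fls_const e - 1) = fls_const (e + 1) * E + fls_const (- c / e)"
          unfolding FE y distrib_left by (simp flip: fls_plus_const)
        ultimately show ?thesis using eq by simp
      qed
      moreover have "ord \<gamma> (G * (fls_const e * E)) = ord \<gamma> G + ord \<gamma> E"
        using E M nz \<gamma> 1 by (simp add: ord_mult mero_mult)
      moreover have "ord \<gamma> (fls_const (e + 1) * E + fls_const (- c / e)) = 0"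
        using ordc[OF E(1,3) _ \<gamma>, of "- c / e" "e + 1"] c 1 by simp
      ultimately show "ord \<gamma> G \<noteq> 0" using E by simp
    qed
  next
    case 2
    have e1: "e + 1 \<noteq> 0" using 2 by (simp add: eq_neg_iff_add_eq_0)
    define s where "s = (e + 1 - c) / (e + 1)"
    show ?thesis
    proof (rule that(3))
      show "s \<noteq> 0" using 2 e1 by (simp add: s_def)
      fix \<gamma> :: 'k assume \<gamma>: "absval \<gamma> < R" and o: "ord \<gamma> (F - fls_const s) > 0"
      define E where "E = F - fls_const s"
      have E: "E \<in> M" "E \<noteq> 0" "ord \<gamma> E > 0" using EM o by (auto simp: E_def)
      have es: "(fls_const e + 1) * fls_const s = fls_const e + 1 - fls_const c"
      proof -
        have "(e + 1) * s = e + 1 - c" using e1 by (simp add: s_def)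
        then have "fls_const ((e + 1) * s) = fls_const (e + 1 - c)" by (rule arg_cong)
        then show ?thesis by (simp flip: fls_plus_const fls_minus_const fls_const_mult_const)
      qed
      \<comment> \<open>The constant \<open>c / (e + 1)\<close> is the value of the denominator at
        the root \<open>s\<close> of the numerator; as it is nonzero, \<open>G\<close> does have a
        zero.\<close>
      have y: "fls_const (c / (e + 1)) = fls_const e * fls_const s + (fls_const c - fls_const e)"
      proof -
        have "c / (e + 1) = e * s + (c - e)" using e1 by (simp add: s_def field_simps)
        then have "fls_const (c / (e + 1)) = fls_const (e * s + (c - e))" by (rule arg_cong)
        also have "\<dots> = fls_const e * fls_const s + (fls_const c - fls_const e)"
          by (simp flip: fls_plus_const fls_minus_const fls_const_mult_const)
        finally show ?thesis .
      qed
      have FE: "F = E + fls_const s" by (simp add: E_def)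
      have "G * (fls_const e * E + fls_const (c / (e + 1))) = fls_const (e + 1) * E"
      proof -
        have "fls_const e * F + (fls_const c - fls_const e) = fls_const e * E + fls_const (c / (e + 1))"
          unfolding FE y distrib_left by simp
        moreover have "(fls_const e + 1) * F + (fls_const c - fls_const e - 1) = fls_const (e + 1) * E"
          unfolding FE distrib_left es by (simp flip: fls_plus_const)
        ultimately show ?thesis using eq by simp
      qed
      moreover have "ord \<gamma> (fls_const (e + 1) * E) = ord \<gamma> E"
        using E \<gamma> e1 by (simp add: ord_mult)
      moreover have "ord \<gamma> (G * (fls_const e * E + fls_const (c / (e + 1)))) = ord \<gamma> G"
        using ordc[OF E(1,3) _ \<gamma>, of "c / (e + 1)" e] c e1 E M nz \<gamma>
        by (simp add: ord_mult mero_mult mero_add)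
      ultimately show "ord \<gamma> G \<noteq> 0" using E by simp
    qed
  next
    case 3
    then have "inverse (G - 1) = inverse (F - 1)" using V by simp
    then show ?thesis using that(1) by simp
  next
    case 4
    have "G * - F = - 1" using eq unfolding 4 by (simp add: fls_const_uminus[symmetric])
    then show ?thesis using that(2) by (simp add: mult.commute)
  qed
qed

lemma main_inequality:
  assumes f: "nonconst f" and g: "nonconst g" and d: "fls_deriv (Phi f / \<alpha>) \<noteq> 0" "fls_deriv (Phi g / \<alpha>) \<noteq> 0"
    and sh: "shares f g" and ne: "Phi f \<noteq> Phi g" "Phi f * Phi g \<noteq> \<alpha>\<^sup>2"
  shows "(\<lambda>r. real (n + 2) * T r f) \<lesssim> (\<lambda>r. 6 * T r f + 7 * T r g + 9 * T r \<alpha>)"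
proof (cases "wr (inverse (Phi f / \<alpha> - 1)) (inverse (Phi g / \<alpha> - 1)) = 0")
  case False
  have "Phi f / \<alpha> \<noteq> 1" "Phi g / \<alpha> \<noteq> 1" using d by auto
  then show ?thesis using main_inequality_wronskian[OF f g _ _ sh False] by blast
next
  case True
  note F = quotient_facts[OF f] and G = quotient_facts[OF g]
  show ?thesis
  proof (rule moebius_cases[OF F(1) G(1) d True])
    assume "Phi f / \<alpha> = Phi g / \<alpha>"
    then show ?thesis using ne \<alpha> by simp
  next
    assume "Phi f / \<alpha> * (Phi g / \<alpha>) = 1"
    then show ?thesis using ne \<alpha> by (simp add: power2_eq_square)
  next
    fix s assume "s \<noteq> 0" "\<And>\<gamma>. absval \<gamma> < R \<Longrightarrow> ord \<gamma> (Phi f / \<alpha> - fls_const s) > 0 \<Longrightarrow> ord \<gamma> (Phi g / \<alpha>) \<noteq> 0"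
    then show ?thesis by (rule main_inequality_omitted[OF f g d(1)])
  qed
qed

text \<open>If \<open>Phi f\<close> is a constant multiple of \<open>\<alpha>\<close>, then at a
  zero of \<open>f\<close> the order of \<open>Psi f\<close> exceeds that of \<open>\<alpha>\<close>
  by only 1. So \<open>Psi f\<close> has too few zeros for its growth, which later excludes constant
  quotients.\<close>

lemma constant_quotient:
  assumes f: "nonconst f" and d: "fls_deriv (Phi f / \<alpha>) = 0"
  shows "(\<lambda>r. real (n + 2) * T r f) \<lesssim> (\<lambda>r. 2 * T r f + 2 * T r \<alpha>)"
proof -
  note F = quotient_facts[OF f] and f' = nonconstD[OF f]
  obtain c where c: "Phi f / \<alpha> = fls_const c" using d unfolding fls_deriv_eq_0_iff by blast
  then have c0: "c \<noteq> 0" using F(2) by auto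
  obtain C1 where C1: "\<And>r. \<rho> < r \<Longrightarrow> r < R \<Longrightarrow>
      real (n + 2) * T r f \<le> Z r (Psi f) + max 0 (- ln (nrm r (Phi f / \<alpha>))) + T r \<alpha> + C1"
    using char_fun_le_Psi[OF f] unfolding le_up_to_const_def by blast
  obtain C2 where C2: "\<And>r. \<rho> < r \<Longrightarrow> r < R \<Longrightarrow> Z r (f - fls_const b) \<le> T r f + C2"
    using zeros_sub_const[OF f'(1,4)] unfolding le_up_to_const_def by blast
  show ?thesis
  proof (rule le_up_to_constI)
    fix r assume r: "\<rho> < r" "r < R"
    have M: "f - fls_const b \<in> M" using f' by (intro mero_intros)
    note lf = zero_divisor_locfin[OF f'(1)] zero_divisor_locfin[OF M] zero_divisor_locfin[OF \<alpha>(1)]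
    have "Z r (Psi f) \<le> counting \<rho> r (\<lambda>\<gamma>. zero_divisor R f \<gamma> + zero_divisor R (f - fls_const b) \<gamma> + zero_divisor R \<alpha> \<gamma>)"
    proof (intro counting_leI divisor_locfin_add lf r zero_divisor_locfin Psi_mero f')
      fix \<gamma> :: 'k assume \<gamma>: "absval \<gamma> < R"
      define X where "X = int n * ord \<gamma> f"
      note L = local_orders[OF f \<gamma>, folded X_def]
      have "ord \<gamma> (Phi f) = ord \<gamma> \<alpha>" using F(3)[OF \<gamma>] \<gamma> unfolding c by simp
      then have "max (ord \<gamma> (Psi f)) 0 \<le> max (ord \<gamma> f) 0 + max (ord \<gamma> (f - fls_const b)) 0 + max (ord \<gamma> \<alpha>) 0"
        using L by (cases "ord \<gamma> f < 0"; cases "ord \<gamma> f = 0") auto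
      then have "real_of_int (max (ord \<gamma> (Psi f)) 0) \<le> real_of_int (max (ord \<gamma> f) 0 + max (ord \<gamma> (f - fls_const b)) 0 + max (ord \<gamma> \<alpha>) 0)"
        by (simp only: of_int_le_iff)
      then show "zero_divisor R (Psi f) \<gamma> \<le> zero_divisor R f \<gamma> + zero_divisor R (f - fls_const b) \<gamma> + zero_divisor R \<alpha> \<gamma>"
        unfolding zero_divisor_def by (simp only: of_int_add)
    qed
    also have "\<dots> = Z r f + Z r (f - fls_const b) + Z r \<alpha>"
      using lf by (simp add: counting_add[OF _ _ r(2)] divisor_locfin_add)
    finally have "Z r (Psi f) \<le> Z r f + Z r (f - fls_const b) + Z r \<alpha>" .
    moreover have "max 0 (- ln (nrm r (Phi f / \<alpha>))) = max 0 (- ln (absval c))"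
      unfolding c nrm_const[OF r_pos[OF r(1)] r(2)] ..
    ultimately show "real (n + 2) * T r f \<le> (2 * T r f + 2 * T r \<alpha>) + (C1 + C2 + max 0 (- ln (absval c)))"
      using C1[OF r] C2[OF r] T_ge(1)[of r f] T_ge(1)[of r \<alpha>] by linarith
  qed
qed

section \<open>The case of product 1\<close>

definition defect :: "'k fls \<Rightarrow> 'k \<Rightarrow> int" where
  "defect f \<gamma> = max (- ord \<gamma> f) 0 + ord \<gamma> (f * (f - fls_const a) / fls_deriv f)"

text \<open>At zeros, poles and \<open>a\<close>-points of \<open>f\<close> the defect is 1,
  elsewhere it is minus the order of the derivative: the pointwise form of the second main theorem
  for 0, \<open>a\<close> and infinity.\<close>

lemma defect_local:
  assumes f: "nonconst f" and \<gamma>: "absval \<gamma> < R"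
  shows "defect f \<gamma> \<le> 1"
    and "ord \<gamma> (Phi f) < 0 \<Longrightarrow> ord \<gamma> f < 0 \<and> ord \<gamma> (Phi f) = int (n + 2) * ord \<gamma> f - 1"
    and "ord \<gamma> f > 0 \<Longrightarrow> ord \<gamma> (Phi f) = int (n + 1) * ord \<gamma> f - 1"
    and "ord \<gamma> f = 0 \<Longrightarrow> ord \<gamma> (f - fls_const a) > 0 \<Longrightarrow> ord \<gamma> (Phi f) = 2 * ord \<gamma> (f - fls_const a) - 1"
    and "ord \<gamma> f = 0 \<Longrightarrow> ord \<gamma> (f - fls_const a) = 0 \<Longrightarrow> defect f \<gamma> = - ord \<gamma> (Phi f)"
    and "ord \<gamma> f < 0 \<Longrightarrow> ord \<gamma> (Phi f) < 0"
proof -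
  note f' = nonconstD[OF f]
  have M: "f - fls_const a \<in> M" using f' by (intro mero_intros)
  have o: "ord \<gamma> (f * (f - fls_const a) / fls_deriv f) = ord \<gamma> f + ord \<gamma> (f - fls_const a) - ord \<gamma> (fls_deriv f)"
    using f' M \<gamma> by (simp add: ord_divide ord_mult mero_mult mero_deriv)
  define X where "X = int n * ord \<gamma> f"
  note L = local_orders[OF f \<gamma>, folded X_def]
  have X: "int (n + 2) * ord \<gamma> f = X + 2 * ord \<gamma> f" "int (n + 1) * ord \<gamma> f = X + ord \<gamma> f"
    by (simp_all add: X_def algebra_simps)
  show "defect f \<gamma> \<le> 1" unfolding defect_def o
    using L by (cases "ord \<gamma> f < 0"; cases "ord \<gamma> f = 0"; cases "ord \<gamma> (f - fls_const a) > 0") auto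
  show "ord \<gamma> (Phi f) < 0 \<Longrightarrow> ord \<gamma> f < 0 \<and> ord \<gamma> (Phi f) = int (n + 2) * ord \<gamma> f - 1"
    unfolding X using L by (cases "ord \<gamma> f < 0"; cases "ord \<gamma> f = 0") auto
  show "ord \<gamma> f > 0 \<Longrightarrow> ord \<gamma> (Phi f) = int (n + 1) * ord \<gamma> f - 1"
    unfolding X using L by auto
  show "ord \<gamma> f = 0 \<Longrightarrow> ord \<gamma> (f - fls_const a) > 0 \<Longrightarrow> ord \<gamma> (Phi f) = 2 * ord \<gamma> (f - fls_const a) - 1"
    using L by auto
  show "ord \<gamma> f = 0 \<Longrightarrow> ord \<gamma> (f - fls_const a) = 0 \<Longrightarrow> defect f \<gamma> = - ord \<gamma> (Phi f)"
    unfolding defect_def o using L by auto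
  show "ord \<gamma> f < 0 \<Longrightarrow> ord \<gamma> (Phi f) < 0" using L by auto
qed

text \<open>The orders of \<open>Phi f\<close> and \<open>Phi g\<close> are opposite. If both are 0,
  no defect is positive. Otherwise \<open>g\<close> has a pole of some order \<open>y\<close>. A
  zero of \<open>f\<close> of order \<open>x\<close> there requires
  \<open>(n + 1) * (x - y) = y + 2\<close>, so \<open>x > y \<ge> n - 1\<close> and
  \<open>x \<ge> 12\<close>; an \<open>a\<close>-point of order \<open>z\<close> requires
  \<open>2 * z = (n + 2) * y + 2\<close>, so \<open>z \<ge> 8\<close>; in the remaining case the
  defect of \<open>f\<close> is negative and offsets that of \<open>g\<close>. The weights fit
  because \<open>2 * 12 = 3 * 8 = 24\<close>, and two defects weighted by 12 amount to at most
  24.\<close>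

lemma product_one_local_aux:
  assumes f: "nonconst f" and g: "nonconst g" and \<gamma>: "absval \<gamma> < R"
    and 0: "ord \<gamma> (Phi f) + ord \<gamma> (Phi g) = 0" and pos: "ord \<gamma> (Phi f) \<ge> 0"
  shows "12 * (defect f \<gamma> + defect g \<gamma>) \<le> 2 * max (ord \<gamma> f) 0 + 3 * max (ord \<gamma> (f - fls_const a)) 0
    + 2 * max (ord \<gamma> g) 0 + 3 * max (ord \<gamma> (g - fls_const a)) 0"
proof -
  note F = defect_local[OF f \<gamma>] and G = defect_local[OF g \<gamma>]
  note LF = local_orders(3,4,5)[OF f \<gamma>] and LG = local_orders(3,4,5)[OF g \<gamma>]
  have nonneg: "0 \<le> 2 * max (ord \<gamma> f) 0 + 3 * max (ord \<gamma> (f - fls_const a)) 0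
      + 2 * max (ord \<gamma> g) 0 + 3 * max (ord \<gamma> (g - fls_const a)) 0"
    by (intro add_nonneg_nonneg mult_nonneg_nonneg) simp_all
  have linear: "12 * (d + d') \<le> 2 * u + 3 * v + 2 * w + 3 * x"
    if "d \<le> 1" "d' \<le> 1" "u \<ge> 0" "v \<ge> 0" "w \<ge> 0" "x \<ge> 0" "u \<ge> 12 \<or> v \<ge> 8" for d d' u v w x :: int
  proof -
    have "12 * (d + d') \<le> 24" using that(1,2) by simp
    moreover have "24 \<le> 2 * u + 3 * v" using that by auto
    moreover have "0 \<le> 2 * w + 3 * x" using that by simp
    ultimately show ?thesis by linarith
  qed
  show ?thesis
  proof (cases "ord \<gamma> (Phi f) = 0")
    case True
    have "ord \<gamma> h = 0 \<and> defect h \<gamma> \<le> 0" if h: "nonconst h" "ord \<gamma> (Phi h) = 0" for h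
    proof -
      note H = defect_local[OF h(1) \<gamma>] and LH = local_orders(3,4,5)[OF h(1) \<gamma>]
      have "\<not> ord \<gamma> h > 0"
      proof
        assume x: "ord \<gamma> h > 0"
        then have "int (n + 1) * ord \<gamma> h = 1" using H(3) h(2) by simp
        moreover have "int (n + 1) * ord \<gamma> h \<ge> int (n + 1) * 1" using x by (intro mult_left_mono) auto
        ultimately show False using n by simp
      qed
      moreover have "\<not> ord \<gamma> h < 0"
      proof
        assume "ord \<gamma> h < 0"
        then show False using H(6) h(2) by simp
      qed
      ultimately have x0: "ord \<gamma> h = 0" by simp
      moreover have "ord \<gamma> (h - fls_const a) = 0" using H(4)[OF x0] LH(3)[OF x0] h(2) by presburger
      ultimately show ?thesis using H(5) h(2) by simp
    qed
    from this[OF f True] this[OF g] 0 True have "12 * (defect f \<gamma> + defect g \<gamma>) \<le> 0" by simp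
    also note nonneg
    finally show ?thesis .
  next
    case False
    then have neg: "ord \<gamma> (Phi g) < 0" using 0 pos by simp
    define y where "y = - ord \<gamma> g"
    have y: "y > 0" and Gy: "ord \<gamma> (Phi g) = - (int (n + 2) * y) - 1" using G(2)[OF neg] by (auto simp: y_def)
    have Fy: "ord \<gamma> (Phi f) = int (n + 2) * y + 1" using Gy 0 by simp
    have n2: "int (n + 2) * y \<ge> int (n + 2) * 1" using y by (intro mult_left_mono) auto
    have xn: "\<not> ord \<gamma> f < 0"
    proof
      assume "ord \<gamma> f < 0"
      then show False using F(6) pos by simp
    qed
    show ?thesis
    proof (cases "ord \<gamma> f > 0")
      case True
      have "int (n + 1) * ord \<gamma> f - 1 = int (n + 2) * y + 1" using F(3)[OF True] Fy by simp
      then have eq: "int (n + 1) * (ord \<gamma> f - y) = y + 2" by (simp add: algebra_simps)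
      have "ord \<gamma> f - y > 0"
      proof (rule ccontr)
        assume "\<not> ?thesis"
        then have "int (n + 1) * (ord \<gamma> f - y) \<le> 0" by (intro mult_nonneg_nonpos) auto
        then show False using eq y by simp
      qed
      then have "int (n + 1) * (ord \<gamma> f - y) \<ge> int (n + 1) * 1" by (intro mult_left_mono) auto
      then have "int (n + 1) \<le> y + 2" unfolding eq by simp
      then have "ord \<gamma> f \<ge> 12" using n \<open>ord \<gamma> f - y > 0\<close> by linarith
      then show ?thesis using F(1) G(1) by (intro linear) simp_all
    next
      case False
      then have x0: "ord \<gamma> f = 0" using xn by simp
      show ?thesis
      proof (cases "ord \<gamma> (f - fls_const a) > 0")
        case True
        have "2 * ord \<gamma> (f - fls_const a) - 1 = int (n + 2) * y + 1" using F(4)[OF x0 True] Fy by simp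
        moreover have "int (n + 2) * y \<ge> 14" by (rule order_trans[OF _ n2]) (use n in simp)
        ultimately have "ord \<gamma> (f - fls_const a) \<ge> 8" by linarith
        then show ?thesis using F(1) G(1) by (intro linear) simp_all
      next
        case False
        then have "ord \<gamma> (f - fls_const a) = 0" using LF(3)[OF x0] by simp
        then have "defect f \<gamma> \<le> - 1" using F(5)[OF x0] \<open>ord \<gamma> (Phi f) \<noteq> 0\<close> pos by simp
        then have "12 * (defect f \<gamma> + defect g \<gamma>) \<le> 0" using G(1) by simp
        also note nonneg
        finally show ?thesis .
      qed
    qed
  qed
qed

lemma product_one_local:
  assumes f: "nonconst f" and g: "nonconst g" and \<gamma>: "absval \<gamma> < R" and 1: "Phi f * Phi g = \<alpha>\<^sup>2"
  shows "12 * (defect f \<gamma> + defect g \<gamma>) \<le> 2 * max (ord \<gamma> f) 0 + 3 * max (ord \<gamma> (f - fls_const a)) 0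
    + 2 * max (ord \<gamma> g) 0 + 3 * max (ord \<gamma> (g - fls_const a)) 0 + 24 * max (ord \<gamma> \<alpha>) 0 + 24 * max (- ord \<gamma> \<alpha>) 0"
proof (cases "ord \<gamma> \<alpha> = 0")
  case False
  have linear: "12 * (d + d') \<le> 2 * u + 3 * v + 2 * w + 3 * x + 24 * p + 24 * q"
    if "d \<le> 1" "d' \<le> 1" "u \<ge> 0" "v \<ge> 0" "w \<ge> 0" "x \<ge> 0" "p + q \<ge> 1" for d d' u v w x p q :: int
  proof -
    have "12 * (d + d') \<le> 24" using that(1,2) by simp
    moreover have "24 \<le> 24 * p + 24 * q" using that(7) by simp
    moreover have "0 \<le> 2 * u + 3 * v + 2 * w + 3 * x" using that(3-6) by simp
    ultimately show ?thesis by linarith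
  qed
  have "max (ord \<gamma> \<alpha>) 0 + max (- ord \<gamma> \<alpha>) 0 \<ge> 1" using False by simp
  then show ?thesis
    using defect_local(1)[OF f \<gamma>] defect_local(1)[OF g \<gamma>] by (intro linear) simp_all
next
  case True
  have "ord \<gamma> (Phi f) + ord \<gamma> (Phi g) = ord \<gamma> (\<alpha>\<^sup>2)"
    unfolding 1[symmetric] using Phi_mero Phi_nonzero nonconstD f g \<gamma> by (simp add: ord_mult)
  then have 0: "ord \<gamma> (Phi f) + ord \<gamma> (Phi g) = 0" using \<alpha> \<gamma> True by (simp add: ord_power)
  show ?thesis
  proof (cases "ord \<gamma> (Phi f) \<ge> 0")
    case pos: True
    show ?thesis using product_one_local_aux[OF f g \<gamma> 0 pos] True by simp
  next
    case False
    then show ?thesis using product_one_local_aux[OF g f \<gamma>] 0 True by simp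
  qed
qed

text \<open>This is \<open>three_values\<close> for the values 0, \<open>a\<close> and infinity with
  the pole count added to the proximity term.\<close>

lemma char_fun_defect:
  assumes f: "nonconst f"
  shows "(\<lambda>r. T r f) \<lesssim> (\<lambda>r. counting \<rho> r (\<lambda>\<gamma>. of_int (defect f \<gamma>)))"
    and "divisor_locfin R (\<lambda>\<gamma>. of_int (defect f \<gamma>))"
proof -
  note f' = nonconstD[OF f]
  define h where "h = f * (f - fls_const a) / fls_deriv f"
  have h: "h \<in> M" unfolding h_def using f' by (intro mero_intros)
  have eq: "(\<lambda>\<gamma>. of_int (defect f \<gamma>)) = (\<lambda>\<gamma>. pole_divisor R f \<gamma> + ordr h \<gamma>)"
    by (simp add: defect_def pole_divisor_def h_def)
  show "divisor_locfin R (\<lambda>\<gamma>. of_int (defect f \<gamma>))"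
    unfolding eq by (intro divisor_locfin_add pole_divisor_locfin ord_locfin f' h)
  obtain C1 where C1: "\<And>r. \<rho> < r \<Longrightarrow> r < R \<Longrightarrow> T r f \<le> N r f + max 0 (ln (nrm r f)) + C1"
    using char_fun_poles(1)[OF f'(1,3)] unfolding le_up_to_const_def by blast
  obtain C2 where C2: "\<And>r. \<rho> < r \<Longrightarrow> r < R \<Longrightarrow> max 0 (ln (nrm r f)) \<le> counting \<rho> r (ordr h) + C2"
    using three_values(2)[OF f'(1,2) a] unfolding le_up_to_const_def h_def by blast
  show "(\<lambda>r. T r f) \<lesssim> (\<lambda>r. counting \<rho> r (\<lambda>\<gamma>. of_int (defect f \<gamma>)))"
  proof (rule le_up_to_constI)
    fix r assume r: "\<rho> < r" "r < R"
    have "counting \<rho> r (\<lambda>\<gamma>. of_int (defect f \<gamma>)) = N r f + counting \<rho> r (ordr h)"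
      unfolding eq by (rule counting_add[OF pole_divisor_locfin[OF f'(1)] ord_locfin[OF h] r(2)])
    then show "T r f \<le> counting \<rho> r (\<lambda>\<gamma>. of_int (defect f \<gamma>)) + (C1 + C2)"
      using C1[OF r] C2[OF r] by linarith
  qed
qed

text \<open>Each function pays \<open>2 + 3\<close> out of 12, which leaves 7; the 48 consists of 24
  for the zeros and 24 for the poles of \<open>\<alpha>\<close>.\<close>

lemma product_one:
  assumes f: "nonconst f" and g: "nonconst g" and 1: "Phi f * Phi g = \<alpha>\<^sup>2"
  shows "(\<lambda>r. 7 * (T r f + T r g)) \<lesssim> (\<lambda>r. 48 * T r \<alpha>)"
proof -
  note f' = nonconstD[OF f] and g' = nonconstD[OF g]
  obtain C1 where C1: "\<And>r. \<rho> < r \<Longrightarrow> r < R \<Longrightarrow> T r f \<le> counting \<rho> r (\<lambda>\<gamma>. of_int (defect f \<gamma>)) + C1"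
    using char_fun_defect(1)[OF f] unfolding le_up_to_const_def by blast
  obtain C2 where C2: "\<And>r. \<rho> < r \<Longrightarrow> r < R \<Longrightarrow> T r g \<le> counting \<rho> r (\<lambda>\<gamma>. of_int (defect g \<gamma>)) + C2"
    using char_fun_defect(1)[OF g] unfolding le_up_to_const_def by blast
  obtain C3 where C3: "\<And>r. \<rho> < r \<Longrightarrow> r < R \<Longrightarrow> Z r (f - fls_const a) \<le> T r f + C3"
    using zeros_sub_const[OF f'(1,4)] unfolding le_up_to_const_def by blast
  obtain C4 where C4: "\<And>r. \<rho> < r \<Longrightarrow> r < R \<Longrightarrow> Z r (g - fls_const a) \<le> T r g + C4"
    using zeros_sub_const[OF g'(1,4)] unfolding le_up_to_const_def by blast
  show ?thesis
  proof (rule le_up_to_constI)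
    fix r assume r: "\<rho> < r" "r < R"
    have M: "f - fls_const a \<in> M" "g - fls_const a \<in> M" using f' g' by (auto intro: mero_intros)
    note lf = char_fun_defect(2)[OF f] char_fun_defect(2)[OF g] zero_divisor_locfin[OF f'(1)]
      zero_divisor_locfin[OF g'(1)] zero_divisor_locfin[OF M(1)] zero_divisor_locfin[OF M(2)]
      zero_divisor_locfin[OF \<alpha>(1)] pole_divisor_locfin[OF \<alpha>(1)]
    have "12 * (counting \<rho> r (\<lambda>\<gamma>. of_int (defect f \<gamma>)) + counting \<rho> r (\<lambda>\<gamma>. of_int (defect g \<gamma>)))
        = counting \<rho> r (\<lambda>\<gamma>. 12 * (of_int (defect f \<gamma>) + of_int (defect g \<gamma>)))"
      by (simp only: counting_cmult counting_add[OF lf(1,2) r(2)])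
    also have "\<dots> \<le> counting \<rho> r (\<lambda>\<gamma>. 2 * zero_divisor R f \<gamma> + 3 * zero_divisor R (f - fls_const a) \<gamma>
      + 2 * zero_divisor R g \<gamma> + 3 * zero_divisor R (g - fls_const a) \<gamma> + 24 * zero_divisor R \<alpha> \<gamma> + 24 * pole_divisor R \<alpha> \<gamma>)"
    proof (intro counting_leI divisor_locfin_add divisor_locfin_cmult lf r)
      fix \<gamma> :: 'k assume \<gamma>: "absval \<gamma> < R"
      have "real_of_int (12 * (defect f \<gamma> + defect g \<gamma>)) \<le> real_of_int (2 * max (ord \<gamma> f) 0 + 3 * max (ord \<gamma> (f - fls_const a)) 0
        + 2 * max (ord \<gamma> g) 0 + 3 * max (ord \<gamma> (g - fls_const a)) 0 + 24 * max (ord \<gamma> \<alpha>) 0 + 24 * max (- ord \<gamma> \<alpha>) 0)"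
        using product_one_local[OF f g \<gamma> 1] by (simp only: of_int_le_iff)
      then show "12 * (real_of_int (defect f \<gamma>) + real_of_int (defect g \<gamma>)) \<le> 2 * zero_divisor R f \<gamma> + 3 * zero_divisor R (f - fls_const a) \<gamma>
        + 2 * zero_divisor R g \<gamma> + 3 * zero_divisor R (g - fls_const a) \<gamma> + 24 * zero_divisor R \<alpha> \<gamma> + 24 * pole_divisor R \<alpha> \<gamma>"
        unfolding zero_divisor_def pole_divisor_def by (simp only: of_int_add of_int_mult of_int_numeral)
    qed
    also have "\<dots> = 2 * Z r f + 3 * Z r (f - fls_const a) + 2 * Z r g + 3 * Z r (g - fls_const a) + 24 * Z r \<alpha> + 24 * N r \<alpha>"
      using lf by (simp add: counting_add[OF _ _ r(2)] counting_cmult divisor_locfin_add divisor_locfin_cmult)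
    finally show "7 * (T r f + T r g) \<le> 48 * T r \<alpha> + (12 * C1 + 12 * C2 + 3 * C3 + 3 * C4)"
      using C1[OF r] C2[OF r] C3[OF r] C4[OF r] T_ge(1)[of r f] T_ge(1)[of r g] T_ge[of r \<alpha>] by argo
  qed
qed

text \<open>\<open>Psi f\<close> takes the value \<open>s\<close> where \<open>Psi g\<close>
  vanishes. The second main theorem for 0, \<open>s\<close> and infinity counts every point once:
  poles of \<open>f\<close>, zeros of \<open>f\<close> and \<open>f - b\<close>, zeros of
  \<open>g\<close> and \<open>g - b\<close>, hence 3 and 2.\<close>

lemma equal_derivatives:
  assumes f: "nonconst f" and g: "nonconst g" and s: "Psi f = Psi g + fls_const s" "s \<noteq> 0"
  shows "(\<lambda>r. real (n + 2) * T r f) \<lesssim> (\<lambda>r. 3 * T r f + 2 * T r g)"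
proof -
  note f' = nonconstD[OF f] and g' = nonconstD[OF g]
  note P = Psi_mero[OF f'(1)] Psi_deriv_nonzero[OF f]
  have P0: "Psi f \<noteq> 0" using P(2) by auto
  define h where "h = (Psi f - fls_const s) / fls_deriv (Psi f)"
  have h: "h \<in> M" unfolding h_def using P by (intro mero_intros)
  have "(\<lambda>r. real (n + 2) * T r f) \<lesssim> (\<lambda>r. T r (Psi f))"
    using char_fun_power_mult[OF f'(1,3,4), where b = b and k = "n + 1"]
    by (simp only: Psi_def Suc_eq_plus1 add.assoc one_add_one)
  then obtain C0 where C0: "\<And>r. \<rho> < r \<Longrightarrow> r < R \<Longrightarrow> real (n + 2) * T r f \<le> T r (Psi f) + C0"
    unfolding le_up_to_const_def by blast
  obtain C1 where C1: "\<And>r. \<rho> < r \<Longrightarrow> r < R \<Longrightarrow> T r (Psi f) \<le> Z r (Psi f) + max 0 (- ln (nrm r (Psi f))) + C1"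
    using char_fun_zeros(1)[OF P(1) P0] unfolding le_up_to_const_def by blast
  obtain C2 where C2: "\<And>r. \<rho> < r \<Longrightarrow> r < R \<Longrightarrow> max 0 (- ln (nrm r (Psi f))) \<le> counting \<rho> r (ordr h) + C2"
    using three_values(1)[OF P s(2)] unfolding le_up_to_const_def h_def by blast
  obtain C3 where C3: "\<And>r. \<rho> < r \<Longrightarrow> r < R \<Longrightarrow> Z r (f - fls_const b) \<le> T r f + C3"
    using zeros_sub_const[OF f'(1,4)] unfolding le_up_to_const_def by blast
  obtain C4 where C4: "\<And>r. \<rho> < r \<Longrightarrow> r < R \<Longrightarrow> Z r (g - fls_const b) \<le> T r g + C4"
    using zeros_sub_const[OF g'(1,4)] unfolding le_up_to_const_def by blast
  show ?thesis
  proof (rule le_up_to_constI)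
    fix r assume r: "\<rho> < r" "r < R"
    have M: "f - fls_const b \<in> M" "g - fls_const b \<in> M" using f' g' by (auto intro: mero_intros)
    note lf = zero_divisor_locfin[OF P(1)] ord_locfin[OF h] pole_divisor_locfin[OF f'(1)]
      zero_divisor_locfin[OF f'(1)] zero_divisor_locfin[OF M(1)] zero_divisor_locfin[OF g'(1)]
      zero_divisor_locfin[OF M(2)]
    have "Z r (Psi f) + counting \<rho> r (ordr h) = counting \<rho> r (\<lambda>\<gamma>. zero_divisor R (Psi f) \<gamma> + ordr h \<gamma>)"
      by (rule counting_add[OF lf(1,2) r(2), symmetric])
    also have "\<dots> \<le> counting \<rho> r (\<lambda>\<gamma>. pole_divisor R f \<gamma> + zero_divisor R f \<gamma> + zero_divisor R (f - fls_const b) \<gamma>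
      + zero_divisor R g \<gamma> + zero_divisor R (g - fls_const b) \<gamma>)"
    proof (intro counting_leI divisor_locfin_add lf r)
      fix \<gamma> :: 'k assume \<gamma>: "absval \<gamma> < R"
      define X Y where "X = int n * ord \<gamma> f" and "Y = int n * ord \<gamma> g"
      note L = local_orders[OF f \<gamma>, folded X_def] and L' = local_orders[OF g \<gamma>, folded Y_def]
      note l = three_values_local[OF P \<gamma> s(2), folded h_def]
      have e: "Psi f - fls_const s = Psi g" using s(1) by simp
      have "max (ord \<gamma> (Psi f)) 0 + ord \<gamma> h \<le> max (- ord \<gamma> f) 0 + max (ord \<gamma> f) 0 + max (ord \<gamma> (f - fls_const b)) 0
        + max (ord \<gamma> g) 0 + max (ord \<gamma> (g - fls_const b)) 0"
      proof -
        have p: "ord \<gamma> (Psi f) < 0 \<Longrightarrow> max (- ord \<gamma> f) 0 \<ge> 1"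
          using L by (cases "ord \<gamma> f < 0"; cases "ord \<gamma> f = 0") auto
        have z: "ord \<gamma> (Psi f) > 0 \<Longrightarrow> max (ord \<gamma> f) 0 + max (ord \<gamma> (f - fls_const b)) 0 \<ge> 1"
          using L by (cases "ord \<gamma> f < 0"; cases "ord \<gamma> f = 0") auto
        have z': "ord \<gamma> (Psi g) > 0 \<Longrightarrow> max (ord \<gamma> g) 0 + max (ord \<gamma> (g - fls_const b)) 0 \<ge> 1"
          using L' by (cases "ord \<gamma> g < 0"; cases "ord \<gamma> g = 0") auto
        have "max (- ord \<gamma> f) 0 \<ge> 0" "max (ord \<gamma> f) 0 + max (ord \<gamma> (f - fls_const b)) 0 \<ge> 0"
          "max (ord \<gamma> g) 0 + max (ord \<gamma> (g - fls_const b)) 0 \<ge> 0" by simp_all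
        moreover consider "ord \<gamma> (Psi f) < 0" | "ord \<gamma> (Psi f) > 0" | "ord \<gamma> (Psi f) = 0" "ord \<gamma> (Psi g) > 0"
          | "ord \<gamma> (Psi f) = 0" "ord \<gamma> (Psi g) \<le> 0" by linarith
        then have "max (ord \<gamma> (Psi f)) 0 + ord \<gamma> h \<le> (if ord \<gamma> (Psi f) < 0 \<or> ord \<gamma> (Psi f) > 0 \<or> ord \<gamma> (Psi g) > 0 then 1 else 0)"
          by cases (use l in \<open>auto simp: e\<close>)
        ultimately show ?thesis using p z z'
          by (cases "ord \<gamma> (Psi f) < 0"; cases "ord \<gamma> (Psi f) > 0"; cases "ord \<gamma> (Psi g) > 0") simp_all
      qed
      then have "real_of_int (max (ord \<gamma> (Psi f)) 0 + ord \<gamma> h) \<le> real_of_int (max (- ord \<gamma> f) 0 + max (ord \<gamma> f) 0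
        + max (ord \<gamma> (f - fls_const b)) 0 + max (ord \<gamma> g) 0 + max (ord \<gamma> (g - fls_const b)) 0)"
        by (simp only: of_int_le_iff)
      then show "zero_divisor R (Psi f) \<gamma> + ordr h \<gamma> \<le> pole_divisor R f \<gamma> + zero_divisor R f \<gamma>
        + zero_divisor R (f - fls_const b) \<gamma> + zero_divisor R g \<gamma> + zero_divisor R (g - fls_const b) \<gamma>"
        unfolding zero_divisor_def pole_divisor_def by (simp only: of_int_add)
    qed
    also have "\<dots> = N r f + Z r f + Z r (f - fls_const b) + Z r g + Z r (g - fls_const b)"
      using lf by (simp add: counting_add[OF _ _ r(2)] divisor_locfin_add)
    finally show "real (n + 2) * T r f \<le> (3 * T r f + 2 * T r g) + (C0 + C1 + C2 + C3 + C4)"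
      using C0[OF r] C1[OF r] C2[OF r] C3[OF r] C4[OF r] T_ge[of r f] T_ge(1)[of r g] by linarith
  qed
qed

text \<open>With \<open>f = h * g\<close> the equation becomes linear in \<open>g\<close> after
  cancelling a power of \<open>g\<close>. Its coefficient \<open>h ^ (n + 2) - 1\<close> is nonzero,
  as otherwise \<open>h ^ (n + 1) = 1\<close> too and \<open>h\<close> would be 1.\<close>

lemma equal_Psi:
  assumes f: "nonconst f" and g: "nonconst g" and eq: "Psi f = Psi g" and ne: "f \<noteq> g"
  shows "f = fls_const b * (((f / g) ^ (n + 1) - 1) / ((f / g) ^ (n + 2) - 1)) * (f / g)"
    and "g = fls_const b * (((f / g) ^ (n + 1) - 1) / ((f / g) ^ (n + 2) - 1))"
proof -
  note f' = nonconstD[OF f] and g' = nonconstD[OF g]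
  define h where "h = f / g"
  have fh: "f = h * g" using g'(3) by (simp add: h_def)
  have h1: "h \<noteq> 1" using ne fh by auto
  have "g ^ (n + 1) * (h ^ (n + 1) * (h * g - fls_const b)) = g ^ (n + 1) * (g - fls_const b)"
    using eq unfolding Psi_def fh by (simp only: power_mult_distrib mult_ac)
  then have "h ^ (n + 1) * (h * g - fls_const b) = g - fls_const b"
    using g'(3) by (simp only: mult_cancel_left power_eq_0_iff) simp
  then have key: "g * (h ^ (n + 2) - 1) = fls_const b * (h ^ (n + 1) - 1)"
    by (simp add: algebra_simps)
  have nz: "h ^ (n + 2) - 1 \<noteq> 0"
  proof
    assume 0: "h ^ (n + 2) - 1 = 0"
    then have 1: "h ^ (n + 1) = 1" using key b_nonzero by simp
    have "h ^ (n + 2) = h * h ^ (n + 1)" by simp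
    then show False using 0 1 h1 by (simp del: power_Suc)
  qed
  show g: "g = fls_const b * (((f / g) ^ (n + 1) - 1) / ((f / g) ^ (n + 2) - 1))"
    unfolding h_def[symmetric] times_divide_eq_right by (rule nonzero_eq_divide_eq[OF nz, THEN iffD2, OF key])
  show "f = fls_const b * (((f / g) ^ (n + 1) - 1) / ((f / g) ^ (n + 2) - 1)) * (f / g)"
    unfolding g[symmetric] using g'(3) by simp
qed

text \<open>\<open>T r \<alpha>\<close> is negligible against \<open>T r f\<close>, which exceeds
  every bound, so it cannot dominate a positive multiple of \<open>S r\<close>. The parameter
  \<open>S\<close> lets one argument serve a single function and a sum of two.\<close>

lemma growth_contradiction:
  assumes unb: "\<And>B. \<forall>\<^sub>F r in at_left R. T r f > B"
    and small: "\<And>\<epsilon>. \<epsilon> > 0 \<Longrightarrow> \<forall>\<^sub>F r in at_left R. T r \<alpha> \<le> \<epsilon> * T r f"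
    and S: "\<And>r. T r f \<le> S r" and d: "d > 0" and c: "c \<ge> 0"
    and le: "(\<lambda>r. d * S r) \<lesssim> (\<lambda>r. c * T r \<alpha>)"
  shows False
proof -
  obtain C where C: "\<And>r. \<rho> < r \<Longrightarrow> r < R \<Longrightarrow> d * S r \<le> c * T r \<alpha> + C"
    using le unfolding le_up_to_const_def by blast
  \<comment> \<open>Makes \<open>c * \<epsilon> \<le> d / 2\<close>; the summand 1 keeps the
    denominator positive when \<open>c = 0\<close>.\<close>
  define \<epsilon> where "\<epsilon> = d / (2 * (c + 1))"
  have \<epsilon>: "\<epsilon> > 0" using c d by (simp add: \<epsilon>_def)
  have c\<epsilon>: "c * \<epsilon> \<le> d / 2" using c d by (simp add: \<epsilon>_def field_simps)
  have "\<forall>\<^sub>F r in at_left R. False"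
    using unb[of "2 * \<bar>C\<bar> / d"] small[OF \<epsilon>] eventually_at_left_real[OF \<rho>(2)]
  proof eventually_elim
    case (elim r)
    have r: "\<rho> < r" "r < R" using elim(3) by auto
    have T0: "T r f \<ge> 0" using elim(1) d by (meson abs_ge_zero divide_nonneg_pos less_le_trans less_imp_le mult_nonneg_nonneg order_trans zero_le_numeral)
    have "c * T r \<alpha> \<le> c * (\<epsilon> * T r f)" using elim(2) c by (rule mult_left_mono)
    also have "\<dots> = (c * \<epsilon>) * T r f" by simp
    also have "\<dots> \<le> d / 2 * T r f" using c\<epsilon> T0 by (rule mult_right_mono)
    finally have "d * S r \<le> d / 2 * T r f + C" using C[OF r] by linarith
    moreover have "d * T r f \<le> d * S r" using S[of r] d by (intro mult_left_mono) auto
    moreover have "2 * \<bar>C\<bar> < d * T r f" using elim(1) d by (simp add: pos_divide_less_eq mult.commute)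
    ultimately show ?case by linarith
  qed
  then show False by (simp add: eventually_False trivial_limit_at_left_real)
qed

section \<open>Combination of the cases\<close>

lemma sharing_conclusion:
  assumes f: "nonconst f" and g: "nonconst g"
    and unb: "\<And>B. \<forall>\<^sub>F r in at_left R. T r f > B" "\<And>B. \<forall>\<^sub>F r in at_left R. T r g > B"
    and small: "\<And>\<epsilon>. \<epsilon> > 0 \<Longrightarrow> \<forall>\<^sub>F r in at_left R. T r \<alpha> \<le> \<epsilon> * T r f"
      "\<And>\<epsilon>. \<epsilon> > 0 \<Longrightarrow> \<forall>\<^sub>F r in at_left R. T r \<alpha> \<le> \<epsilon> * T r g"
    and sh: "Phi f \<noteq> \<alpha> \<Longrightarrow> Phi g \<noteq> \<alpha> \<Longrightarrow> shares f g"
  shows "f = g \<or> (\<exists>h\<in>M. f = fls_const b * ((h ^ (n + 1) - 1) / (h ^ (n + 2) - 1)) * h \<and>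
    g = fls_const b * ((h ^ (n + 1) - 1) / (h ^ (n + 2) - 1)))"
proof -
  have d: "fls_deriv (Phi h / \<alpha>) \<noteq> 0"
    if h: "nonconst h" "\<And>B. \<forall>\<^sub>F r in at_left R. T r h > B"
      "\<And>\<epsilon>. \<epsilon> > 0 \<Longrightarrow> \<forall>\<^sub>F r in at_left R. T r \<alpha> \<le> \<epsilon> * T r h" for h
  proof
    assume "fls_deriv (Phi h / \<alpha>) = 0"
    then obtain C where C: "\<And>r. \<rho> < r \<Longrightarrow> r < R \<Longrightarrow> real (n + 2) * T r h \<le> 2 * T r h + 2 * T r \<alpha> + C"
      using constant_quotient[OF h(1)] unfolding le_up_to_const_def by blast
    have "(\<lambda>r. real n * T r h) \<lesssim> (\<lambda>r. 2 * T r \<alpha>)"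
      by (rule le_up_to_constI[where C = C]) (use C in \<open>force simp: distrib_right\<close>)
    then show False using growth_contradiction[OF h(2,3), of "\<lambda>r. T r h" "real n" 2] n by simp
  qed
  note df = d[OF f unb(1) small(1)] and dg = d[OF g unb(2) small(2)]
  have "Phi f \<noteq> \<alpha>" "Phi g \<noteq> \<alpha>" using df dg \<alpha> by auto
  note sh = sh[OF this]
  then have sh': "shares g f" by (simp add: shares_def)
  have T0: "T r h \<ge> 0" if "\<rho> < r" for r h using char_fun_nonneg[OF \<rho>(1), of r h] that by simp
  \<comment> \<open>\<open>max 0\<close> secures \<open>T r f \<le> S r\<close> for every real
    \<open>r\<close>; nonnegativity of \<open>T r g\<close> is at hand only for
    \<open>r > \<rho>\<close>.\<close>
  define S where "S r = T r f + max 0 (T r g)" for r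
  have S: "T r f \<le> S r" for r by (simp add: S_def)
  have SE: "S r = T r f + T r g" if "\<rho> < r" for r using T0[OF that, of g] by (simp add: S_def)
  have contra: False if "d > 0" "c \<ge> 0" "\<And>r. \<rho> < r \<Longrightarrow> r < R \<Longrightarrow> d * (T r f + T r g) \<le> c * T r \<alpha> + C" for d c C
  proof (rule growth_contradiction[OF unb(1) small(1) S that(1,2)])
    show "(\<lambda>r. d * S r) \<lesssim> (\<lambda>r. c * T r \<alpha>)"
      by (rule le_up_to_constI[where C = C]) (use that(3) SE in auto)
  qed
  have scale: "12 * (x + y) \<le> real n * x + real n * y" if "x \<ge> 0" "y \<ge> 0" for x y :: real
    using mult_right_mono[of 12 "real n" x] mult_right_mono[of 12 "real n" y] that n by simp
  have "Phi f = Phi g"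
  proof (rule ccontr)
    assume ne: "Phi f \<noteq> Phi g"
    show False
    proof (cases "Phi f * Phi g = \<alpha>\<^sup>2")
      case True
      then show False using product_one[OF f g True] contra[of 7 48] unfolding le_up_to_const_def by auto
    next
      case False
      obtain C1 where C1: "\<And>r. \<rho> < r \<Longrightarrow> r < R \<Longrightarrow> real (n + 2) * T r f \<le> 6 * T r f + 7 * T r g + 9 * T r \<alpha> + C1"
        using main_inequality[OF f g df dg sh ne False] unfolding le_up_to_const_def by blast
      obtain C2 where C2: "\<And>r. \<rho> < r \<Longrightarrow> r < R \<Longrightarrow> real (n + 2) * T r g \<le> 6 * T r g + 7 * T r f + 9 * T r \<alpha> + C2"
        using main_inequality[OF g f dg df sh' ne[symmetric]] False unfolding le_up_to_const_def
        by (auto simp: mult.commute)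
      \<comment> \<open>Sum of the two inequalities: \<open>n + 2 \<ge> 14\<close> against
        \<open>6 + 7 = 13\<close> leaves a factor 1.\<close>
      have "1 * (T r f + T r g) \<le> 18 * T r \<alpha> + (C1 + C2)" if r: "\<rho> < r" "r < R" for r
        using C1[OF r] C2[OF r] scale[OF T0 T0, OF r(1) r(1), of f g] by (simp add: distrib_right)
      then show False using contra[of 1 18 "C1 + C2"] by simp
    qed
  qed
  then have "fls_deriv (Psi f) = fls_deriv (Psi g)" by (simp add: deriv_Psi)
  then obtain s where s: "Psi f = Psi g + fls_const s"
    unfolding fls_deriv_eq_iff_ex by (auto simp: add.commute)
  have "s = 0"
  proof (rule ccontr)
    assume s0: "s \<noteq> 0"
    obtain C1 where C1: "\<And>r. \<rho> < r \<Longrightarrow> r < R \<Longrightarrow> real (n + 2) * T r f \<le> 3 * T r f + 2 * T r g + C1"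
      using equal_derivatives[OF f g s s0] unfolding le_up_to_const_def by blast
    have s': "Psi g = Psi f + fls_const (- s)" "- s \<noteq> 0" using s s0 by simp_all
    obtain C2 where C2: "\<And>r. \<rho> < r \<Longrightarrow> r < R \<Longrightarrow> real (n + 2) * T r g \<le> 3 * T r g + 2 * T r f + C2"
      using equal_derivatives[OF g f s'] unfolding le_up_to_const_def by blast
    have "1 * (T r f + T r g) \<le> 0 * T r \<alpha> + (C1 + C2)" if r: "\<rho> < r" "r < R" for r
      using C1[OF r] C2[OF r] scale[OF T0 T0, OF r(1) r(1), of f g] T0[OF r(1), of f] T0[OF r(1), of g]
      by (simp add: distrib_right)
    then show False using contra[of 1 0 "C1 + C2"] by simp
  qed
  then have "Psi f = Psi g" using s by simp
  then show ?thesis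
    using equal_Psi[OF f g] mero_divide[OF nonconstD(1)[OF f] nonconstD(1)[OF g]] by blast
qed

end

theorem theorem10:
  fixes R :: real
    and f g \<alpha> :: "'k::{ultrametric_field, complete_space, alg_closed_field, field_char_0} fls"
    and a :: 'k
    and n :: nat
  assumes "R > 0"
    and "f \<in> unbdd_mero_disk R" and "g \<in> unbdd_mero_disk R"
    and "\<alpha> \<in> mero_disk R" and "\<alpha> \<noteq> 0"
    and "small_wrt R \<alpha> f" and "small_wrt R \<alpha> g"
    and "a \<noteq> 0" and "n \<ge> 12"
    and "share_CM R (fls_deriv f * f ^ n * (f - fls_const a))
                    (fls_deriv g * g ^ n * (g - fls_const a)) \<alpha>"
  shows "f = g \<or>
    (\<exists>h \<in> mero_disk R.
       f = fls_const (a * of_nat (n + 2) / of_nat (n + 1))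
             * ((h ^ (n + 1) - 1) / (h ^ (n + 2) - 1)) * h \<and>
       g = fls_const (a * of_nat (n + 2) / of_nat (n + 1))
             * ((h ^ (n + 1) - 1) / (h ^ (n + 2) - 1)))"
proof -
  interpret ultrametric_disk R "TYPE('k)" by (rule ultrametric_disk_of_unbounded[OF assms(1,2)])
  obtain \<rho>1 where \<rho>1: "\<rho>1 < R" "\<And>\<rho> \<epsilon>. \<rho>1 < \<rho> \<Longrightarrow> 0 < \<rho> \<Longrightarrow> \<rho> < R \<Longrightarrow> \<epsilon> > 0 \<Longrightarrow>
    \<forall>\<^sub>F r in at_left R. char_fun R \<rho> r \<alpha> \<le> \<epsilon> * char_fun R \<rho> r f"
    using small_wrt_char_fun[OF assms(6,2,4)] by blast
  obtain \<rho>2 where \<rho>2: "\<rho>2 < R" "\<And>\<rho> \<epsilon>. \<rho>2 < \<rho> \<Longrightarrow> 0 < \<rho> \<Longrightarrow> \<rho> < R \<Longrightarrow> \<epsilon> > 0 \<Longrightarrow>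
    \<forall>\<^sub>F r in at_left R. char_fun R \<rho> r \<alpha> \<le> \<epsilon> * char_fun R \<rho> r g"
    using small_wrt_char_fun[OF assms(7,3,4)] by blast
  have "max 0 (max \<rho>1 \<rho>2) < R" using \<rho>1(1) \<rho>2(1) assms(1) by simp
  \<comment> \<open>One base radius for both functions, beyond the origins used in the two smallness
    conditions.\<close>
  then obtain \<rho> where "max 0 (max \<rho>1 \<rho>2) < \<rho>" and \<rho>R: "\<rho> < R" using dense_order_class.dense by blast
  then have \<rho>': "\<rho>1 < \<rho>" "\<rho>2 < \<rho>" "0 < \<rho>" by simp_all
  interpret sharing R "TYPE('k)" \<rho> \<alpha> a n
    by standard (use \<rho>R \<rho>' assms in auto)
  \<comment> \<open>A function with zero derivative is constant, and constants are quotients of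
    bounded series.\<close>
  have nc: "nonconst h" if h: "h \<in> unbdd_mero_disk R" for h :: "'k fls"
  proof -
    have hM: "h \<in> mero_disk R" "h \<notin> bdd_mero_disk R" using h by (auto simp: unbdd_mero_disk_def)
    have "fls_deriv h \<noteq> 0"
    proof
      assume "fls_deriv h = 0"
      then obtain c where c: "h = fls_const c" unfolding fls_deriv_eq_0_iff by blast
      have "fps_const c \<in> bdd_analytic_disk R" "(1 :: 'k fps) \<in> bdd_analytic_disk R"
        using conv_at_bdd[of R "fps_const c"] conv_at_bdd[of R "1 :: 'k fps"]
        by (simp_all add: bdd_analytic_disk_def)
      moreover have "h = fps_to_fls (fps_const c) / fps_to_fls 1" using c by simp
      ultimately show False using hM(2) unfolding bdd_mero_disk_def using one_neq_zero by blast
    qed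
    then show ?thesis using hM by (simp add: nonconst_def)
  qed
  have sh: "shares f g" if "Phi f \<noteq> \<alpha>" "Phi g \<noteq> \<alpha>"
    unfolding shares_def
  proof (intro allI impI)
    fix \<gamma> :: 'k assume "absval \<gamma> < R"
    then have "zero_mult R \<gamma> (Phi f - \<alpha>) = zero_mult R \<gamma> (Phi g - \<alpha>)"
      using assms(10) by (simp add: share_CM_def open_disk_def Phi_def)
    then show "nat (ord \<gamma> (Phi f - \<alpha>)) = nat (ord \<gamma> (Phi g - \<alpha>))"
      using that by (simp add: zero_mult_def)
  qed
  show ?thesis
    by (rule sharing_conclusion[unfolded b_def, OF nc[OF assms(2)] nc[OF assms(3)]
        char_fun_unbounded[OF assms(2) \<rho>'(3) \<rho>R] char_fun_unbounded[OF assms(3) \<rho>'(3) \<rho>R]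
        \<rho>1(2)[OF \<rho>'(1,3) \<rho>R] \<rho>2(2)[OF \<rho>'(2,3) \<rho>R] sh])
qed

end
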